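(* Let $n\ge 1$, and let $\pi,\theta\in B_n$ be two signed permutations with $s(\pi)=s(\theta)=k$. Then: (1) if $m(\pi)=m(\theta)=0$, then $\pi$ and $\theta$ are $([.]--[.])$-equivalent, and for every finite group $G$, $\Pr_\pi(G)=\Pr_\theta(G)=\Pr^{n-k+1}(G)$; (2) if $m(\pi)>0$ and $m(\theta)>0$, then $\pi$ and $\theta$ are $([.]--[.])$-equivalent, and for every finite group $G$, $\Pr_\pi(G)=\Pr_\theta(G)=\Pr^{-(n-k+1)}(G)$.
   Context: Probabilities. For a finite group $G$, $\Pr(\cdot)$ is the probability over independent uniformly random elements $a_1,a_2,\dots$ of $G$. For $m\ge 0$, $\Pr^{m}(G)=\Pr(a_1a_2\cdots a_m=a_ma_{m-1}\cdots a_1)$ (so $\Pr^0(G)=1$). For $m\ge 1$, $\Pr^{-m}(G)=\Pr(a_1\cdots a_m=a_1^{-1}\cdots a_m^{-1})$. For $\pi\in B_n$, $\Pr_\pi(G)=\Pr(a_1\cdots a_n=a_{|\pi_1|}^{\epsilon_1}\cdots a_{|\pi_n|}^{\epsilon_n})$, where $\epsilon_i=1$ if $\pi_i$ is positive and $\epsilon_i=-1$ if $\pi_i$ is negative. Signed permutations. $B_n$ is the group of permutations $\pi$ of $\{\pm1,\dots,\pm n\}$ with $\pi_{-i}=-\pi_i$. $m(\pi)$ is the number of $1\le i\le n$ with $\pi_i<0$. Let $H_n=\{+0,+1,\dots,+n,-0,-1,\dots,-n\}$ ($2n+2$ distinct elements), with negation $-(+j)=-j$, $-(-j)=+j$, sign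 $(+)$ for $+j$ and $(-)$ for $-j$ (including $j=0$), and $|\pm j|=j$. Extend $\pi$ by $\pi_{+0}=+0$, $\pi_{-0}=-0$. The successor $i\mapsto i+1$ on $H_n$ is $+0\mapsto+1\mapsto\cdots\mapsto+n\mapsto+0$ and $-n\mapsto-(n-1)\mapsto\cdots\mapsto-1\mapsto-0\mapsto-n$. Breakpoint graph. $\mathrm{Gr}(\pi)$ has vertex set $H_n$, gray edges $\{i,-(i+1)\}$ and black edges $\{\pi_i,\pi_{-(i+1)}\}$ for $i\in H_n$ (undirected; each colour class is a perfect matching). $s(\pi)$ is the number of cycles of $\mathrm{Gr}(\pi)$ alternating between black and gray edges. Let $\pi^*$ be the permutation of $H_n$ with cycles $(\pi_{+n},\pi_{+(n-1)},\dots,\pi_{+1},\pi_{+0})$ and $(\pi_{-0},\pi_{-1},\dots,\pi_{-n})$, where $(c_1,c_2,\dots)$ sends $c_1\mapsto c_2$; write $u\to v$ for $\pi^*(u)=v$. Then $\pi^*$ determines $\pi$ (read the cycle containing $+0$), and the black edges are $\{-u,\pi^*(u)\}$. Exchange. Let $x,y,z,w\in H_n$, $y\ne x$, $y\neq x+1$, with black edges $\{-z,x\},\{-(x+1),y\},\{-y,w\}$ in $\mathrm{Gr}(\pi)$. The $([x]--[y])$-exchange operation produces the $\theta\in B_n$ (when it exists) whose graph $\mathrm{Gr}(\theta)$ has instead the black edges $\{-z,y\},\{-y,x\},\{-(x+1),w\}$, all other edges being unchanged (if $x=w$, equivalently $y=z$, it leaves $\pi$ unchanged). Cyclic. The $([x]--[y])$-cyclic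 operation replaces $\pi^*$ by $\theta^*=\sigma\pi^*\sigma^{-1}$ and $\pi$ by the corresponding $\theta\in B_n$, where $\sigma$ is a bijection of $H_n$ with $\sigma(-t)=-\sigma(t)$. Put $p=|x|$, $q=|y|$. Below, only the non-fixed values of $\sigma$ on elements of sign $(+)$ are listed, written as integers; when $p=n$, the label $p+1=n+1$ denotes $0$ (but is treated as $n+1$ in inequalities and ranges). (A) $x=+p$ and $x+1\to y\to x$: if $y=+q$, $q>p+1$: $p+1\mapsto q-1$, $t\mapsto t-1$ for $p+2\le t\le q-1$; if $y=+q$, $q<p$: $p\mapsto q+1$, $t\mapsto t+1$ for $q+1\le t\le p-1$; if $y=-q$, $q>p+1$: $p+1\mapsto -q$, $t\mapsto t-1$ for $p+2\le t\le q$; if $y=-q$, $q<p$: $p\mapsto -q$, $t\mapsto t+1$ for $q\le t\le p-1$. (B) $x=+p$ and $-(x+1)\to y\to x$: if $y=+q$, $q>p+1$: $p+1\mapsto q-1$, $t\mapsto t-1$ for $p+2\le t\le q-1$; if $y=+q$, $q<p$: $p+1\mapsto q$, $t\mapsto t+1$ for $q\le t\le p$; if $y=-q$, $q>p+1$: $p+1\mapsto -q$, $t\mapsto t-1$ for $p+2\le t\le q$; if $y=-q$, $q<p$: $p+1\mapsto -(q+1)$, $t\mapsto t+1$ for $q+1\le t\le p$. (C) $x=-p$ and $+(p+1)\to y\to x$: if $y=+q$, $q>p+1$: $p\mapsto q$, $t\mapsto t-1$ for $p+1\le t\le q$; if $y=+q$, $q<p$: $p\mapsto q+1$, $t\mapsto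 t+1$ for $q+1\le t\le p-1$; if $y=-q$, $q>p+1$: $p\mapsto -(q-1)$, $t\mapsto t-1$ for $p+1\le t\le q-1$; if $y=-q$, $q<p$: $p\mapsto -q$, $t\mapsto t+1$ for $q\le t\le p-1$. Sign-change. Let $0\le p\le n$ (with $p+1$ read as $0$ if $p=n$) and suppose either $+p\to-(p+1)$ and $+(p+1)\to-p$, or $-p\to+(p+1)$ and $-(p+1)\to+p$, in $\pi^*$. The $([p]--[p+1])$-sign-change operation interchanges $+p$ with $-p$ and $+(p+1)$ with $-(p+1)$ in the cycles of $\pi^*$, giving $\theta^*$ and hence $\theta\in B_n$. Equivalence. $\pi,\theta\in B_n$ are $([.]--[.])$-equivalent if one of them can be obtained from the other by a finite (possibly empty) sequence of exchange, cyclic and sign-change operations. *)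

theory Defs
  imports
    "HOL-Algebra.Group"
    "HOL-Combinatorics.Cycles"
    "HOL-Probability.Product_PMF"
begin

section \<open>Signed permutations and the set \<open>H\<^sub>n\<close>\<close>

definition signed_perms :: "nat \<Rightarrow> (int \<Rightarrow> int) set" where
  "signed_perms n =
     {\<pi>. \<pi> permutes ({- int n..int n} - {0}) \<and> (\<forall>i. \<pi> (- i) = - \<pi> i)}"

definition neg_count :: "nat \<Rightarrow> (int \<Rightarrow> int) \<Rightarrow> nat" where
  "neg_count n \<pi> = card {i \<in> {1..int n}. \<pi> i < 0}"

text \<open>\<open>Pos 0\<close> and \<open>Neg 0\<close> are the two distinct elements \<open>+0\<close> and \<open>-0\<close>.\<close>

datatype signed_nat = Pos nat | Neg nat

definition H :: "nat \<Rightarrow> signed_nat set" where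
  "H n = Pos ` {0..n} \<union> Neg ` {0..n}"

primrec neg :: "signed_nat \<Rightarrow> signed_nat" where
  "neg (Pos j) = Neg j"
| "neg (Neg j) = Pos j"

primrec nxt :: "nat \<Rightarrow> signed_nat \<Rightarrow> signed_nat" where
  "nxt n (Pos j) = (if j = n then Pos 0 else Pos (j + 1))"
| "nxt n (Neg j) = (if j = 0 then Neg n else Neg (j - 1))"

text \<open>Only used for nonzero integers.\<close>

definition signed_of_int :: "int \<Rightarrow> signed_nat" where
  "signed_of_int i = (if i > 0 then Pos (nat i) else Neg (nat (- i)))"

primrec ext :: "(int \<Rightarrow> int) \<Rightarrow> signed_nat \<Rightarrow> signed_nat" where
  "ext \<pi> (Pos j) = (if j = 0 then Pos 0 else signed_of_int (\<pi> (int j)))"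
| "ext \<pi> (Neg j) = (if j = 0 then Neg 0 else signed_of_int (\<pi> (- int j)))"


section \<open>The breakpoint graph\<close>

definition gray_edges :: "nat \<Rightarrow> signed_nat set set" where
  "gray_edges n = {{i, neg (nxt n i)} | i. i \<in> H n}"

definition black_edges :: "nat \<Rightarrow> (int \<Rightarrow> int) \<Rightarrow> signed_nat set set" where
  "black_edges n \<pi> = {{ext \<pi> i, ext \<pi> (neg (nxt n i))} | i. i \<in> H n}"

text \<open>
  The list of successive vertices of a cycle whose edges are alternately black and gray, starting
  with a black one; a black edge parallel to a gray one forms such a cycle of length 2.
\<close>

definition alternating_cycle :: "nat \<Rightarrow> (int \<Rightarrow> int) \<Rightarrow> signed_nat list \<Rightarrow> bool" where
  "alternating_cycle n \<pi> vs \<longleftrightarrow>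
     vs \<noteq> [] \<and> distinct vs \<and> even (length vs) \<and>
     (\<forall>i < length vs. {vs ! i, vs ! (Suc i mod length vs)}
        \<in> (if even i then black_edges n \<pi> else gray_edges n))"

text \<open>
  Each colour class being a perfect matching, an alternating cycle is determined by its vertex
  set, whatever the starting vertex and the direction of traversal.
\<close>

definition num_cycles :: "nat \<Rightarrow> (int \<Rightarrow> int) \<Rightarrow> nat" where
  "num_cycles n \<pi> = card {set vs | vs. alternating_cycle n \<pi> vs}"

text \<open>
  The permutation \<open>\<pi>\<^sup>*\<close>, with cycles \<open>(\<pi>\<^bsub>+n\<^esub>, \<dots>, \<pi>\<^bsub>+1\<^esub>, \<pi>\<^bsub>+0\<^esub>)\<close> and
  \<open>(\<pi>\<^bsub>-0\<^esub>, \<pi>\<^bsub>-1\<^esub>, \<dots>, \<pi>\<^bsub>-n\<^esub>)\<close>; it is the identity outside \<open>H n\<close>.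
\<close>

definition star :: "nat \<Rightarrow> (int \<Rightarrow> int) \<Rightarrow> signed_nat \<Rightarrow> signed_nat" where
  "star n \<pi> = cycle_of_list (map (\<lambda>j. ext \<pi> (Pos j)) (rev [0..<n+1]))
            \<circ> cycle_of_list (map (\<lambda>j. ext \<pi> (Neg j)) [0..<n+1])"


section \<open>The exchange operation\<close>

text \<open>
  No \<open>\<theta>\<close> exists when \<open>y = neg x\<close>, since \<open>{neg y, x}\<close> would then be a loop.
\<close>

definition exchange ::
    "nat \<Rightarrow> signed_nat \<Rightarrow> signed_nat \<Rightarrow> (int \<Rightarrow> int) \<Rightarrow> (int \<Rightarrow> int) \<Rightarrow> bool" where
  "exchange n x y \<pi> \<theta> \<longleftrightarrow>
     \<pi> \<in> signed_perms n \<and> \<theta> \<in> signed_perms n \<and>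
     x \<in> H n \<and> y \<in> H n \<and> y \<noteq> x \<and> y \<noteq> nxt n x \<and>
     (\<exists>z \<in> H n. \<exists>w \<in> H n.
        {neg z, x} \<in> black_edges n \<pi> \<and>
        {neg (nxt n x), y} \<in> black_edges n \<pi> \<and>
        {neg y, w} \<in> black_edges n \<pi> \<and>
        (if x = w then \<theta> = \<pi>
         else black_edges n \<theta> =
                (black_edges n \<pi> - {{neg z, x}, {neg (nxt n x), y}, {neg y, w}})
                \<union> {{neg z, y}, {neg y, x}, {neg (nxt n x), w}}))"


section \<open>The cyclic operation\<close>

text \<open>
  The following three functions give, for the three types of cyclic operation and \<open>p = |x|\<close>, the
  value of \<open>\<sigma>\<close> at \<open>Pos t\<close>. In each of them \<open>|y|\<close> equals neither \<open>p\<close> nor the label following \<open>p\<close>,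
  because \<open>star n \<pi>\<close> has no fixed point in \<open>H n\<close> and never has \<open>u\<close> and \<open>neg u\<close> in a common cycle;
  the final branches \<open>Pos t\<close> of the outer conditionals are thus never reached. The label \<open>p + 1\<close>
  has to be read as 0 when \<open>p = n\<close>. As \<open>q > p + 1\<close> is impossible for \<open>p = n\<close>, this only matters
  in the case \<open>q < p\<close> of type B.
\<close>

definition wrap :: "nat \<Rightarrow> nat \<Rightarrow> nat" where
  "wrap n j = (if j = n + 1 then 0 else j)"

definition sigma_A :: "nat \<Rightarrow> signed_nat \<Rightarrow> nat \<Rightarrow> signed_nat" where
  "sigma_A p y t = (case y of
     Pos q \<Rightarrow>
       if q > p + 1 then
         (if t = p + 1 then Pos (q - 1) else if p + 2 \<le> t \<and> t \<le> q - 1 then Pos (t - 1) else Pos t)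
       else if q < p then
         (if t = p then Pos (q + 1) else if q + 1 \<le> t \<and> t \<le> p - 1 then Pos (t + 1) else Pos t)
       else Pos t
   | Neg q \<Rightarrow>
       if q > p + 1 then
         (if t = p + 1 then Neg q else if p + 2 \<le> t \<and> t \<le> q then Pos (t - 1) else Pos t)
       else if q < p then
         (if t = p then Neg q else if q \<le> t \<and> t \<le> p - 1 then Pos (t + 1) else Pos t)
       else Pos t)"

definition sigma_B :: "nat \<Rightarrow> nat \<Rightarrow> signed_nat \<Rightarrow> nat \<Rightarrow> signed_nat" where
  "sigma_B n p y t = (case y of
     Pos q \<Rightarrow>
       if q > p + 1 then
         (if t = p + 1 then Pos (q - 1) else if p + 2 \<le> t \<and> t \<le> q - 1 then Pos (t - 1) else Pos t)
       else if q < p then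
         (if t = wrap n (p + 1) then Pos q
          else if q \<le> t \<and> t \<le> p then Pos (wrap n (t + 1)) else Pos t)
       else Pos t
   | Neg q \<Rightarrow>
       if q > p + 1 then
         (if t = p + 1 then Neg q else if p + 2 \<le> t \<and> t \<le> q then Pos (t - 1) else Pos t)
       else if q < p then
         (if t = wrap n (p + 1) then Neg (q + 1)
          else if q + 1 \<le> t \<and> t \<le> p then Pos (wrap n (t + 1)) else Pos t)
       else Pos t)"

definition sigma_C :: "nat \<Rightarrow> signed_nat \<Rightarrow> nat \<Rightarrow> signed_nat" where
  "sigma_C p y t = (case y of
     Pos q \<Rightarrow>
       if q > p + 1 then
         (if t = p then Pos q else if p + 1 \<le> t \<and> t \<le> q then Pos (t - 1) else Pos t)
       else if q < p then
         (if t = p then Pos (q + 1) else if q + 1 \<le> t \<and> t \<le> p - 1 then Pos (t + 1) else Pos t)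
       else Pos t
   | Neg q \<Rightarrow>
       if q > p + 1 then
         (if t = p then Neg (q - 1) else if p + 1 \<le> t \<and> t \<le> q - 1 then Pos (t - 1) else Pos t)
       else if q < p then
         (if t = p then Neg q else if q \<le> t \<and> t \<le> p - 1 then Pos (t + 1) else Pos t)
       else Pos t)"

primrec odd_extension :: "(nat \<Rightarrow> signed_nat) \<Rightarrow> signed_nat \<Rightarrow> signed_nat" where
  "odd_extension f (Pos t) = f t"
| "odd_extension f (Neg t) = neg (f t)"

text \<open>\<open>inv_into UNIV\<close> is the inverse function; \<open>HOL-Algebra\<close> takes over the notation \<open>inv\<close>.\<close>

definition conjugate :: "('a \<Rightarrow> 'a) \<Rightarrow> ('a \<Rightarrow> 'a) \<Rightarrow> 'a \<Rightarrow> 'a" where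
  "conjugate \<sigma> f = \<sigma> \<circ> f \<circ> inv_into UNIV \<sigma>"

inductive cyclic ::
    "nat \<Rightarrow> signed_nat \<Rightarrow> signed_nat \<Rightarrow> (int \<Rightarrow> int) \<Rightarrow> (int \<Rightarrow> int) \<Rightarrow> bool" for n :: nat where
  A: "\<lbrakk>\<pi> \<in> signed_perms n; \<theta> \<in> signed_perms n; Pos p \<in> H n; y \<in> H n;
       star n \<pi> (nxt n (Pos p)) = y; star n \<pi> y = Pos p;
       star n \<theta> = conjugate (odd_extension (sigma_A p y)) (star n \<pi>)\<rbrakk>
      \<Longrightarrow> cyclic n (Pos p) y \<pi> \<theta>"
| B: "\<lbrakk>\<pi> \<in> signed_perms n; \<theta> \<in> signed_perms n; Pos p \<in> H n; y \<in> H n;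
       star n \<pi> (neg (nxt n (Pos p))) = y; star n \<pi> y = Pos p;
       star n \<theta> = conjugate (odd_extension (sigma_B n p y)) (star n \<pi>)\<rbrakk>
      \<Longrightarrow> cyclic n (Pos p) y \<pi> \<theta>"
| C: "\<lbrakk>\<pi> \<in> signed_perms n; \<theta> \<in> signed_perms n; Neg p \<in> H n; y \<in> H n;
       star n \<pi> (nxt n (Pos p)) = y; star n \<pi> y = Neg p;
       star n \<theta> = conjugate (odd_extension (sigma_C p y)) (star n \<pi>)\<rbrakk>
      \<Longrightarrow> cyclic n (Neg p) y \<pi> \<theta>"


section \<open>The sign-change operation and equivalence\<close>

definition sign_change :: "nat \<Rightarrow> nat \<Rightarrow> (int \<Rightarrow> int) \<Rightarrow> (int \<Rightarrow> int) \<Rightarrow> bool" where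
  "sign_change n p \<pi> \<theta> \<longleftrightarrow>
     \<pi> \<in> signed_perms n \<and> \<theta> \<in> signed_perms n \<and> p \<le> n \<and>
     (let r = wrap n (p + 1) in
        (star n \<pi> (Pos p) = Neg r \<and> star n \<pi> (Pos r) = Neg p \<or>
         star n \<pi> (Neg p) = Pos r \<and> star n \<pi> (Neg r) = Pos p) \<and>
        star n \<theta> =
          conjugate (Transposition.transpose (Pos p) (Neg p)
                       \<circ> Transposition.transpose (Pos r) (Neg r))
                     (star n \<pi>))"

definition operation :: "nat \<Rightarrow> (int \<Rightarrow> int) \<Rightarrow> (int \<Rightarrow> int) \<Rightarrow> bool" where
  "operation n \<pi> \<theta> \<longleftrightarrow>
     (\<exists>x y. exchange n x y \<pi> \<theta>) \<or> (\<exists>x y. cyclic n x y \<pi> \<theta>) \<or> (\<exists>p. sign_change n p \<pi> \<theta>)"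

text \<open>
  The operations are not all reversible: for \<open>n = 4\<close>, the permutation \<open>(3, 1, 4, 2)\<close> cannot be
  obtained from any other one, so the disjunction is essential.
\<close>

definition op_equivalent :: "nat \<Rightarrow> (int \<Rightarrow> int) \<Rightarrow> (int \<Rightarrow> int) \<Rightarrow> bool" where
  "op_equivalent n \<pi> \<theta> \<longleftrightarrow> (operation n)\<^sup>*\<^sup>* \<pi> \<theta> \<or> (operation n)\<^sup>*\<^sup>* \<theta> \<pi>"


section \<open>Probabilities in a finite group\<close>

definition list_prod :: "('g, 'r) monoid_scheme \<Rightarrow> 'g list \<Rightarrow> 'g" where
  "list_prod G xs = foldr (\<lambda>x y. x \<otimes>\<^bsub>G\<^esub> y) xs \<one>\<^bsub>G\<^esub>"

text \<open>The law of independent uniformly random elements \<open>a 1, \<dots>, a m\<close> of \<open>G\<close>.\<close>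

definition random_elements :: "('g, 'r) monoid_scheme \<Rightarrow> nat \<Rightarrow> (nat \<Rightarrow> 'g) pmf" where
  "random_elements G m = Pi_pmf {1..m} undefined (\<lambda>_. pmf_of_set (carrier G))"

definition Pr_signed :: "('g, 'r) monoid_scheme \<Rightarrow> nat \<Rightarrow> (int \<Rightarrow> int) \<Rightarrow> real" where
  "Pr_signed G n \<pi> = measure_pmf.prob (random_elements G n)
     {a. list_prod G (map a [1..<n+1]) =
         list_prod G (map (\<lambda>i. if \<pi> (int i) > 0 then a (nat \<bar>\<pi> (int i)\<bar>)
                               else inv\<^bsub>G\<^esub> (a (nat \<bar>\<pi> (int i)\<bar>))) [1..<n+1])}"

text \<open>\<open>Pr\<^sup>e(G)\<close>, for nonnegative and for negative exponents \<open>e\<close>.\<close>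

definition Pr_power :: "('g, 'r) monoid_scheme \<Rightarrow> int \<Rightarrow> real" where
  "Pr_power G e =
     (if e \<ge> 0 then
        measure_pmf.prob (random_elements G (nat e))
          {a. list_prod G (map a [1..<nat e + 1]) = list_prod G (map a (rev [1..<nat e + 1]))}
      else
        measure_pmf.prob (random_elements G (nat (- e)))
          {a. list_prod G (map a [1..<nat (- e) + 1]) =
              list_prod G (map (\<lambda>i. inv\<^bsub>G\<^esub> (a i)) [1..<nat (- e) + 1])})"

end

theory Submission
  imports Defs
begin

text \<open>
  Read \<open>\<pi>\<close> as the cyclic word \<open>w = 0 \<pi>\<^sub>1 \<dots> \<pi>\<^sub>n\<close>, up to rotation and formal inversion. An exchange
  slides the letter preceding \<open>x + 1\<close> to the position after \<open>x\<close>; in the graph the gray edge between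
  \<open>x\<close> and \<open>-(x + 1)\<close> subdivides another black edge, so the number of cycles is preserved, and in a
  group the slide is the substitution \<open>a\<^sub>x \<mapsto> a\<^sub>x y\<inverse>\<close>, \<open>a\<^bsub>x+1\<^esub> \<mapsto> y a\<^bsub>x+1\<^esub>\<close>. Exchanges are reversible.

  Gluing two polygons with boundaries \<open>0 1 \<dots> n\<close> and \<open>w\<close> gives a surface, and the reduction follows the
  classification of surfaces. If \<open>w\<close> contains both signs, exchanges bring \<open>-n\<close> in front of \<open>0\<close>;
  removing this crosscap and inducting, where the remaining word can be kept nonorientable, yields
  \<open>0 -1 \<dots> -m (m+1) \<dots> n\<close>. If all letters are positive and some \<open>x, x+1, x+2\<close> occur in \<open>w\<close> in the
  reversed cyclic order, exchanges split off a handle \<open>n (n-1)\<close>. Otherwise, unless exchanges create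
  such a triple, at most one letter lies between \<open>x\<close> and \<open>x + 1\<close> for every \<open>x\<close>, which leaves only
  the identity and the word with letter \<open>i (h + 1) mod (2 h + 1)\<close> in position \<open>i\<close>. The latter has a
  single cycle, so exchanges suffice for at least two cycles; for a single one, a cyclic operation of
  type A leads from the exceptional word to the others.

  For the probability in the orientable case one passes from \<open>n\<close> to \<open>n + 1\<close>, which does not change
  it but adds a cycle, so that again exchanges suffice.
\<close>

section \<open>Words\<close>

text \<open>The cycles of the breakpoint graph are the vertices of the glued surface, which has two
  faces and n + 1 edges. With k cycles its Euler characteristic is k + 1 - n, so n - k + 1 is the
  number of crosscaps or twice the number of handles; this is the origin of the exponent. The
  obstacle is that slides alone do not realise this classification: a slide is tied to a pair of
  consecutive labels, and the exceptional one-cycle words admit none that changes them. The cyclic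
  operations needed there have no direct inverse, so \<open>reach\<close>, unlike
  \<open>eqv\<close>, has a direction. The word 0 2 1 4 3 ... made of handles only serves as a sink:
  every orientable one-cycle word reaches it, and it is shown to reach back all of them except those
  slide equivalent to a bare exceptional word, which form at most one class for each n. Hence any
  two one-cycle words are comparable, as the disjunction in \<open>op_equivalent\<close> demands.
  The probabilities avoid cyclic operations altogether, since only slides are plain substitutions of
  variables.\<close>

lemma neg_neg [simp]: "neg (neg u) = u"
  by (cases u) auto

lemma neg_neq [simp]: "neg u \<noteq> u" "u \<noteq> neg u"
  by (cases u; simp)+

lemma neg_eq_iff [simp]: "neg u = neg v \<longleftrightarrow> u = v"
  by (metis neg_neg)

primrec lab :: "signed_nat \<Rightarrow> nat" where
  "lab (Pos j) = j"
| "lab (Neg j) = j"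

lemma lab_neg [simp]: "lab (neg u) = lab u"
  by (cases u) auto

lemma lab_eqD: "lab u = lab v \<Longrightarrow> u = v \<or> u = neg v"
  by (cases u; cases v) auto

lemma mem_H_iff: "u \<in> H n \<longleftrightarrow> lab u \<le> n"
  by (cases u) (auto simp: H_def)

lemma finite_H [simp]: "finite (H n)"
  by (simp add: H_def)

lemma neg_mem_H_iff [simp]: "neg u \<in> H n \<longleftrightarrow> u \<in> H n"
  by (simp add: mem_H_iff)

lemma nxt_mem_H [simp]: "u \<in> H n \<Longrightarrow> nxt n u \<in> H n"
  by (cases u) (auto simp: mem_H_iff)

lemma nxt_neg_nxt: "u \<in> H n \<Longrightarrow> nxt n (neg (nxt n u)) = neg u"
  by (cases u) (auto simp: mem_H_iff)

section \<open>Inverse words, validity, and the edges of a cyclic word\<close>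

definition winv :: "signed_nat list \<Rightarrow> signed_nat list" where
  "winv w = rev (map neg w)"

lemma winv_simps [simp]:
  "winv [] = []" "winv (a # w) = winv w @ [neg a]" "winv (u @ v) = winv v @ winv u"
  "winv (winv w) = w" "length (winv w) = length w" "set (winv w) = neg ` set w"
  by (auto simp: winv_def rev_map o_def)

definition valid :: "nat \<Rightarrow> signed_nat list \<Rightarrow> bool" where
  "valid n w \<longleftrightarrow> distinct (map lab w) \<and> lab ` set w = {..n}"

lemma valid_length: "valid n w \<Longrightarrow> length w = Suc n"
  unfolding valid_def by (metis card_atMost distinct_card length_map list.set_map)

lemma lab_winv: "map lab (winv w) = rev (map lab w)"
  by (simp add: winv_def rev_map o_def)

lemma valid_append_commute: "valid n (u @ v) \<longleftrightarrow> valid n (v @ u)"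
  by (auto simp: valid_def Un_commute image_Un)

lemma valid_winv [simp]: "valid n (winv w) \<longleftrightarrow> valid n w"
  by (simp add: valid_def lab_winv image_image)

text \<open>As a vertex, a letter \<open>a\<close> stands for its end and \<open>neg a\<close> for
  its start; an edge joins the end of a letter to the start of the next one. Reading a word
  backwards with inverted letters therefore yields the same edges.\<close>

fun path_edges :: "signed_nat list \<Rightarrow> signed_nat set set" where
  "path_edges (a # b # w) = insert {a, neg b} (path_edges (b # w))"
| "path_edges w = {}"

primrec word_edges :: "signed_nat list \<Rightarrow> signed_nat set set" where
  "word_edges [] = {}"
| "word_edges (a # w) = path_edges (a # w @ [a])"

lemma path_edges_append: "path_edges (u @ a # v) = path_edges (u @ [a]) \<union> path_edges (a # v)"
proof (induction u)
  case (Cons b u)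
  then show ?case by (cases u) auto
qed simp

lemma word_edges_append_commute: "word_edges (u @ v) = word_edges (v @ u)"
proof (cases "u = [] \<or> v = []")
  case False
  then obtain a u' b v' where "u = a # u'" "v = b # v'" by (metis neq_Nil_conv)
  then show ?thesis
    using path_edges_append[of "a # u'" b "v' @ [a]"] path_edges_append[of "b # v'" a "u' @ [b]"]
    by auto
qed auto

lemma path_edges_winv: "path_edges (winv w) = path_edges w"
proof (induction w rule: path_edges.induct)
  case (1 a b w)
  have "path_edges (winv (a # b # w)) = path_edges (winv w @ [neg b]) \<union> path_edges [neg b, neg a]"
    using path_edges_append[of "winv w" "neg b" "[neg a]"] by simp
  with 1 show ?case by (auto simp: insert_commute)
qed auto

lemma word_edges_winv: "word_edges (winv w) = word_edges w"
proof (cases w)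
  case (Cons a v)
  have "word_edges (winv w) = word_edges (neg a # winv v)"
    using word_edges_append_commute[of "winv v" "[neg a]"] Cons by simp
  also have "\<dots> = path_edges (winv (a # v @ [a]))" by simp
  also have "\<dots> = word_edges w" using Cons path_edges_winv[of "a # v @ [a]"] by simp
  finally show ?thesis .
qed simp

lemma path_edges_nth: "path_edges w = {{w ! i, neg (w ! Suc i)} | i. Suc i < length w}"
proof (induction w rule: path_edges.induct)
  case (1 a b w)
  have "{{(a # b # w) ! i, neg ((a # b # w) ! Suc i)} | i. Suc i < length (a # b # w)} =
        insert {a, neg b} {{(b # w) ! i, neg ((b # w) ! Suc i)} | i. Suc i < length (b # w)}"
    (is "?L = ?R")
  proof
    show "?L \<subseteq> ?R"
    proof
      fix e assume "e \<in> ?L"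
      then obtain i where i: "e = {(a # b # w) ! i, neg ((a # b # w) ! Suc i)}"
        "Suc i < length (a # b # w)" by blast
      then show "e \<in> ?R" by (cases i) auto
    qed
    show "?R \<subseteq> ?L"
    proof
      fix e assume "e \<in> ?R"
      then consider "e = {a, neg b}" | i where "e = {(b # w) ! i, neg ((b # w) ! Suc i)}"
        "Suc i < length (b # w)" by blast
      then show "e \<in> ?L"
      proof cases
        case 1 then show ?thesis by (intro CollectI exI[of _ 0]) auto
      next
        case (2 i) then show ?thesis by (intro CollectI exI[of _ "Suc i"]) auto
      qed
    qed
  qed
  with 1 show ?case by simp
qed auto

lemma word_edges_nth:
  "word_edges w = {{w ! i, neg (w ! (Suc i mod length w))} | i. i < length w}"
proof (cases w)
  case (Cons a v)
  have nth: "(w @ [a]) ! i = w ! i" "(w @ [a]) ! Suc i = w ! (Suc i mod length w)"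
    if "i < length w" for i
  proof -
    show "(w @ [a]) ! i = w ! i" using that by (simp add: nth_append)
    show "(w @ [a]) ! Suc i = w ! (Suc i mod length w)"
    proof (cases "Suc i = length w")
      case True then show ?thesis using Cons by (simp add: nth_append)
    next
      case False
      with that have "Suc i < length w" by simp
      then show ?thesis by (simp add: nth_append)
    qed
  qed
  have "word_edges w = path_edges (w @ [a])" using Cons by simp
  also have "\<dots> = {{(w @ [a]) ! i, neg ((w @ [a]) ! Suc i)} | i. i < length w}"
    by (simp add: path_edges_nth)
  also have "\<dots> = {{w ! i, neg (w ! (Suc i mod length w))} | i. i < length w}"
    by (intro Collect_cong ex_cong1) (auto simp: nth)
  finally show ?thesis .
qed simp

lemma path_edges_vertices: "e \<in> path_edges w \<Longrightarrow> e \<subseteq> set (butlast w) \<union> neg ` set (tl w)"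
  by (induction w rule: path_edges.induct) auto


lemma path_edges_snoc: "path_edges (u @ [a, b]) = insert {a, neg b} (path_edges (u @ [a]))"
  using path_edges_append[of u a "[b]"] by auto

lemma word_edge_mem_H:
  assumes "valid n w" "e \<in> word_edges w"
  obtains a b where "e = {a, b}" "a \<noteq> b" "a \<in> H n" "b \<in> H n"
proof -
  obtain i where i: "i < length w" "e = {w ! i, neg (w ! (Suc i mod length w))}"
    using assms(2) by (auto simp: word_edges_nth)
  have len: "length w = Suc n" and dist: "distinct (map lab w)"
    using assms valid_length by (auto simp: valid_def)
  have i': "Suc i mod length w < length w" using len by simp
  have mem: "w ! k \<in> H n" if "k < length w" for k
    using assms(1) that nth_mem[OF that] unfolding valid_def mem_H_iff by auto
  have ne: "w ! i \<noteq> neg (w ! (Suc i mod length w))"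
  proof
    \<comment> \<open>Equal labels force equal positions, which leaves only a word of length one;
      its edge \<open>{a, neg a}\<close> is not a loop either.\<close>
    assume eq: "w ! i = neg (w ! (Suc i mod length w))"
    then have "map lab w ! i = map lab w ! (Suc i mod length w)" using i i' by simp
    then have "i = Suc i mod length w" using dist i i' by (metis length_map nth_eq_iff_index_eq)
    with eq show False by (metis neg_neq(1))
  qed
  show ?thesis using that[OF i(2) ne] mem[OF i(1)] mem[OF i'] by simp
qed

lemma Suc_mod_inject: "Suc i mod L = Suc j mod L \<Longrightarrow> i < L \<Longrightarrow> j < L \<Longrightarrow> i = j"
  by (cases "Suc i = L"; cases "Suc j = L") auto

text \<open>As each label occurs once, a vertex is either the end or the start of exactly one
  letter, and this determines the position of its edge.\<close>

lemma word_edge_unique: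
  assumes "valid n w" "e \<in> word_edges w" "e' \<in> word_edges w" "v \<in> e" "v \<in> e'"
  shows "e = e'"
proof -
  let ?s = "\<lambda>i. Suc i mod length w"
  obtain i where i: "i < length w" "e = {w ! i, neg (w ! ?s i)}"
    using assms(2) by (auto simp: word_edges_nth)
  obtain j where j: "j < length w" "e' = {w ! j, neg (w ! ?s j)}"
    using assms(3) by (auto simp: word_edges_nth)
  have s: "?s k < length w" for k using valid_length[OF assms(1)] by simp
  have inj: "k = l" if "lab (w ! k) = lab (w ! l)" "k < length w" "l < length w" for k l
    using assms(1) that unfolding valid_def by (metis length_map nth_eq_iff_index_eq nth_map)
  have "i = j"
  proof (rule ccontr)
    assume "i \<noteq> j"
    then have "?s i \<noteq> ?s j" using Suc_mod_inject i(1) j(1) by blast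
    consider "w ! i = w ! j" | "w ! i = neg (w ! ?s j)" | "neg (w ! ?s i) = w ! j"
      | "neg (w ! ?s i) = neg (w ! ?s j)"
      using assms(4,5) i(2) j(2) by auto
    then show False
    proof cases
      case 1 then show False using inj[of i j] i j \<open>i \<noteq> j\<close> by simp
    next
      case 2 then show False using inj[of i "?s j"] i s by (metis lab_neg neg_neq(1))
    next
      case 3 then show False using inj[of j "?s i"] j s by (metis lab_neg neg_neq(1))
    next
      case 4 then show False using inj[of "?s i" "?s j"] s \<open>?s i \<noteq> ?s j\<close> by simp
    qed
  qed
  then show ?thesis using i j by simp
qed

lemma word_edge_partner:
  assumes "valid n w" "v \<in> H n"
  obtains u where "{v, u} \<in> word_edges w"
proof -
  have len: "length w = Suc n" using assms valid_length by auto
  have "lab v \<in> lab ` set w" using assms by (auto simp: valid_def mem_H_iff)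
  then obtain i where i: "i < length w" "lab v = lab (w ! i)" by (auto simp: in_set_conv_nth)
  have ex: "{w ! k, neg (w ! (Suc k mod length w))} \<in> word_edges w" if "k < length w" for k
    using that by (auto simp: word_edges_nth)
  from lab_eqD[OF i(2)] show ?thesis
  proof
    assume "v = w ! i" then show ?thesis using that ex[OF i(1)] by simp
  next
    assume v: "v = neg (w ! i)"
    define k where "k = (if i = 0 then n else i - 1)"
    have "k < length w" "Suc k mod length w = i" using i len by (auto simp: k_def)
    then show ?thesis using that[of "w ! k"] ex[of k] v by (simp add: insert_commute)
  qed
qed


section \<open>Permutations as words starting with +0\<close>

definition perm_word :: "nat \<Rightarrow> (int \<Rightarrow> int) \<Rightarrow> signed_nat list" where
  "perm_word n \<pi> = map (\<lambda>j. ext \<pi> (Pos j)) [0..<n + 1]"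

lemma length_perm_word [simp]: "length (perm_word n \<pi>) = Suc n"
  by (simp add: perm_word_def)

lemma perm_word_nth: "j \<le> n \<Longrightarrow> perm_word n \<pi> ! j = ext \<pi> (Pos j)"
  unfolding perm_word_def by (subst nth_map) (auto simp del: upt_Suc)

lemma signed_perms_bounds:
  assumes "\<pi> \<in> signed_perms n" "i \<noteq> 0" "\<bar>i\<bar> \<le> int n"
  shows "\<pi> i \<noteq> 0" "\<bar>\<pi> i\<bar> \<le> int n"
  using assms permutes_in_image[of \<pi> "{- int n..int n} - {0}" i]
  unfolding signed_perms_def by (auto simp: abs_le_iff)

lemma ext_neg:
  assumes "\<pi> \<in> signed_perms n" "u \<in> H n"
  shows "ext \<pi> (neg u) = neg (ext \<pi> u)"
proof -
  have odd: "\<pi> (- int j) = - \<pi> (int j)" for j using assms by (simp add: signed_perms_def)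
  have minus: "signed_of_int (- i) = neg (signed_of_int i)" if "i \<noteq> 0" for i
    using that by (simp add: signed_of_int_def)
  have "\<pi> (int j) \<noteq> 0" if "j \<noteq> 0" "j \<le> n" for j
    using signed_perms_bounds(1)[OF assms(1), of "int j"] that by simp
  then have "signed_of_int (\<pi> (- int j)) = neg (signed_of_int (\<pi> (int j)))"
    if "j \<noteq> 0" "j \<le> n" for j
    using that minus unfolding odd by blast
  then show ?thesis using assms(2) by (cases u) (auto simp: mem_H_iff)
qed

lemma lab_signed_of_int: "lab (signed_of_int i) = nat \<bar>i\<bar>"
  by (simp add: signed_of_int_def)

lemma lab_ext_Pos:
  "\<pi> \<in> signed_perms n \<Longrightarrow> lab (ext \<pi> (Pos j)) = nat \<bar>\<pi> (int j)\<bar>"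
  by (auto simp: lab_signed_of_int signed_perms_def dest: permutes_not_in[of _ _ 0])

lemma valid_perm_word:
  assumes "\<pi> \<in> signed_perms n"
  shows "valid n (perm_word n \<pi>)"
proof -
  have perm: "\<pi> permutes ({- int n..int n} - {0})" and odd: "\<And>i. \<pi> (- i) = - \<pi> i"
    using assms by (auto simp: signed_perms_def)
  have map: "map lab (perm_word n \<pi>) = map (\<lambda>j. nat \<bar>\<pi> (int j)\<bar>) [0..<n + 1]"
    unfolding perm_word_def map_map by (simp only: o_def lab_ext_Pos[OF assms])
  have inj: "inj_on (\<lambda>j. nat \<bar>\<pi> (int j)\<bar>) {0..<n + 1}"
  proof (rule inj_onI)
    fix i j assume "nat \<bar>\<pi> (int i)\<bar> = nat \<bar>\<pi> (int j)\<bar>"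
    then have "\<pi> (int i) = \<pi> (int j) \<or> \<pi> (int i) = \<pi> (- int j)" by (auto simp: odd)
    then have "int i = int j \<or> int i = - int j"
      unfolding inj_eq[OF permutes_inj[OF perm]] .
    then show "i = j" by auto
  qed
  have d: "distinct (map lab (perm_word n \<pi>))"
    unfolding map distinct_map set_upt using inj by simp
  have le: "nat \<bar>\<pi> (int j)\<bar> \<le> n" if "j \<le> n" for j
  proof (cases "j = 0")
    case True
    then show ?thesis using permutes_not_in[OF perm, of 0] by simp
  qed (use signed_perms_bounds[OF assms, of "int j"] that in auto)
  have "set (map lab (perm_word n \<pi>)) \<subseteq> {..n}"
    unfolding map set_map set_upt
  proof (rule image_subsetI)
    fix j assume "j \<in> {0..<n + 1}"
    then show "nat \<bar>\<pi> (int j)\<bar> \<in> {..n}" using le[of j] by simp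
  qed
  moreover have "card (set (map lab (perm_word n \<pi>))) = Suc n"
    using distinct_card[OF d] by simp
  ultimately have "set (map lab (perm_word n \<pi>)) = {..n}"
    by (intro card_subset_eq) auto
  then show ?thesis using d by (simp add: valid_def)
qed

lemma black_edges_eq:
  assumes "\<pi> \<in> signed_perms n"
  shows "black_edges n \<pi> = word_edges (perm_word n \<pi>)"
proof -
  let ?w = "perm_word n \<pi>"
  let ?e = "\<lambda>i. {?w ! i, neg (?w ! (Suc i mod Suc n))}"
  have we: "word_edges ?w = {?e i | i. i \<le> n}"
    unfolding word_edges_nth by (simp add: less_Suc_eq_le)
  have P: "{ext \<pi> (Pos j), ext \<pi> (neg (nxt n (Pos j)))} = ?e j" if "j \<le> n" for j
    using that ext_neg[OF assms, of "nxt n (Pos j)"]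
    by (cases "j = n") (simp_all add: perm_word_nth mem_H_iff del: ext.simps)
  \<comment> \<open>The edge contributed by \<open>Neg j\<close> is that of the position cyclically
    before \<open>j\<close>, so \<open>black_edges\<close> lists every edge twice.\<close>
  have N: "{ext \<pi> (Neg j), ext \<pi> (neg (nxt n (Neg j)))} = ?e (if j = 0 then n else j - 1)"
    if "j \<le> n" for j
    using that ext_neg[OF assms, of "Pos j"]
    by (cases "j = 0") (auto simp add: perm_word_nth mem_H_iff simp del: ext.simps)
  show ?thesis
  proof
    show "black_edges n \<pi> \<subseteq> word_edges ?w"
    proof
      fix e assume "e \<in> black_edges n \<pi>"
      then obtain u where u: "u \<in> H n" "e = {ext \<pi> u, ext \<pi> (neg (nxt n u))}"
        unfolding black_edges_def by blast
      show "e \<in> word_edges ?w"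
      proof (cases u)
        case (Pos j)
        then show ?thesis using u P[of j] unfolding we mem_H_iff by auto
      next
        case (Neg j)
        then show ?thesis using u N[of j] unfolding we mem_H_iff by force
      qed
    qed
    show "word_edges ?w \<subseteq> black_edges n \<pi>"
    proof
      fix e assume "e \<in> word_edges ?w"
      then obtain j where "j \<le> n" "e = ?e j" unfolding we by blast
      then show "e \<in> black_edges n \<pi>"
        unfolding black_edges_def using P[of j]
        by (intro CollectI exI[of _ "Pos j"]) (auto simp: mem_H_iff)
    qed
  qed
qed

text \<open>The gray edges are the black edges of the identity, so the results on words apply to
  both colours.\<close>

lemma gray_edges_eq: "gray_edges n = word_edges (map Pos [0..<n + 1])"
proof -
  have id: "id \<in> signed_perms n" by (simp add: signed_perms_def permutes_id)
  have e: "ext id u = u" if "u \<in> H n" for u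
    using that by (cases u) (auto simp: signed_of_int_def)
  have "gray_edges n = black_edges n id"
    unfolding gray_edges_def black_edges_def by (intro Collect_cong ex_cong1) (auto simp: e)
  moreover have "perm_word n id = map Pos [0..<n + 1]"
    unfolding perm_word_def by (intro map_cong refl e) (auto simp: mem_H_iff simp del: upt_Suc)
  ultimately show ?thesis using black_edges_eq[OF id] by simp
qed

lemma valid_map_Pos: "valid n (map Pos l) \<longleftrightarrow> distinct l \<and> set l = {..n}"
  by (auto simp: valid_def distinct_map o_def image_image inj_on_def)

lemma valid_upt: "valid n (map Pos [0..<n + 1])"
  unfolding valid_map_Pos by auto

lemma perm_word_hd: "perm_word n \<pi> ! 0 = Pos 0"
  by (simp add: perm_word_nth)

lemma perm_word_inject:
  assumes "\<pi> \<in> signed_perms n" "\<theta> \<in> signed_perms n" "perm_word n \<pi> = perm_word n \<theta>"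
  shows "\<pi> = \<theta>"
proof
  fix i :: int
  have odd: "\<pi> (- i) = - \<pi> i" "\<theta> (- i) = - \<theta> i" for i
    using assms by (auto simp: signed_perms_def)
  have pos: "\<pi> (int j) = \<theta> (int j)" if "0 < j" "j \<le> n" for j
  proof -
    have "signed_of_int (\<pi> (int j)) = signed_of_int (\<theta> (int j))"
      using that perm_word_nth[of j n \<pi>] perm_word_nth[of j n \<theta>] assms(3) by simp
    then show ?thesis
      using signed_perms_bounds(1)[of _ n "int j"] assms(1,2) that
      by (auto simp: signed_of_int_def split: if_splits)
  qed
  consider "i = 0 \<or> \<bar>i\<bar> > int n" | "0 < i" "i \<le> int n" | "i < 0" "- i \<le> int n" by linarith
  then show "\<pi> i = \<theta> i"
  proof cases
    case 1
    then have "i \<notin> {- int n..int n} - {0}" by auto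
    then show ?thesis using assms(1,2) by (auto simp: signed_perms_def permutes_not_in)
  next
    case 2 then show ?thesis using pos[of "nat i"] by simp
  next
    case 3 then show ?thesis using pos[of "nat (- i)"] odd[of i] by simp
  qed
qed

text \<open>Both words start with \<open>Pos 0\<close>, and the edge at the end of a letter names
  the next letter; so the word can be read off from its edges.\<close>

lemma black_edges_inject:
  assumes "\<pi> \<in> signed_perms n" "\<theta> \<in> signed_perms n" "black_edges n \<pi> = black_edges n \<theta>"
  shows "\<pi> = \<theta>"
proof -
  let ?w = "perm_word n \<pi>" and ?v = "perm_word n \<theta>"
  have E: "word_edges ?w = word_edges ?v" using assms black_edges_eq by metis
  have "?w ! i = ?v ! i" if "i \<le> n" for i
    using that
  proof (induction i)
    case (Suc i)
    have "{?w ! i, neg (?w ! Suc i)} \<in> word_edges ?w" "{?v ! i, neg (?v ! Suc i)} \<in> word_edges ?v"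
      using Suc.prems unfolding word_edges_nth by (auto intro!: exI[of _ i])
    then have "{?w ! i, neg (?w ! Suc i)} = {?v ! i, neg (?v ! Suc i)}"
      using E word_edge_unique[OF valid_perm_word[OF assms(1)], of _ _ "?w ! i"] Suc by auto
    then show ?case using Suc by (auto simp: doubleton_eq_iff)
  qed (simp add: perm_word_hd)
  then have "?w = ?v" by (intro nth_equalityI) auto
  then show ?thesis using perm_word_inject assms by blast
qed

primrec int_of :: "signed_nat \<Rightarrow> int" where
  "int_of (Pos j) = int j"
| "int_of (Neg j) = - int j"

lemma signed_of_int_of: "lab u \<noteq> 0 \<Longrightarrow> signed_of_int (int_of u) = u"
  by (cases u) (auto simp: signed_of_int_def)

lemma abs_int_of: "\<bar>int_of u\<bar> = int (lab u)"
  by (cases u) auto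

lemma ex_perm_word:
  assumes "valid n w" "w ! 0 = Pos 0"
  shows "\<exists>\<pi> \<in> signed_perms n. perm_word n \<pi> = w"
proof -
  let ?S = "{- int n..int n} - {0}"
  \<comment> \<open>The sign makes the function odd, and it is the identity outside the nonzero
    labels, as \<open>permutes\<close> requires.\<close>
  define \<pi> where "\<pi> i = (if i \<in> ?S then sgn i * int_of (w ! nat \<bar>i\<bar>) else i)" for i
  have len: "length w = Suc n" using assms valid_length by auto
  have inj: "k = l" if "lab (w ! k) = lab (w ! l)" "k \<le> n" "l \<le> n" for k l
    using assms(1) that len unfolding valid_def
    by (metis length_map nth_eq_iff_index_eq nth_map le_imp_less_Suc)
  have le: "lab (w ! k) \<le> n" if "k \<le> n" for k
    using assms(1) that len nth_mem[of k w] unfolding valid_def by auto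
  have ne: "lab (w ! k) \<noteq> 0" if "k \<le> n" "k \<noteq> 0" for k
    using inj[of k 0] that assms(2) by auto
  have odd: "\<pi> (- i) = - \<pi> i" for i by (auto simp: \<pi>_def)
  have abs: "\<bar>\<pi> i\<bar> = int (lab (w ! nat \<bar>i\<bar>))" if "i \<in> ?S" for i
    using that by (auto simp: \<pi>_def abs_mult abs_int_of)
  have "inj_on \<pi> ?S"
  proof (rule inj_onI)
    fix i j assume ij: "i \<in> ?S" "j \<in> ?S" "\<pi> i = \<pi> j"
    have "int (lab (w ! nat \<bar>i\<bar>)) = int (lab (w ! nat \<bar>j\<bar>))"
      unfolding abs[OF ij(1), symmetric] abs[OF ij(2), symmetric] ij(3) ..
    moreover have le: "nat \<bar>i\<bar> \<le> n" "nat \<bar>j\<bar> \<le> n" "nat \<bar>j\<bar> \<noteq> 0" using ij by auto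
    ultimately have "nat \<bar>i\<bar> = nat \<bar>j\<bar>" using inj by simp
    then have "i = j \<or> i = - j" by auto
    moreover have "\<pi> j \<noteq> 0" using abs[OF ij(2)] ne[OF le(2,3)] by linarith
    ultimately show "i = j" using ij(3) odd[of j] by (metis neg_equal_zero)
  qed
  moreover have "\<pi> ` ?S \<subseteq> ?S"
  proof (intro image_subsetI)
    fix i assume i: "i \<in> ?S"
    then have "nat \<bar>i\<bar> \<le> n" "nat \<bar>i\<bar> \<noteq> 0" by auto
    then have "\<bar>\<pi> i\<bar> \<le> int n" "\<pi> i \<noteq> 0"
      using abs[OF i] le[of "nat \<bar>i\<bar>"] ne[of "nat \<bar>i\<bar>"] by linarith+
    then show "\<pi> i \<in> ?S" by auto
  qed
  ultimately have "bij_betw \<pi> ?S ?S"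
    by (simp add: bij_betw_def endo_inj_surj)
  then have "\<pi> permutes ?S" by (rule bij_imp_permutes) (auto simp: \<pi>_def)
  then have mem: "\<pi> \<in> signed_perms n" by (auto simp: signed_perms_def odd)
  have "perm_word n \<pi> ! j = w ! j" if "j \<le> n" for j
  proof (cases "j = 0")
    case False
    then have "\<pi> (int j) = int_of (w ! j)" using that by (auto simp: \<pi>_def)
    then show ?thesis using that False ne[of j] by (simp add: perm_word_nth signed_of_int_of)
  qed (simp add: perm_word_hd assms)
  then have "perm_word n \<pi> = w" using len by (intro nth_equalityI) auto
  then show ?thesis using mem by blast
qed

lemma valid_split_Pos_0:
  assumes "valid n w"
  shows "\<exists>u v. w = u @ Pos 0 # v \<or> winv w = u @ Pos 0 # v"
proof -
  have "0 \<in> lab ` set w" using assms by (auto simp: valid_def)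
  then obtain a where "a \<in> set w" "lab a = 0" by auto
  have "a = Pos 0 \<or> neg a = Pos 0" using \<open>lab a = 0\<close> by (cases a) auto
  then have "Pos 0 \<in> set w \<or> Pos 0 \<in> set (winv w)" using \<open>a \<in> set w\<close> by force
  then show ?thesis by (meson split_list)
qed

text \<open>A valid word, inverted if it contains -0, can be rotated to start with +0, and neither
  step changes its edges. This supplies a permutation for every word met on the way.\<close>

lemma ex_perm:
  assumes "valid n w"
  shows "\<exists>\<pi> \<in> signed_perms n. black_edges n \<pi> = word_edges w"
proof -
  obtain u v w' where w': "w' = u @ Pos 0 # v" "w' = w \<or> w' = winv w"
    using valid_split_Pos_0[OF assms] by metis
  then have "valid n (Pos 0 # v @ u)" "word_edges w = word_edges (Pos 0 # v @ u)"
    using assms valid_append_commute[of n u "Pos 0 # v"] word_edges_winv[of w]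
      word_edges_append_commute[of u "Pos 0 # v"] valid_winv[of n w] by auto
  then show ?thesis using ex_perm_word[of n "Pos 0 # v @ u"] black_edges_eq by fastforce
qed

section \<open>Exchanges of words\<close>

text \<open>\<open>move\<close> and \<open>flip\<close> are the exchanges in which \<open>j\<close>
  and its successor have equal or opposite signs; in the latter case a letter placed after
  \<open>j\<close> appears inverted and in front of \<open>Neg j\<close>. The remaining sign
  patterns follow by \<open>winv\<close>. The rule \<open>sym\<close> is harmless because exchanges
  are reversible.\<close>

inductive eqv :: "nat \<Rightarrow> signed_nat list \<Rightarrow> signed_nat list \<Rightarrow> bool" for n where
  refl: "eqv n w w"
| sym: "eqv n w w' \<Longrightarrow> eqv n w' w"
| trans: "eqv n w w' \<Longrightarrow> eqv n w' w'' \<Longrightarrow> eqv n w w''"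
| rotate: "eqv n (u @ v) (v @ u)"
| winv: "eqv n w (winv w)"
| move: "j \<le> n \<Longrightarrow> eqv n (y # nxt n (Pos j) # u @ Pos j # v) (nxt n (Pos j) # u @ Pos j # y # v)"
| flip: "j \<le> n \<Longrightarrow>
    eqv n (y # nxt n (Pos j) # u @ Neg j # v) (nxt n (Pos j) # u @ neg y # Neg j # v)"

declare eqv.trans [trans]

lemma valid_cong: "mset (map lab w) = mset (map lab w') \<Longrightarrow> valid n w \<longleftrightarrow> valid n w'"
  unfolding valid_def set_map[symmetric] by (metis mset_eq_imp_distinct_iff mset_eq_setD)

lemma eqv_valid: "eqv n w w' \<Longrightarrow> valid n w \<longleftrightarrow> valid n w'"
proof (induction rule: eqv.induct)
  case (rotate u v)
  then show ?case by (rule valid_append_commute)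
next
  case (move j y u v)
  show ?case by (rule valid_cong) (simp del: nxt.simps)
next
  case (flip j y u v)
  show ?case by (rule valid_cong) (simp del: nxt.simps)
qed auto

text \<open>
  The path \<open>c, x, -(x + 1), y\<close> is shortened to the edge \<open>{c, y}\<close>, and the gray edge \<open>{x, -(x + 1)}\<close>
  subdivides \<open>{-y, d}\<close>. The last condition says that the removed edges are the only ones of \<open>E\<close> at
  their vertices other than \<open>c\<close> and \<open>d\<close>; it makes the relation symmetric, see \<open>edge_swap_sym\<close>.
\<close>

definition edge_swap ::
    "nat \<Rightarrow> signed_nat \<Rightarrow> signed_nat \<Rightarrow> signed_nat \<Rightarrow> signed_nat \<Rightarrow>
     signed_nat set set \<Rightarrow> signed_nat set set \<Rightarrow> bool" where
  "edge_swap n x y c d E E' \<longleftrightarrow>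
     x \<in> H n \<and> y \<in> H n \<and> c \<in> H n \<and> d \<in> H n \<and>
     y \<noteq> x \<and> y \<noteq> nxt n x \<and> y \<noteq> neg x \<and> y \<noteq> neg (nxt n x) \<and> x \<noteq> neg (nxt n x) \<and>
     c \<noteq> x \<and> c \<noteq> neg (nxt n x) \<and> d \<noteq> x \<and> d \<noteq> neg (nxt n x) \<and>
     (\<exists>K. E = K \<union> {{c, x}, {neg (nxt n x), y}, {neg y, d}} \<and>
          E' = K \<union> {{c, y}, {neg y, x}, {neg (nxt n x), d}} \<and>
          (\<forall>e \<in> K. x \<notin> e \<and> y \<notin> e \<and> neg y \<notin> e \<and> neg (nxt n x) \<notin> e))"

text \<open>The reverse exchange uses the same gray edge read from its other end:
  \<open>neg (nxt n x)\<close> takes the place of \<open>x\<close>, and its successor is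
  \<open>neg x\<close>.\<close>

lemma edge_swap_sym:
  assumes "edge_swap n x y c d E E'"
  shows "edge_swap n (neg (nxt n x)) (neg y) d c E' E"
proof -
  obtain K where K: "E = K \<union> {{c, x}, {neg (nxt n x), y}, {neg y, d}}"
    "E' = K \<union> {{c, y}, {neg y, x}, {neg (nxt n x), d}}"
    "\<forall>e \<in> K. x \<notin> e \<and> y \<notin> e \<and> neg y \<notin> e \<and> neg (nxt n x) \<notin> e"
    and mem: "x \<in> H n" "y \<in> H n" "c \<in> H n" "d \<in> H n"
    and ne: "y \<noteq> x" "y \<noteq> nxt n x" "y \<noteq> neg x"
    "y \<noteq> neg (nxt n x)" "x \<noteq> neg (nxt n x)" "c \<noteq> x" "c \<noteq> neg (nxt n x)" "d \<noteq> x" "d \<noteq> neg (nxt n x)"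
    using assms unfolding edge_swap_def by blast
  have nx: "nxt n (neg (nxt n x)) = neg x" using nxt_neg_nxt[OF mem(1)] by simp
  have "E' = K \<union> {{d, neg (nxt n x)}, {x, neg y}, {y, c}}"
    "E = K \<union> {{d, neg y}, {y, neg (nxt n x)}, {x, c}}"
    unfolding K(1,2) by (simp_all only: insert_commute Un_insert_right)
  moreover have "neg y \<noteq> x" "neg (nxt n x) \<noteq> x" "neg y \<noteq> nxt n x" using ne by (metis neg_neg)+
  ultimately show ?thesis unfolding edge_swap_def nx
    using K(3) mem ne
    by (intro conjI exI[of _ K]) (simp_all del: nxt.simps)
qed

lemma exchange_edge_swap:
  assumes "\<pi> \<in> signed_perms n" "\<theta> \<in> signed_perms n"
    and swap: "edge_swap n x y c d (black_edges n \<pi>) (black_edges n \<theta>)"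
  shows "exchange n x y \<pi> \<theta>"
proof -
  obtain K where K: "black_edges n \<pi> = K \<union> {{c, x}, {neg (nxt n x), y}, {neg y, d}}"
    "black_edges n \<theta> = K \<union> {{c, y}, {neg y, x}, {neg (nxt n x), d}}"
    "\<forall>e \<in> K. x \<notin> e \<and> y \<notin> e \<and> neg y \<notin> e \<and> neg (nxt n x) \<notin> e"
    and mem: "x \<in> H n" "y \<in> H n" "c \<in> H n" "d \<in> H n"
    and ne: "y \<noteq> x" "y \<noteq> nxt n x" "d \<noteq> x"
    using swap unfolding edge_swap_def by blast
  let ?R = "{{c, x}, {neg (nxt n x), y}, {neg y, d}}"
  have "e \<notin> ?R" if "e \<in> K" for e 
  proof
    assume "e \<in> ?R"
    then have "e = {c, x} \<or> e = {neg (nxt n x), y} \<or> e = {neg y, d}" by simp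
    then show False using K(3)[rule_format, OF that] by auto
  qed
  then have "K - ?R = K" by blast
  then have diff: "black_edges n \<pi> - ?R = K" unfolding K(1) by (simp only: Un_Diff Diff_cancel Un_empty_right)
  show ?thesis unfolding exchange_def
  proof (intro conjI; (rule bexI[of _ "neg c"], rule bexI[of _ d], intro conjI)?)
    show "{neg (neg c), x} \<in> black_edges n \<pi>" "{neg (nxt n x), y} \<in> black_edges n \<pi>"
      "{neg y, d} \<in> black_edges n \<pi>" unfolding K(1) by simp_all
    show "if x = d then \<theta> = \<pi> else black_edges n \<theta> =
        black_edges n \<pi> - {{neg (neg c), x}, {neg (nxt n x), y}, {neg y, d}} \<union>
        {{neg (neg c), y}, {neg y, x}, {neg (nxt n x), d}}"
      unfolding neg_neg diff K(2) using ne(3) by simp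
    show "neg c \<in> H n" using mem by simp
  qed (fact assms(1) assms(2) mem ne)+
qed

lemma path_edges_avoid:
  assumes "e \<in> path_edges w" "v \<notin> set (butlast w)" "neg v \<notin> set (tl w)"
  shows "v \<notin> e"
proof
  assume "v \<in> e"
  then have "v \<in> neg ` set (tl w)" using path_edges_vertices[OF assms(1)] assms(2) by blast
  then obtain p where "v = neg p" "p \<in> set (tl w)" by blast
  then show False using assms(3) by simp
qed

lemma lab_notin: "lab y \<notin> lab ` A \<Longrightarrow> y \<notin> A \<and> neg y \<notin> A"
  using image_eqI[of "lab y" lab y A] image_eqI[of "lab y" lab "neg y" A] by auto

text \<open>For \<open>v = []\<close> the letter \<open>y\<close> already follows
  \<open>Pos j\<close> cyclically and the move is a rotation. Otherwise \<open>c\<close> comes from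
  the letter after \<open>Pos j\<close> and \<open>d\<close> is the letter before \<open>y\<close>;
  both lie in \<open>v\<close>, and \<open>K\<close> consists of the edges inside the two untouched
  stretches.\<close>

lemma edge_swap_move:
  assumes v: "valid n (y # nxt n (Pos j) # u @ Pos j # v)" and "v \<noteq> []"
  shows "\<exists>c d. edge_swap n (Pos j) y c d (word_edges (y # nxt n (Pos j) # u @ Pos j # v))
                 (word_edges (nxt n (Pos j) # u @ Pos j # y # v))"
proof -
  let ?x = "Pos j" and ?nx = "nxt n (Pos j)"
  obtain z v' where z: "v = z # v'" using \<open>v \<noteq> []\<close> by (cases v) auto
  obtain v'' d where d: "v = v'' @ [d]" using \<open>v \<noteq> []\<close> by (cases v rule: rev_cases) auto
  define K where "K = path_edges (?nx # u @ [?x]) \<union> path_edges v"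
  have E: "word_edges (y # ?nx # u @ ?x # v) = K \<union> {{neg z, ?x}, {neg ?nx, y}, {neg y, d}}"
  proof -
    have "word_edges (y # ?nx # u @ ?x # v) =
        insert {y, neg ?nx} (path_edges (?nx # u @ [?x]) \<union> path_edges (?x # v @ [y]))"
      using path_edges_append[of "?nx # u" ?x "v @ [y]"] by simp
    also have "path_edges (?x # v @ [y]) = insert {?x, neg z} (path_edges (v @ [y]))"
      using z by simp
    also have "path_edges (v @ [y]) = insert {d, neg y} (path_edges v)"
      using path_edges_snoc[of v'' d y] d by simp
    finally show ?thesis by (auto simp: K_def insert_commute)
  qed
  have E': "word_edges (?nx # u @ ?x # y # v) = K \<union> {{neg z, y}, {neg y, ?x}, {neg ?nx, d}}"
  proof -
    have "word_edges (?nx # u @ ?x # y # v) =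
        path_edges (?nx # u @ [?x]) \<union> insert {?x, neg y} (path_edges (y # v @ [?nx]))"
      using path_edges_append[of "?nx # u" ?x "y # v @ [?nx]"] by simp
    also have "path_edges (y # v @ [?nx]) = insert {y, neg z} (path_edges (v @ [?nx]))"
      using z by simp
    also have "path_edges (v @ [?nx]) = insert {d, neg ?nx} (path_edges v)"
      using path_edges_snoc[of v'' d ?nx] d by simp
    finally show ?thesis by (auto simp: K_def insert_commute)
  qed
  have dist: "distinct (map lab (y # ?nx # u @ ?x # v))"
    and labs: "lab ` set (y # ?nx # u @ ?x # v) = {..n}"
    using v by (auto simp: valid_def)
  have H: "a \<in> H n" if "a \<in> set (y # ?nx # u @ ?x # v)" for a
    using that labs by (auto simp: mem_H_iff)
  have x: "?x \<notin> set u" "neg ?x \<notin> set u" "?x \<notin> set v" "neg ?x \<notin> set v" "lab ?x \<noteq> lab ?nx"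
    and y: "y \<notin> set u" "neg y \<notin> set u" "y \<notin> set v" "neg y \<notin> set v"
    "lab y \<noteq> lab ?nx" "lab y \<noteq> lab ?x"
    and nx: "?nx \<notin> set u" "neg ?nx \<notin> set u" "?nx \<notin> set v" "neg ?nx \<notin> set v"
    using dist lab_notin[of ?x "set u"] lab_notin[of ?x "set v"] lab_notin[of y "set u"]
      lab_notin[of y "set v"] lab_notin[of ?nx "set u"] lab_notin[of ?nx "set v"]
    by (auto simp del: nxt.simps neg.simps lab.simps)
  have ne: "y \<noteq> ?x" "y \<noteq> ?nx" "y \<noteq> neg ?x" "y \<noteq> neg ?nx" "?x \<noteq> neg ?nx" "?x \<noteq> ?nx"
    "neg y \<noteq> ?x" "neg y \<noteq> ?nx"
    using x(5) y(5,6) by (metis lab_neg)+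
  have "z \<in> set v" unfolding z by simp
  moreover have "d \<in> set v" unfolding d by simp
  ultimately have mem: "z \<in> set v" "d \<in> set v" .
  have K: "\<forall>e \<in> K. ?x \<notin> e \<and> y \<notin> e \<and> neg y \<notin> e \<and> neg ?nx \<notin> e"
  proof
    fix e assume "e \<in> K"
    then consider "e \<in> path_edges (?nx # u @ [?x])" | "e \<in> path_edges v"
      by (auto simp: K_def)
    then show "?x \<notin> e \<and> y \<notin> e \<and> neg y \<notin> e \<and> neg ?nx \<notin> e"
    proof cases
      case 1
      show ?thesis
        by (intro conjI; rule path_edges_avoid[OF 1])
          (use x y nx ne in \<open>auto simp: butlast_append simp del: nxt.simps neg.simps\<close>)
    next
      case 2
      have sub: "set (butlast v) \<subseteq> set v" "set (tl v) \<subseteq> set v"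
        by (auto dest: in_set_butlastD list.set_sel(2)[rotated]) (metis list.set_sel(2) tl_Nil)
      show ?thesis
        by (intro conjI; rule path_edges_avoid[OF 2])
          (use x y nx sub in \<open>auto simp del: nxt.simps neg.simps\<close>)
    qed
  qed
  have "edge_swap n ?x y (neg z) d (word_edges (y # ?nx # u @ ?x # v))
      (word_edges (?nx # u @ ?x # y # v))"
    unfolding edge_swap_def
  proof (intro conjI exI[of _ K])
    show "neg z \<noteq> ?x" using x mem by (metis neg_neg)
    show "neg z \<noteq> neg ?nx" using nx mem by (metis neg_neg)
    show "d \<noteq> ?x" using x mem by metis
    show "d \<noteq> neg ?nx" using nx mem by metis
    show "neg z \<in> H n" "d \<in> H n" using H mem by auto
    show "?x \<in> H n" "y \<in> H n" using H[of ?x] H[of y] by simp_all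
  qed (fact E E' K ne)+
  then show ?thesis by blast
qed


text \<open>Here \<open>c\<close> is the letter before \<open>Neg j\<close> and \<open>d\<close> the
  one before \<open>y\<close>. They exist even for empty \<open>u\<close> and \<open>v\<close>,
  since they may be \<open>nxt n (Pos j)\<close> and \<open>Neg j\<close> themselves.\<close>

lemma edge_swap_flip:
  assumes v: "valid n (y # nxt n (Pos j) # u @ Neg j # v)"
  shows "\<exists>c d. edge_swap n (Pos j) y c d (word_edges (y # nxt n (Pos j) # u @ Neg j # v))
                 (word_edges (nxt n (Pos j) # u @ neg y # Neg j # v))"
proof -
  let ?x = "Pos j" and ?nx = "nxt n (Pos j)"
  obtain u' c where c: "?nx # u = u' @ [c]" by (metis append_butlast_last_id list.distinct(1))
  obtain v' d where d: "Neg j # v = v' @ [d]" by (metis append_butlast_last_id list.distinct(1))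
  define K where "K = path_edges (?nx # u) \<union> path_edges (Neg j # v)"
  have E: "word_edges (y # ?nx # u @ Neg j # v) = K \<union> {{c, ?x}, {neg ?nx, y}, {neg y, d}}"
  proof -
    have "word_edges (y # ?nx # u @ Neg j # v) =
        insert {y, neg ?nx} (path_edges ((?nx # u) @ [Neg j]) \<union> path_edges ((Neg j # v) @ [y]))"
      using path_edges_append[of "?nx # u" "Neg j" "v @ [y]"] by simp
    also have "path_edges ((?nx # u) @ [Neg j]) = insert {c, ?x} (path_edges (?nx # u))"
      unfolding c using path_edges_snoc[of u' c "Neg j"] by simp
    also have "path_edges ((Neg j # v) @ [y]) = insert {d, neg y} (path_edges (Neg j # v))"
      unfolding d using path_edges_snoc[of v' d y] by simp
    finally show ?thesis by (auto simp: K_def insert_commute)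
  qed
  have E': "word_edges (?nx # u @ neg y # Neg j # v) = K \<union> {{c, y}, {neg y, ?x}, {neg ?nx, d}}"
  proof -
    have "word_edges (?nx # u @ neg y # Neg j # v) =
        path_edges ((?nx # u) @ [neg y]) \<union> insert {neg y, ?x} (path_edges ((Neg j # v) @ [?nx]))"
      using path_edges_append[of "?nx # u" "neg y" "Neg j # v @ [?nx]"] by simp
    also have "path_edges ((?nx # u) @ [neg y]) = insert {c, y} (path_edges (?nx # u))"
      unfolding c using path_edges_snoc[of u' c "neg y"] by simp
    also have "path_edges ((Neg j # v) @ [?nx]) = insert {d, neg ?nx} (path_edges (Neg j # v))"
      unfolding d using path_edges_snoc[of v' d ?nx] by simp
    finally show ?thesis by (auto simp: K_def insert_commute)
  qed
  have dist: "distinct (map lab (y # ?nx # u @ Neg j # v))"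
    and labs: "lab ` set (y # ?nx # u @ Neg j # v) = {..n}"
    using v by (auto simp: valid_def)
  have H: "a \<in> H n" if "a \<in> set (y # ?nx # u @ Neg j # v)" for a
    using that labs by (auto simp: mem_H_iff)
  have x: "?x \<notin> set u" "neg ?x \<notin> set u" "?x \<notin> set v" "neg ?x \<notin> set v" "lab ?x \<noteq> lab ?nx"
    and y: "y \<notin> set u" "neg y \<notin> set u" "y \<notin> set v" "neg y \<notin> set v"
    "lab y \<noteq> lab ?nx" "lab y \<noteq> lab ?x"
    and nx: "?nx \<notin> set u" "neg ?nx \<notin> set u" "?nx \<notin> set v" "neg ?nx \<notin> set v"
    using dist lab_notin[of ?x "set u"] lab_notin[of ?x "set v"] lab_notin[of y "set u"]
      lab_notin[of y "set v"] lab_notin[of ?nx "set u"] lab_notin[of ?nx "set v"]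
    by (auto simp del: nxt.simps neg.simps)
  have ne: "y \<noteq> ?x" "y \<noteq> ?nx" "y \<noteq> neg ?x" "y \<noteq> neg ?nx" "?x \<noteq> neg ?nx" "?x \<noteq> ?nx"
    "neg y \<noteq> ?x" "neg y \<noteq> ?nx"
    using x(5) y(5,6) by (metis lab_neg)+
  have "c \<in> set (?nx # u)" unfolding c by simp
  moreover have "d \<in> set (Neg j # v)" unfolding d by simp
  ultimately have mem: "c = ?nx \<or> c \<in> set u" "d = neg ?x \<or> d \<in> set v" by auto
  have K: "\<forall>e \<in> K. ?x \<notin> e \<and> y \<notin> e \<and> neg y \<notin> e \<and> neg ?nx \<notin> e"
  proof
    fix e assume "e \<in> K"
    then consider "e \<in> path_edges (?nx # u)" | "e \<in> path_edges (neg ?x # v)"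
      by (auto simp: K_def)
    then show "?x \<notin> e \<and> y \<notin> e \<and> neg y \<notin> e \<and> neg ?nx \<notin> e"
    proof cases
      case 1
      have "set (butlast (?nx # u)) \<subseteq> set (?nx # u)" by (meson in_set_butlastD subsetI)
      then show ?thesis
        by (intro conjI; intro path_edges_avoid[OF 1])
          (use x y nx ne in \<open>auto simp del: nxt.simps neg.simps butlast.simps\<close>)
    next
      case 2
      have "set (butlast (neg ?x # v)) \<subseteq> set (neg ?x # v)" by (meson in_set_butlastD subsetI)
      then show ?thesis
        by (intro conjI; intro path_edges_avoid[OF 2])
          (use x y nx ne in \<open>auto simp del: nxt.simps neg.simps butlast.simps\<close>)
    qed
  qed
  have "edge_swap n ?x y c d (word_edges (y # ?nx # u @ Neg j # v))
      (word_edges (?nx # u @ neg y # Neg j # v))"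
    unfolding edge_swap_def
  proof (intro conjI exI[of _ K])
    show "c \<noteq> ?x" using x ne mem(1) by metis
    show "c \<noteq> neg ?nx" using nx mem(1) by (metis neg_neq(2))
    show "d \<noteq> ?x" using x mem(2) by (metis neg_neq(2))
    show "d \<noteq> neg ?nx" using nx ne mem(2) by (metis neg_neg)
    show "c \<in> H n" "d \<in> H n" using H mem by auto
    show "?x \<in> H n" "y \<in> H n" using H[of "neg ?x"] H[of y] by (simp_all add: mem_H_iff)
  qed (fact E E' K ne)+
  then show ?thesis by blast
qed

text \<open>Induction over \<open>eqv\<close> as seen by the edge sets: rotation and inversion are
  invisible, and a proper exchange is an \<open>edge_swap\<close>. Both the realisation by
  operations and the invariance of the cycle count are instances.\<close>

lemma eqv_edges_cases:
  assumes "valid n w" "eqv n w w'"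
    and refl: "\<And>w w'. valid n w \<Longrightarrow> valid n w' \<Longrightarrow> word_edges w = word_edges w' \<Longrightarrow> P w w'"
    and sym: "\<And>w w'. valid n w \<Longrightarrow> valid n w' \<Longrightarrow> P w w' \<Longrightarrow> P w' w"
    and trans: "\<And>w w' w''. valid n w \<Longrightarrow> valid n w' \<Longrightarrow> valid n w'' \<Longrightarrow> P w w' \<Longrightarrow> P w' w'' \<Longrightarrow> P w w''"
    and swap: "\<And>w w' x y c d. valid n w \<Longrightarrow> valid n w' \<Longrightarrow>
      edge_swap n x y c d (word_edges w) (word_edges w') \<Longrightarrow> P w w'"
  shows "P w w'"
  using assms(2,1)
proof (induction rule: eqv.induct)
  case (sym w w') then show ?case using assms(4) eqv_valid by blast
next
  case (trans w w' w'') then show ?case using assms(5) eqv_valid by blast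
next
  case (rotate u v)
  then show ?case using refl word_edges_append_commute valid_append_commute by blast
next
  case (winv w) then show ?case using refl word_edges_winv by simp
next
  case (move j y u v)
  have v: "valid n (nxt n (Pos j) # u @ Pos j # y # v)"
    using move eqv_valid[OF eqv.move] by blast
  show ?case
  proof (cases "v = []")
    case True
    then show ?thesis
      using refl[OF move(2) v] word_edges_append_commute[of "[y]" "nxt n (Pos j) # u @ [Pos j]"]
      by simp
  next
    case False
    then show ?thesis using edge_swap_move[OF move(2)] swap[OF move(2) v] by blast
  qed
next
  case (flip j y u v)
  have "valid n (nxt n (Pos j) # u @ neg y # Neg j # v)"
    using flip eqv_valid[OF eqv.flip] by blast
  then show ?case using edge_swap_flip[OF flip(2)] swap flip(2) by blast
qed (rule refl; simp)

lemma eqv_operations: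
  assumes "valid n w" "eqv n w w'" "\<pi> \<in> signed_perms n" "\<theta> \<in> signed_perms n"
    and "black_edges n \<pi> = word_edges w" "black_edges n \<theta> = word_edges w'"
  shows "(operation n)\<^sup>*\<^sup>* \<pi> \<theta> \<and> (operation n)\<^sup>*\<^sup>* \<theta> \<pi>"
proof -
  define P where "P w w' \<longleftrightarrow> (\<forall>\<pi> \<in> signed_perms n. \<forall>\<theta> \<in> signed_perms n.
      black_edges n \<pi> = word_edges w \<longrightarrow> black_edges n \<theta> = word_edges w' \<longrightarrow>
      (operation n)\<^sup>*\<^sup>* \<pi> \<theta> \<and> (operation n)\<^sup>*\<^sup>* \<theta> \<pi>)" for w w'
  have "P w w'"
  proof (rule eqv_edges_cases[OF assms(1,2)])
    fix w w' assume "word_edges w = word_edges w'"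
    then show "P w w'" unfolding P_def using black_edges_inject by (metis rtranclp.rtrancl_refl)
  next
    fix w w' assume "P w w'" then show "P w' w" unfolding P_def by blast
  next
    fix w w' w'' assume "valid n w'" "P w w'" "P w' w''"
    \<comment> \<open>Transitivity needs an actual permutation whose word is the intermediate
      one.\<close>
    then show "P w w''" unfolding P_def using ex_perm[of n w'] by (meson rtranclp_trans)
  next
    fix w w' x y c d assume "edge_swap n x y c d (word_edges w) (word_edges w')"
    then show "P w w'"
      unfolding P_def operation_def
      by (metis (mono_tags, lifting) edge_swap_sym exchange_edge_swap r_into_rtranclp)
  qed
  then show ?thesis using assms unfolding P_def by blast
qed

section \<open>Cycles of the breakpoint graph\<close>

text \<open>Cycles are counted as connected components, because components of graphs on different
  vertex sets can be compared through maps that contract or expand paths, without handling vertex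
  lists.\<close>

definition conn :: "signed_nat set set \<Rightarrow> signed_nat \<Rightarrow> signed_nat \<Rightarrow> bool" where
  "conn E = (\<lambda>u v. {u, v} \<in> E)\<^sup>*\<^sup>*"

definition num_comps :: "signed_nat set \<Rightarrow> signed_nat set set \<Rightarrow> nat" where
  "num_comps V E = card ((\<lambda>v. Collect (conn E v)) ` V)"

lemma conn_refl [simp]: "conn E u u"
  by (simp add: conn_def)

lemma conn_edge: "{u, v} \<in> E \<Longrightarrow> conn E u v"
  by (simp add: conn_def r_into_rtranclp)

lemma conn_trans [trans]: "conn E u v \<Longrightarrow> conn E v w \<Longrightarrow> conn E u w"
  unfolding conn_def by (rule rtranclp_trans)

lemma conn_sym: "conn E u v \<Longrightarrow> conn E v u"
proof -
  have "symp (\<lambda>u v. {u, v} \<in> E)" by (auto intro: sympI simp: insert_commute)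
  then show "conn E u v \<Longrightarrow> conn E v u"
    unfolding conn_def by (blast dest: symp_rtranclp sympD)
qed

lemma conn_induct:
  assumes "conn E u v" "P u" "\<And>a b. P a \<Longrightarrow> {a, b} \<in> E \<Longrightarrow> P b"
  shows "P v"
  using assms(1) unfolding conn_def by (induction rule: rtranclp_induct) (use assms(2,3) in auto)

lemma Collect_conn_eq_iff: "Collect (conn E u) = Collect (conn E v) \<longleftrightarrow> conn E u v"
  by (metis conn_refl conn_sym conn_trans mem_Collect_eq Collect_cong)

lemma card_image_eq_if:
  assumes "\<And>u v. u \<in> V \<Longrightarrow> v \<in> V \<Longrightarrow> F u = F v \<longleftrightarrow> G u = G v"
  shows "card (F ` V) = card (G ` V)"
proof (rule bij_betw_same_card)
  define h where "h c = G (SOME v. v \<in> V \<and> F v = c)" for c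
  have h: "h (F v) = G v" if "v \<in> V" for v
  proof -
    have "(SOME u. u \<in> V \<and> F u = F v) \<in> V \<and> F (SOME u. u \<in> V \<and> F u = F v) = F v"
      by (rule someI) (use that in simp)
    then show ?thesis unfolding h_def using assms that by blast
  qed
  show "bij_betw h (F ` V) (G ` V)"
    unfolding bij_betw_def inj_on_def by (auto simp: h assms image_iff)
qed

text \<open>Two maps that carry edges to connected pairs and are mutually inverse up to
  connectedness induce inverse bijections between the components.\<close>

lemma num_comps_eq:
  assumes "f ` V \<subseteq> V'" "g ` V' \<subseteq> V"
    and f: "\<And>u v. {u, v} \<in> E \<Longrightarrow> conn E' (f u) (f v)"
    and g: "\<And>u v. {u, v} \<in> E' \<Longrightarrow> conn E (g u) (g v)"
    and gf: "\<And>v. v \<in> V \<Longrightarrow> conn E v (g (f v))"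
    and fg: "\<And>v. v \<in> V' \<Longrightarrow> conn E' v (f (g v))"
  shows "num_comps V E = num_comps V' E'"
proof -
  have fc: "conn E' (f u) (f v)" if "conn E u v" for u v
    using that by (rule conn_induct) (use f conn_trans in auto)
  have gc: "conn E (g u) (g v)" if "conn E' u v" for u v
    using that by (rule conn_induct) (use g conn_trans in auto)
  have iff: "conn E u v \<longleftrightarrow> conn E' (f u) (f v)" if "u \<in> V" "v \<in> V" for u v
    using fc gc gf that by (meson conn_sym conn_trans)
  have "num_comps V E = card ((\<lambda>v. Collect (conn E' (f v))) ` V)"
    unfolding num_comps_def by (rule card_image_eq_if) (simp add: Collect_conn_eq_iff iff)
  also have "(\<lambda>v. Collect (conn E' (f v))) ` V = (\<lambda>v. Collect (conn E' v)) ` V'"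
  proof
    show "(\<lambda>v. Collect (conn E' v)) ` V' \<subseteq> (\<lambda>v. Collect (conn E' (f v))) ` V"
    proof (rule image_subsetI)
      fix v assume v: "v \<in> V'"
      then have "Collect (conn E' v) = Collect (conn E' (f (g v)))"
        using fg by (simp add: Collect_conn_eq_iff)
      then show "Collect (conn E' v) \<in> (\<lambda>v. Collect (conn E' (f v))) ` V" using v assms(2) by blast
    qed
  qed (use assms(1) in blast)
  finally show ?thesis by (simp add: num_comps_def)
qed

lemma num_comps_insert:
  assumes "finite V" "v \<notin> V" "\<And>e. e \<in> E \<Longrightarrow> v \<notin> e"
  shows "num_comps (insert v V) E = Suc (num_comps V E)"
proof -
  have "\<not> conn E u v" if "u \<in> V" for u
  proof
    assume "conn E u v"
    then have "conn E v u" by (rule conn_sym)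
    then have "u = v"
    proof (rule conn_induct)
      fix a b assume "a = v" "{a, b} \<in> E"
      then show "b = v" using assms(3)[of "{a, b}"] by simp
    qed simp
    then show False using assms(2) that by simp
  qed
  then have "Collect (conn E v) \<noteq> Collect (conn E u)" if "u \<in> V" for u
    using that conn_sym unfolding Collect_conn_eq_iff by blast
  then have "Collect (conn E v) \<notin> (\<lambda>v. Collect (conn E v)) ` V" by blast
  then show ?thesis using assms(1) by (simp add: num_comps_def)
qed

lemma num_comps_one:
  assumes "u \<in> V" "\<And>v. v \<in> V \<Longrightarrow> conn E u v"
  shows "num_comps V E = 1"
proof -
  have "Collect (conn E v) = Collect (conn E u)" if "v \<in> V" for v
    unfolding Collect_conn_eq_iff by (rule conn_sym[OF assms(2)[OF that]])
  then have "(\<lambda>v. Collect (conn E v)) ` V = (\<lambda>v. Collect (conn E u)) ` V" by (rule image_cong[OF HOL.refl])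
  then show ?thesis using assms(1) by (simp add: num_comps_def image_constant)
qed

section \<open>Perfect matchings and alternating cycles\<close>

definition matching :: "'a set \<Rightarrow> 'a set set \<Rightarrow> bool" where
  "matching V M \<longleftrightarrow>
     (\<forall>e \<in> M. \<exists>a b. e = {a, b} \<and> a \<noteq> b \<and> a \<in> V \<and> b \<in> V) \<and> (\<forall>v \<in> V. \<exists>u. {v, u} \<in> M) \<and>
     (\<forall>e \<in> M. \<forall>e' \<in> M. \<forall>v. v \<in> e \<longrightarrow> v \<in> e' \<longrightarrow> e = e')"

lemma matching_word_edges: "valid n w \<Longrightarrow> matching (H n) (word_edges w)"
proof -
  assume w: "valid n w"
  show ?thesis unfolding matching_def
  proof (intro conjI ballI allI impI)
    show "\<exists>a b. e = {a, b} \<and> a \<noteq> b \<and> a \<in> H n \<and> b \<in> H n" if "e \<in> word_edges w" for e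
      using word_edge_mem_H[OF w that] by metis
    show "\<exists>u. {v, u} \<in> word_edges w" if "v \<in> H n" for v
      using word_edge_partner[OF w that] by metis
  qed (rule word_edge_unique[OF w])
qed

lemma matchingD:
  assumes "matching V M" "{u, v} \<in> M"
  shows "u \<in> V" "v \<in> V" "u \<noteq> v" "\<And>w. {u, w} \<in> M \<Longrightarrow> w = v" "\<And>w. {w, u} \<in> M \<Longrightarrow> w = v"
proof -
  show "u \<in> V" "v \<in> V" "u \<noteq> v"
    using assms unfolding matching_def by (metis doubleton_eq_iff insertI1 singletonD)+
  show *: "w = v" if "{u, w} \<in> M" for w
  proof -
    have "{u, w} = {u, v}" using assms that unfolding matching_def by (metis insertI1)
    then show ?thesis by (auto simp: doubleton_eq_iff)
  qed
  show "w = v" if "{w, u} \<in> M" for w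
    using *[of w] that by (simp add: insert_commute)
qed

lemma alternating_cycle_component:
  assumes B: "matching (H n) (black_edges n \<pi>)" and G: "matching (H n) (gray_edges n)"
    and vs: "alternating_cycle n \<pi> vs"
  shows "vs ! 0 \<in> H n" "set vs = Collect (conn (black_edges n \<pi> \<union> gray_edges n) (vs ! 0))"
proof -
  let ?L = "length vs" and ?E = "black_edges n \<pi> \<union> gray_edges n"
  have L: "0 < ?L" "even ?L" using vs by (auto simp: alternating_cycle_def)
  have edge: "{vs ! i, vs ! (Suc i mod ?L)} \<in> (if even i then black_edges n \<pi> else gray_edges n)"
    if "i < ?L" for i using vs that by (simp add: alternating_cycle_def)
  show "vs ! 0 \<in> H n" using edge[OF L(1)] matchingD(1)[OF B] by simp
  \<comment> \<open>The length is even, so also the predecessor of position 0 has the opposite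
    parity. Hence both edges at a vertex of the list lead to its two neighbours in the list.\<close>
  have prev: "\<exists>k < ?L. Suc k mod ?L = i \<and> (even k \<longleftrightarrow> odd i)" if "i < ?L" for i
  proof (cases i)
    case 0
    then show ?thesis using L by (intro exI[of _ "?L - 1"]) auto
  next
    case (Suc k)
    then show ?thesis using that by (intro exI[of _ k]) auto
  qed
  have closed: "u \<in> set vs" if "v \<in> set vs" "{v, u} \<in> ?E" for u v
  proof -
    obtain i where i: "i < ?L" "v = vs ! i" using \<open>v \<in> set vs\<close> by (auto simp: in_set_conv_nth)
    obtain k where k: "k < ?L" "Suc k mod ?L = i" "even k \<longleftrightarrow> odd i" using prev[OF i(1)] by blast
    have 1: "{v, vs ! (Suc i mod ?L)} \<in> (if even i then black_edges n \<pi> else gray_edges n)"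
      using edge[OF i(1)] i(2) by simp
    have 2: "{v, vs ! k} \<in> (if even i then gray_edges n else black_edges n \<pi>)"
      using edge[OF k(1)] k(2,3) i(2) by (auto simp: insert_commute)
    have "u = vs ! (Suc i mod ?L) \<or> u = vs ! k"
    proof (cases "{v, u} \<in> black_edges n \<pi>")
      case True
      then show ?thesis using matchingD(4)[OF B _ True] 1 2 by (cases "even i") auto
    next
      case False
      then have "{v, u} \<in> gray_edges n" using that by simp
      then show ?thesis using matchingD(4)[OF G] 1 2 by (cases "even i") auto
    qed
    then show ?thesis using k(1) L(1) by auto
  qed
  have "conn ?E (vs ! 0) (vs ! i)" if "i < ?L" for i
    using that
  proof (induction i)
    case (Suc i)
    then have "{vs ! i, vs ! Suc i} \<in> ?E" using edge[of i] by (auto split: if_splits)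
    then show ?case using Suc conn_edge conn_trans by (metis Suc_lessD)
  qed simp
  then have "set vs \<subseteq> Collect (conn ?E (vs ! 0))" by (auto simp: in_set_conv_nth)
  moreover have "v \<in> set vs" if "conn ?E (vs ! 0) v" for v
    using that by (rule conn_induct) (use L closed in auto)
  ultimately show "set vs = Collect (conn ?E (vs ! 0))" by blast
qed

text \<open>Follow black and gray edges alternately from \<open>v\<close> until a vertex first
  repeats. In a matching the walk cannot re-enter itself except at its start, and there only through
  a gray edge.\<close>

lemma ex_alternating_cycle:
  assumes B: "matching (H n) (black_edges n \<pi>)" and G: "matching (H n) (gray_edges n)"
    and v: "v \<in> H n"
  shows "\<exists>vs. alternating_cycle n \<pi> vs \<and> vs ! 0 = v"
proof -
  define M where "M i = (if even i then black_edges n \<pi> else gray_edges n)" for i :: nat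
  have M: "matching (H n) (M i)" for i using B G by (simp add: M_def)
  define s where "s = rec_nat v (\<lambda>i u. SOME w. {u, w} \<in> M i)"
  have s0: "s 0 = v" and sS: "s (Suc i) = (SOME w. {s i, w} \<in> M i)" for i by (simp_all add: s_def)
  have edge: "{s i, s (Suc i)} \<in> M i" if "s i \<in> H n" for i
    unfolding sS by (rule someI_ex) (use M[of i] that in \<open>auto simp: matching_def\<close>)
  have mem: "s i \<in> H n" for i
    by (induction i) (use v s0 edge matchingD(2)[OF M] in auto)
  note edge = edge[OF mem]
  have "\<not> inj s" using finite_subset[of "range s" "H n"] mem finite_imageD by fastforce
  then have "\<exists>j i. i < j \<and> s i = s j" unfolding inj_def by (metis linorder_neqE_nat)
  then obtain j i where ij: "i < j" "s i = s j" and least: "\<And>j' i'. j' < j \<Longrightarrow> i' < j' \<Longrightarrow> s i' \<noteq> s j'"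
    using exists_least_iff[of "\<lambda>j. \<exists>i < j. s i = s j"] by blast
  have inj: "a = b" if "s a = s b" "a < j" "b < j" for a b
    using least that by (metis linorder_neqE_nat)
  obtain k where k: "j = Suc k" using ij(1) by (cases j) auto
  have ek: "{s i, s k} \<in> M k" using edge[of k] ij(2) k by (simp add: insert_commute)
  \<comment> \<open>If the closing edge had the colour of the edge leaving \<open>s i\<close>, the
    two would coincide, giving \<open>k = Suc i\<close> and a parity contradiction. So it has the
    other colour, and for \<open>i > 0\<close> it would be the edge by which \<open>s i\<close> was
    first entered.\<close>
  have par: "even k \<longleftrightarrow> odd i"
  proof (rule ccontr)
    assume np: "\<not> (even k \<longleftrightarrow> odd i)"
    then have "M k = M i" by (auto simp: M_def)
    then have "s k = s (Suc i)" using matchingD(4)[OF M edge[of i]] ek by simp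
    moreover have "Suc i \<noteq> j" using matchingD(3)[OF M edge[of i]] ij(2) by auto
    ultimately have "k = Suc i" using inj[of k "Suc i"] ij(1) k by simp
    then show False using np by simp
  qed
  have "i = 0"
  proof (rule ccontr)
    assume "i \<noteq> 0"
    then obtain h where h: "i = Suc h" by (cases i) auto
    then have "M k = M h" using par by (auto simp: M_def)
    moreover have "{s i, s h} \<in> M h" using edge[of h] h by (simp add: insert_commute)
    ultimately have "s k = s h" using matchingD(4)[OF M, of "s i" "s h" h] ek by simp
    then have "k = h" using inj[of k h] ij(1) h k by simp
    then show False using ij(1) h k by simp
  qed
  have "alternating_cycle n \<pi> (map s [0..<j])"
    unfolding alternating_cycle_def
  proof (intro conjI allI impI)
    show "distinct (map s [0..<j])" unfolding distinct_map using inj by (auto intro: inj_onI)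
    fix a assume a: "a < length (map s [0..<j])"
    have "s (Suc a mod j) = s (Suc a)" using a ij \<open>i = 0\<close> by (cases "Suc a = j") auto
    then show "{map s [0..<j] ! a, map s [0..<j] ! (Suc a mod length (map s [0..<j]))}
        \<in> (if even a then black_edges n \<pi> else gray_edges n)"
      using edge[of a] a by (simp add: M_def split: if_splits)
  qed (use k par \<open>i = 0\<close> in auto)
  then show ?thesis using s0 k by (intro exI[of _ "map s [0..<j]"]) (simp del: upt_Suc)
qed

lemma num_cycles_eq:
  assumes "\<pi> \<in> signed_perms n"
  shows "num_cycles n \<pi> = num_comps (H n) (black_edges n \<pi> \<union> gray_edges n)"
proof -
  have B: "matching (H n) (black_edges n \<pi>)" and G: "matching (H n) (gray_edges n)"
    unfolding black_edges_eq[OF assms] gray_edges_eq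
    using matching_word_edges valid_perm_word[OF assms] valid_upt by blast+
  have "{set vs | vs. alternating_cycle n \<pi> vs} =
      (\<lambda>v. Collect (conn (black_edges n \<pi> \<union> gray_edges n) v)) ` H n"
    using alternating_cycle_component[OF B G] ex_alternating_cycle[OF B G] by blast
  then show ?thesis by (simp add: num_cycles_def num_comps_def)
qed

section \<open>The cycle count of a word and its invariance\<close>

definition word_comps :: "nat \<Rightarrow> signed_nat list \<Rightarrow> nat" where
  "word_comps n w = num_comps (H n) (word_edges w \<union> gray_edges n)"

lemma matching_gray: "matching (H n) (gray_edges n)"
  unfolding gray_edges_eq using matching_word_edges valid_upt by blast

lemma gray_edge: "x \<in> H n \<Longrightarrow> {x, neg (nxt n x)} \<in> gray_edges n"
  unfolding gray_edges_def by blast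

text \<open>The map \<open>f x y\<close> contracts the gray edge at \<open>x\<close> onto
  \<open>y\<close>, which is its neighbour in \<open>E\<close>; the edge \<open>{neg y, d}\<close>
  becomes the path through the reinserted gray edge. The map back is the same construction for the
  reverse swap.\<close>

lemma num_comps_edge_swap:
  assumes swap: "edge_swap n x y c d E E'"
  shows "num_comps (H n) (E \<union> gray_edges n) = num_comps (H n) (E' \<union> gray_edges n)"
proof -
  define f where "f x y v = (if v = x \<or> v = neg (nxt n x) then y else v)" for x y v
  have main: "conn (E' \<union> gray_edges n) (f x y u) (f x y v)"
    if swap: "edge_swap n x y c d E E'" and uv: "{u, v} \<in> E \<union> gray_edges n" for x y c d E E' u v
  proof -
    let ?x' = "neg (nxt n x)"
    obtain K where K: "E = K \<union> {{c, x}, {?x', y}, {neg y, d}}"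
      "E' = K \<union> {{c, y}, {neg y, x}, {?x', d}}"
      "\<forall>e \<in> K. x \<notin> e \<and> y \<notin> e \<and> neg y \<notin> e \<and> ?x' \<notin> e"
      and x: "x \<in> H n" and ne: "y \<noteq> x" "y \<noteq> nxt n x" "y \<noteq> neg x"
      "y \<noteq> ?x'" "x \<noteq> ?x'" "c \<noteq> x" "c \<noteq> ?x'" "d \<noteq> x" "d \<noteq> ?x'"
      using swap unfolding edge_swap_def by blast
    let ?F = "E' \<union> gray_edges n"
    have gx: "{x, ?x'} \<in> gray_edges n" using gray_edge x by blast
    have fid: "f x y w = w" if "w \<noteq> x" "w \<noteq> ?x'" for w
      using that by (auto simp: f_def)
    have fx: "f x y x = y" "f x y ?x' = y" by (auto simp: f_def)
    have ny: "f x y (neg y) = neg y" using fid[of "neg y"] ne by (metis neg_neg)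
    have yc: "conn ?F y c" by (rule conn_edge) (simp add: K(2) insert_commute)
    have yd: "conn ?F (neg y) d"
    proof -
      have "conn ?F (neg y) x" by (rule conn_edge) (simp add: K(2))
      also have "conn ?F x ?x'" by (rule conn_edge) (simp add: gx)
      also have "conn ?F ?x' d" by (rule conn_edge) (simp add: K(2))
      finally show ?thesis .
    qed
    consider "{u, v} \<in> K" | "{u, v} = {c, x}" | "{u, v} = {?x', y}" | "{u, v} = {neg y, d}"
      | "{u, v} \<in> gray_edges n" using uv unfolding K(1) by blast
    then show ?thesis
    proof cases
      case 1
      have "x \<notin> {u, v}" "?x' \<notin> {u, v}" using K(3)[rule_format, OF 1] by blast+
      then have "f x y u = u" "f x y v = v" by (auto simp: f_def)
      moreover have "{u, v} \<in> ?F" using 1 unfolding K(2) by simp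
      ultimately show ?thesis by (simp add: conn_edge)
    next
      case 2
      then have "u = c \<and> v = x \<or> u = x \<and> v = c" by (simp add: doubleton_eq_iff)
      then show ?thesis using fx fid[OF ne(6,7)] yc conn_sym[OF yc] by (elim disjE conjE) simp_all
    next
      case 3
      then have "u = ?x' \<and> v = y \<or> u = y \<and> v = ?x'" by (simp add: doubleton_eq_iff)
      then show ?thesis using fx fid[OF ne(1,4)] by (elim disjE conjE) simp_all
    next
      case 4
      then have "u = neg y \<and> v = d \<or> u = d \<and> v = neg y" by (simp add: doubleton_eq_iff)
      then show ?thesis using ny fid[OF ne(8,9)] yd conn_sym[OF yd] by (elim disjE conjE) simp_all
    next
      case 5
      show ?thesis
      proof (cases "u = x \<or> u = ?x' \<or> v = x \<or> v = ?x'")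
        case True
        have "{u, v} = {x, ?x'}"
          using True 5 gx matching_gray[of n] unfolding matching_def by (metis insertI1 insertI2)
        then have "u = x \<and> v = ?x' \<or> u = ?x' \<and> v = x" by (simp add: doubleton_eq_iff)
        then show ?thesis using fx by (elim disjE conjE) simp_all
      next
        case False
        then have "f x y u = u" "f x y v = v" by (auto simp: f_def)
        moreover have "{u, v} \<in> ?F" using 5 by simp
        ultimately show ?thesis by (simp add: conn_edge)
      qed
    qed
  qed
  let ?x' = "neg (nxt n x)"
  have nx': "neg (nxt n ?x') = x"
    using swap nxt_neg_nxt[of x n] by (simp add: edge_swap_def)
  have K: "x \<in> H n" "y \<in> H n" "y \<noteq> x" "y \<noteq> ?x'" "y \<noteq> neg x" "y \<noteq> nxt n x"
    "{?x', y} \<in> E" "{neg y, x} \<in> E'"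
    using swap unfolding edge_swap_def by blast+
  show ?thesis
  proof (rule num_comps_eq[where f = "f x y" and g = "f ?x' (neg y)"])
    show "conn (E' \<union> gray_edges n) (f x y u) (f x y v)" if "{u, v} \<in> E \<union> gray_edges n" for u v
      by (rule main[OF swap that])
    show "conn (E \<union> gray_edges n) (f ?x' (neg y) u) (f ?x' (neg y) v)"
      if "{u, v} \<in> E' \<union> gray_edges n" for u v
      by (rule main[OF edge_swap_sym[OF swap] that])
    show "f x y ` H n \<subseteq> H n" "f ?x' (neg y) ` H n \<subseteq> H n" using K by (auto simp: f_def)
    have ny: "neg y \<noteq> x" "neg y \<noteq> ?x'" using K by (metis neg_neg)+
    have f: "f x y v = (if v = x \<or> v = ?x' then y else v)"
      "f ?x' (neg y) v = (if v = ?x' \<or> v = x then neg y else v)" for v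
      unfolding f_def nx' by simp_all
    have gx: "conn F x ?x'" "conn F ?x' x" if "gray_edges n \<subseteq> F" for F
      using gray_edge[OF K(1)] that conn_edge conn_sym by (metis subsetD)+
    have cy: "conn (E \<union> gray_edges n) ?x' y" by (rule conn_edge) (simp add: K(7))
    have cy': "conn (E' \<union> gray_edges n) x (neg y)"
      by (rule conn_edge, subst insert_commute) (simp add: K(8))
    have cxy: "conn (E \<union> gray_edges n) x y" using conn_trans[OF gx(1) cy] by simp
    have cxy': "conn (E' \<union> gray_edges n) ?x' (neg y)" using conn_trans[OF gx(2) cy'] by simp
    show "conn (E \<union> gray_edges n) v (f ?x' (neg y) (f x y v))" for v
    proof (cases "v = x \<or> v = ?x'")
      case True
      then have "f ?x' (neg y) (f x y v) = y" using K(3,4) by (simp add: f)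
      then show ?thesis using True cy cxy by (elim disjE) simp_all
    next
      case False
      then have "f ?x' (neg y) (f x y v) = v" by (simp add: f)
      then show ?thesis by simp
    qed
    show "conn (E' \<union> gray_edges n) v (f x y (f ?x' (neg y) v))" for v
    proof (cases "v = x \<or> v = ?x'")
      case True
      then have "f x y (f ?x' (neg y) v) = neg y" using ny by (elim disjE) (simp_all add: f)
      then show ?thesis using True cy' cxy' by (elim disjE) simp_all
    next
      case False
      then have "f x y (f ?x' (neg y) v) = v" by (simp add: f)
      then show ?thesis by simp
    qed
  qed
qed

lemma word_comps_eqv:
  assumes "valid n w" "eqv n w w'"
  shows "word_comps n w = word_comps n w'"
  by (rule eqv_edges_cases[OF assms]) (auto simp: word_comps_def dest: num_comps_edge_swap)

section \<open>Cycle counts after attaching letters at the end\<close>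

lemma word_edges_append:
  assumes "w \<noteq> []"
  shows "word_edges (w @ v) = path_edges w \<union> path_edges (last w # v @ [hd w])"
proof -
  obtain a r where a: "w = a # r" using assms by (cases w) auto
  obtain s l where l: "w = s @ [l]" using assms by (cases w rule: rev_cases) auto
  have "word_edges (w @ v) = path_edges (w @ v @ [a])" using a by simp
  also have "\<dots> = path_edges w \<union> path_edges (l # v @ [a])"
    unfolding l using path_edges_append[of s l "v @ [a]"] by simp
  also have "l = last w" using l by simp
  also have "a = hd w" using a by simp
  finally show ?thesis .
qed

lemma gray_edges_append:
  "gray_edges (n + k) = path_edges (map Pos [0..<n + 1]) \<union> path_edges (Pos n # map Pos [n + 1..<n + k + 1] @ [Pos 0])"
proof -
  have "[0..<n + k + 1] = [0..<n + 1] @ [n + 1..<n + k + 1]"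
    using upt_add_eq_append[of 0 "n + 1" k] by simp
  moreover have "last (map Pos [0..<n + 1]) = Pos n" "hd (map Pos [0..<n + 1]) = Pos 0"
    by (simp, simp add: upt_conv_Cons del: upt_Suc)
  ultimately show ?thesis
    unfolding gray_edges_eq using word_edges_append[of "map Pos [0..<n + 1]" "map Pos [n + 1..<n + k + 1]"]
    by simp
qed

lemma path_edges_lab:
  assumes "valid n w" "{a, b} \<in> path_edges w"
  shows "lab a \<le> n" "lab b \<le> n"
proof -
  have "{a, b} \<subseteq> set (butlast w) \<union> neg ` set (tl w)" using path_edges_vertices assms(2) by blast
  moreover have "set (butlast w) \<subseteq> set w" "set (tl w) \<subseteq> set w"
    by (auto dest: in_set_butlastD) (metis list.sel(2) list.set_sel(2))
  ultimately have "lab a \<in> lab ` set w" "lab b \<in> lab ` set w" by (auto simp: image_image)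
  then show "lab a \<le> n" "lab b \<le> n" using assms(1) by (auto simp: valid_def)
qed

lemma valid_Cons_0:
  assumes "valid n (Pos 0 # r)" shows "Pos 0 \<notin> set r" "Neg 0 \<notin> set r"
proof -
  have "lab (Pos 0) \<notin> lab ` set r" using assms by (simp add: valid_def)
  from lab_notin[OF this] show "Pos 0 \<notin> set r" "Neg 0 \<notin> set r" by simp_all
qed

lemma path_edges_no_Neg_0:
  assumes "valid n (Pos 0 # r)" "e \<in> path_edges (Pos 0 # r)"
  shows "Neg 0 \<notin> e"
proof (rule path_edges_avoid[OF assms(2)])
  have "Neg 0 \<notin> set (Pos 0 # r)" "Pos 0 \<notin> set r" using valid_Cons_0[OF assms(1)] by simp_all
  then show "Neg 0 \<notin> set (butlast (Pos 0 # r))" "neg (Neg 0) \<notin> set (tl (Pos 0 # r))"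
    by (auto dest: in_set_butlastD)
qed

text \<open>With n + 1 at the end of both boundary words, \<open>Neg (Suc n)\<close> takes over the
  role of \<open>Neg 0\<close>, while \<open>Pos (Suc n)\<close> and \<open>Neg 0\<close> are joined
  by a black and a gray edge and form a new cycle of length two. In the comparison this cycle
  becomes the isolated vertex \<open>Pos (Suc n)\<close>.\<close>

lemma word_comps_digon:
  assumes v: "valid n (Pos 0 # r)"
  shows "word_comps (Suc n) (Pos 0 # r @ [Pos (Suc n)]) = Suc (word_comps n (Pos 0 # r))"
proof -
  let ?w = "Pos 0 # r" and ?u = "Suc n"
  define l where "l = last ?w"
  define E0 where "E0 = path_edges ?w \<union> path_edges (map Pos [0..<n + 1])"
  define E where "E = E0 \<union> {{l, Neg 0}, {Pos n, Neg 0}}"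
  define E' where "E' = E0 \<union> {{l, Neg ?u}, {Pos n, Neg ?u}, {Pos ?u, Neg 0}}"
  have E: "word_edges ?w \<union> gray_edges n = E"
    using word_edges_append[of ?w "[]"] gray_edges_append[of n 0] by (auto simp: E_def E0_def l_def)
  have E': "word_edges (?w @ [Pos ?u]) \<union> gray_edges ?u = E'"
    using word_edges_append[of ?w "[Pos ?u]"] gray_edges_append[of n 1] by (auto simp: E'_def E0_def l_def)
  have up: "map Pos [0..<n + 1] = Pos 0 # map Pos [1..<n + 1]" by (simp add: upt_conv_Cons del: upt_Suc)
  have vu: "valid n (Pos 0 # map Pos [1..<n + 1])" using valid_upt[of n] up by metis
  have E0: "lab a \<le> n" "lab b \<le> n" "a \<noteq> Neg 0" "b \<noteq> Neg 0" if ab: "{a, b} \<in> E0" for a b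
    using ab path_edges_lab[OF v, of a b] path_edges_lab[OF vu, of a b]
      path_edges_no_Neg_0[OF v, of "{a, b}"] path_edges_no_Neg_0[OF vu, of "{a, b}"]
    unfolding E0_def up by auto
  have lw: "l \<in> set ?w" unfolding l_def by simp
  then have l: "lab l \<le> n" using v by (auto simp: valid_def)
  have "Neg 0 \<notin> set ?w" using valid_Cons_0[OF v] by simp
  then have l0: "l \<noteq> Neg 0" using lw by metis
  define f where "f a = (if a = Neg 0 then Pos ?u else if a = Neg ?u then Neg 0 else a)" for a
  define g where "g a = (if a = Neg 0 then Neg ?u else a)" for a
  have fid: "f a = a" if "lab a \<le> n" "a \<noteq> Neg 0" for a using that by (auto simp: f_def)
  have fl: "f l = l" "g l = l" using l l0 by (auto simp: f_def g_def)
  have "num_comps (H ?u) E' = num_comps (insert (Pos ?u) (H n)) E"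
  proof (rule num_comps_eq[where f = f and g = g])
    show "conn E (f a) (f b)" if ab: "{a, b} \<in> E'" for a b
    proof -
      consider "{a, b} \<in> E0" | "a = l \<and> b = Neg ?u \<or> a = Neg ?u \<and> b = l"
        | "a = Pos n \<and> b = Neg ?u \<or> a = Neg ?u \<and> b = Pos n"
        | "a = Pos ?u \<and> b = Neg 0 \<or> a = Neg 0 \<and> b = Pos ?u"
        using ab unfolding E'_def by (auto simp: doubleton_eq_iff)
      then show ?thesis
      proof cases
        case 1
        then have "f a = a" "f b = b" using E0[OF 1] fid by simp_all
        then show ?thesis using 1 by (simp add: conn_edge E_def)
      next
        case 2
        have "conn E l (Neg 0)" by (rule conn_edge) (simp add: E_def)
        then show ?thesis using 2 fl conn_sym by (elim disjE conjE) (simp_all add: f_def)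
      next
        case 3
        have "conn E (Pos n) (Neg 0)" by (rule conn_edge) (simp add: E_def)
        then show ?thesis using 3 conn_sym by (elim disjE conjE) (simp_all add: f_def)
      next
        case 4
        then show ?thesis by (elim disjE conjE) (simp_all add: f_def)
      qed
    qed
    show "conn E' (g a) (g b)" if ab: "{a, b} \<in> E" for a b
    proof -
      consider "{a, b} \<in> E0" | "a = l \<and> b = Neg 0 \<or> a = Neg 0 \<and> b = l"
        | "a = Pos n \<and> b = Neg 0 \<or> a = Neg 0 \<and> b = Pos n"
        using ab unfolding E_def by (auto simp: doubleton_eq_iff)
      then show ?thesis
      proof cases
        case 1
        then have "g a = a" "g b = b" using E0[OF 1] by (simp_all add: g_def)
        then show ?thesis using 1 by (simp add: conn_edge E'_def)
      next
        case 2
        have "conn E' l (Neg ?u)" by (rule conn_edge) (simp add: E'_def)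
        then show ?thesis using 2 fl conn_sym by (elim disjE conjE) (simp_all add: g_def)
      next
        case 3
        have "conn E' (Pos n) (Neg ?u)" by (rule conn_edge) (simp add: E'_def)
        then show ?thesis using 3 conn_sym by (elim disjE conjE) (simp_all add: g_def)
      qed
    qed
    show "f ` H ?u \<subseteq> insert (Pos ?u) (H n)"
    proof (rule image_subsetI)
      fix a assume "a \<in> H ?u"
      then show "f a \<in> insert (Pos ?u) (H n)"
        by (cases a) (auto simp: f_def mem_H_iff le_Suc_eq)
    qed
    show "g ` insert (Pos ?u) (H n) \<subseteq> H ?u" by (auto simp: g_def mem_H_iff)
    show "conn E' a (g (f a))" if "a \<in> H ?u" for a
    proof -
      have "conn E' (Neg 0) (Pos ?u)" by (rule conn_sym, rule conn_edge) (simp add: E'_def)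
      then show ?thesis by (auto simp: f_def g_def)
    qed
    show "conn E a (f (g a))" if "a \<in> insert (Pos ?u) (H n)" for a
      using that by (auto simp: f_def g_def mem_H_iff)
  qed
  also have "\<dots> = Suc (num_comps (H n) E)"
  proof (rule num_comps_insert)
    show "Pos ?u \<notin> e" if eE: "e \<in> E" for e
    proof
      assume "Pos ?u \<in> e"
      obtain a b where ab: "e = {a, b}"
        using eE word_edge_mem_H[OF v] word_edge_mem_H[OF valid_upt] unfolding E[symmetric] gray_edges_eq
        by (metis UnE)
      then show False using eE \<open>Pos ?u \<in> e\<close> E0[of a b] l unfolding E_def by (auto simp: doubleton_eq_iff)
    qed
  qed (auto simp: mem_H_iff)
  finally show ?thesis using E E' by (simp add: word_comps_def)
qed

text \<open>The two edges at \<open>Neg 0\<close> are replaced by \<open>F\<close>, which ties their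
  other ends and all new vertices to \<open>Neg 0\<close>. Contracting the new vertices onto
  \<open>Neg 0\<close> thus gives back the old graph. Crosscaps and handles differ only in
  \<open>F\<close>.\<close>

lemma word_comps_thick:
  assumes v: "valid n (Pos 0 # r)" and "m > 0"
    and F: "word_edges (Pos 0 # r @ s) \<union> gray_edges (n + m) =
      path_edges (Pos 0 # r) \<union> path_edges (map Pos [0..<n + 1]) \<union> F"
    and F1: "\<And>a b. {a, b} \<in> F \<Longrightarrow>
      n < lab a \<and> (b = Neg 0 \<or> b = Pos n \<or> b = last (Pos 0 # r) \<or> n < lab b) \<or>
      n < lab b \<and> (a = Neg 0 \<or> a = Pos n \<or> a = last (Pos 0 # r) \<or> n < lab a)"
    and F2: "\<And>a. n < lab a \<Longrightarrow> lab a \<le> n + m \<Longrightarrow> conn F a (Neg 0)"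
    and F3: "conn F (Pos n) (Neg 0)" "conn F (last (Pos 0 # r)) (Neg 0)"
  shows "word_comps (n + m) (Pos 0 # r @ s) = word_comps n (Pos 0 # r)"
proof -
  let ?w = "Pos 0 # r"
  define l where "l = last ?w"
  define E0 where "E0 = path_edges ?w \<union> path_edges (map Pos [0..<n + 1])"
  define E where "E = E0 \<union> {{l, Neg 0}, {Pos n, Neg 0}}"
  define E' where "E' = E0 \<union> F"
  have E: "word_edges ?w \<union> gray_edges n = E"
    using word_edges_append[of ?w "[]"] gray_edges_append[of n 0] by (auto simp: E_def E0_def l_def)
  have E0: "lab a \<le> n" "lab b \<le> n" if ab: "{a, b} \<in> E0" for a b
    using ab path_edges_lab[OF v, of a b] path_edges_lab[OF valid_upt, of a b]
    unfolding E0_def by auto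
  have lw: "l \<in> set ?w" unfolding l_def by simp
  then have l: "lab l \<le> n" using v by (auto simp: valid_def)
  define f where "f a = (if lab a \<le> n then a else Neg 0)" for a
  have mono: "conn E' a b" if "conn F a b" for a b
    using that by (rule conn_induct) (auto intro: conn_trans conn_edge simp: E'_def)
  have El: "conn E l (Neg 0)" by (rule conn_edge) (simp add: E_def)
  have En: "conn E (Pos n) (Neg 0)" by (rule conn_edge) (simp add: E_def)
  have to0: "conn E (f a) (Neg 0)" if "a = Neg 0 \<or> a = Pos n \<or> a = l \<or> n < lab a" for a
    using that El En l by (auto simp: f_def)
  have "num_comps (H (n + m)) E' = num_comps (H n) E"
  proof (rule num_comps_eq[where f = f and g = id])
    show "conn E (f a) (f b)" if "{a, b} \<in> E'" for a b
    proof (cases "{a, b} \<in> E0")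
      case True
      then have "f a = a" "f b = b" using E0[OF True] by (simp_all add: f_def)
      then show ?thesis using True by (simp add: conn_edge E_def)
    next
      case False
      then have "{a, b} \<in> F" using that by (simp add: E'_def)
      from F1[OF this] have "conn E (f a) (Neg 0)" "conn E (f b) (Neg 0)"
        using to0[of a] to0[of b] unfolding l_def by blast+
      then show ?thesis using conn_sym conn_trans by blast
    qed
    show "conn E' (id a) (id b)" if "{a, b} \<in> E" for a b
    proof -
      consider "{a, b} \<in> E0" | "a = l \<and> b = Neg 0 \<or> a = Neg 0 \<and> b = l"
        | "a = Pos n \<and> b = Neg 0 \<or> a = Neg 0 \<and> b = Pos n"
        using \<open>{a, b} \<in> E\<close> unfolding E_def by (auto simp: doubleton_eq_iff)
      then show ?thesis
      proof cases
        case 1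
        then show ?thesis by (simp add: conn_edge E'_def)
      next
        case 2
        then show ?thesis using mono[OF F3(2)] conn_sym unfolding l_def by auto
      next
        case 3
        then show ?thesis using mono[OF F3(1)] conn_sym by auto
      qed
    qed
    show "f ` H (n + m) \<subseteq> H n" by (auto simp: f_def mem_H_iff)
    show "id ` H n \<subseteq> H (n + m)" by (auto simp: mem_H_iff)
    show "conn E' a (id (f a))" if "a \<in> H (n + m)" for a
      using mono[OF F2[of a]] that by (auto simp: f_def mem_H_iff)
    show "conn E a (f (id a))" if "a \<in> H n" for a
      using that by (simp add: f_def mem_H_iff)
  qed
  then show ?thesis using E F by (simp add: word_comps_def E'_def E0_def)
qed


lemma word_comps_crosscap:
  assumes v: "valid n (Pos 0 # r)"
  shows "word_comps (Suc n) (Pos 0 # r @ [Neg (Suc n)]) = word_comps n (Pos 0 # r)"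
proof -
  let ?u = "Suc n"
  define l where "l = last (Pos 0 # r)"
  define F where "F = {{l, Pos ?u}, {Neg ?u, Neg 0}, {Pos n, Neg ?u}, {Pos ?u, Neg 0}}"
  have 1: "conn F (Pos ?u) (Neg 0)" by (rule conn_edge) (simp add: F_def)
  have 2: "conn F (Neg ?u) (Neg 0)" by (rule conn_edge) (simp add: F_def)
  have 3: "conn F l (Pos ?u)" by (rule conn_edge) (simp add: F_def)
  have 4: "conn F (Pos n) (Neg ?u)" by (rule conn_edge) (simp add: F_def)
  have "word_comps (n + 1) (Pos 0 # r @ [Neg ?u]) = word_comps n (Pos 0 # r)"
  proof (rule word_comps_thick[OF v, where F = F])
    show "word_edges (Pos 0 # r @ [Neg ?u]) \<union> gray_edges (n + 1) =
        path_edges (Pos 0 # r) \<union> path_edges (map Pos [0..<n + 1]) \<union> F"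
      using word_edges_append[of "Pos 0 # r" "[Neg ?u]"] gray_edges_append[of n 1]
      by (auto simp: F_def l_def)
    show "conn F a (Neg 0)" if "n < lab a" "lab a \<le> n + 1" for a
      using that 1 2 by (cases a) (auto simp: le_Suc_eq)
    show "conn F (Pos n) (Neg 0)" "conn F (last (Pos 0 # r)) (Neg 0)"
      using conn_trans[OF 4 2] conn_trans[OF 3 1] unfolding l_def by simp_all
  qed (auto simp: F_def l_def doubleton_eq_iff)
  then show ?thesis by simp
qed

lemma word_comps_handle:
  assumes v: "valid n (Pos 0 # r)"
  shows "word_comps (n + 2) (Pos 0 # r @ [Pos (n + 2), Pos (n + 1)]) = word_comps n (Pos 0 # r)"
proof (rule word_comps_thick[OF v])
  let ?u = "n + 2" and ?v = "n + 1"
  define l where "l = last (Pos 0 # r)"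
  define F where "F = {{l, Neg ?u}, {Pos ?u, Neg ?v}, {Pos ?v, Neg 0},
    {Pos n, Neg ?v}, {Pos ?v, Neg ?u}, {Pos ?u, Neg 0}}"
  have 1: "conn F (Pos ?u) (Neg 0)" by (rule conn_edge) (simp add: F_def)
  have 2: "conn F (Pos ?v) (Neg 0)" by (rule conn_edge) (simp add: F_def)
  have "conn F (Neg ?u) (Pos ?v)" by (rule conn_sym, rule conn_edge) (simp add: F_def)
  then have 3: "conn F (Neg ?u) (Neg 0)" using 2 by (rule conn_trans)
  have "conn F (Neg ?v) (Pos ?u)" by (rule conn_sym, rule conn_edge) (simp add: F_def)
  then have 4: "conn F (Neg ?v) (Neg 0)" using 1 by (rule conn_trans)
  have "conn F l (Neg ?u)" by (rule conn_edge) (simp add: F_def)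
  then have 5: "conn F l (Neg 0)" using 3 by (rule conn_trans)
  have "conn F (Pos n) (Neg ?v)" by (rule conn_edge) (simp add: F_def)
  then have 6: "conn F (Pos n) (Neg 0)" using 4 by (rule conn_trans)
  have W: "word_edges (Pos 0 # r @ [Pos ?u, Pos ?v]) =
      path_edges (Pos 0 # r) \<union> {{l, Neg ?u}, {Pos ?u, Neg ?v}, {Pos ?v, Neg 0}}"
    using word_edges_append[of "Pos 0 # r" "[Pos ?u, Pos ?v]"] by (simp add: l_def)
  have G: "gray_edges (n + 2) = path_edges (map Pos [0..<n + 1]) \<union>
      {{Pos n, Neg ?v}, {Pos ?v, Neg ?u}, {Pos ?u, Neg 0}}"
    using gray_edges_append[of n 2] by (simp add: upt_conv_Cons)
  show "word_edges (Pos 0 # r @ [Pos ?u, Pos ?v]) \<union> gray_edges (n + 2) =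
      path_edges (Pos 0 # r) \<union> path_edges (map Pos [0..<n + 1]) \<union> F"
    unfolding W G F_def by (simp only: Un_insert_left Un_insert_right Un_ac sup_bot_left sup_bot_right insert_commute)
  show "conn F a (Neg 0)" if "n < lab a" "lab a \<le> n + 2" for a
  proof -
    have "lab a = ?u \<or> lab a = ?v" using that by linarith
    then show ?thesis using 1 2 3 4 by (cases a) auto
  qed
  show "conn F (Pos n) (Neg 0)" by (rule 6)
  show "conn F (last (Pos 0 # r)) (Neg 0)" using 5 by (simp only: l_def)
qed (auto simp: doubleton_eq_iff)

lemma word_comps_0: "word_comps 0 [Pos 0] = 1"
  unfolding word_comps_def
proof (rule num_comps_one[of "Pos 0"])
  fix v assume "v \<in> H 0"
  then have "v = Pos 0 \<or> v = Neg 0" by (cases v) (auto simp: mem_H_iff)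
  moreover have "conn (word_edges [Pos 0] \<union> gray_edges 0) (Pos 0) (Neg 0)"
    by (rule conn_edge) simp
  ultimately show "conn (word_edges [Pos 0] \<union> gray_edges 0) (Pos 0) v" by auto
qed (simp add: mem_H_iff)

section \<open>Words with a single cycle\<close>

lemma word_edge_nthI:
  "i < length w \<Longrightarrow> {w ! i, neg (w ! (Suc i mod length w))} \<in> word_edges w"
  by (auto simp: word_edges_nth)

text \<open>Two steps along a cycle: a gray edge from the end of \<open>x\<close> to the start of x
  + 1, then a black one to the end of the letter before x + 1.\<close>

lemma conn_preceding:
  assumes "x \<le> n" "{Pos y, Neg (if x = n then 0 else Suc x)} \<in> word_edges w"
  shows "conn (word_edges w \<union> gray_edges n) (Pos x) (Pos y)"
proof -
  have "{Pos x, Neg (if x = n then 0 else Suc x)} \<in> gray_edges n"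
    using gray_edge[of "Pos x" n] assms(1) by (auto simp: mem_H_iff split: if_splits)
  then have "conn (word_edges w \<union> gray_edges n) (Pos x) (Neg (if x = n then 0 else Suc x))"
    by (intro conn_edge) simp
  also have "conn (word_edges w \<union> gray_edges n) \<dots> (Pos y)"
    by (rule conn_sym, rule conn_edge) (use assms(2) in simp)
  finally show ?thesis .
qed

text \<open>Gray edges join each negative vertex to a positive one, so checking the positive ones is
  enough.\<close>

lemma word_comps_one:
  assumes "\<And>x. x \<le> n \<Longrightarrow> conn (word_edges w \<union> gray_edges n) (Pos 0) (Pos x)"
  shows "word_comps n w = 1"
  unfolding word_comps_def
proof (rule num_comps_one[of "Pos 0"])
  fix v assume v: "v \<in> H n"
  show "conn (word_edges w \<union> gray_edges n) (Pos 0) v"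
  proof (cases v)
    case (Pos x)
    then show ?thesis using assms v by (simp add: mem_H_iff)
  next
    case (Neg x)
    define y where "y = (if x = 0 then n else x - 1)"
    have "{Pos y, Neg x} \<in> gray_edges n" "y \<le> n"
      using gray_edge[of "Neg x" n] v Neg by (auto simp: mem_H_iff y_def insert_commute)
    then show ?thesis
      using conn_trans[OF assms[of y] conn_edge] Neg by simp
  qed
qed (simp add: mem_H_iff)

text \<open>Passing from \<open>x\<close> to the letter preceding \<open>x + 1\<close> adds \<open>c + 1\<close> modulo \<open>n + 1\<close>.\<close>

lemma word_comps_arithmetic:
  assumes edge: "\<And>x. x \<le> n \<Longrightarrow> {Pos ((x + c) mod Suc n), Neg x} \<in> word_edges w"
    and inverse: "m * (c + 1) mod Suc n = 1 mod Suc n"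
  shows "word_comps n w = 1"
proof (rule word_comps_one)
  let ?E = "word_edges w \<union> gray_edges n"
  have step: "conn ?E (Pos x) (Pos ((x + (c + 1)) mod Suc n))" if "x \<le> n" for x
  proof (rule conn_preceding[OF that])
    have eq: "((if x = n then 0 else Suc x) + c) mod Suc n = (x + (c + 1)) mod Suc n"
    proof (cases "x = n")
      case True
      then have "x + (c + 1) = c + Suc n" by simp
      then show ?thesis using True by (simp only: mod_add_self2) simp
    qed simp
    show "{Pos ((x + (c + 1)) mod Suc n), Neg (if x = n then 0 else Suc x)} \<in> word_edges w"
      using edge[of "if x = n then 0 else Suc x"] that unfolding eq by auto
  qed
  have k: "conn ?E (Pos 0) (Pos (k * (c + 1) mod Suc n))" for k
  proof (induction k)
    case (Suc k)
    have "k * (c + 1) mod Suc n \<le> n" by (simp add: less_Suc_eq_le[symmetric])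
    note conn_trans[OF Suc step[OF this]]
    also have "(k * (c + 1) mod Suc n + (c + 1)) mod Suc n = Suc k * (c + 1) mod Suc n"
      by (simp only: mod_add_right_eq mult_Suc add.commute)
    finally show ?case .
  qed simp
  fix x assume "x \<le> n"
  \<comment> \<open>As \<open>m\<close> inverts \<open>c + 1\<close> modulo n + 1, the label
    \<open>x\<close> is reached from 0 after \<open>x * m\<close> steps.\<close>
  have "(x * m) * (c + 1) mod Suc n = x * (m * (c + 1) mod Suc n) mod Suc n"
    by (simp only: mod_mult_right_eq mult.assoc)
  also have "\<dots> = x * 1 mod Suc n" unfolding inverse by (rule mod_mult_right_eq)
  also have "\<dots> = x" using \<open>x \<le> n\<close> by simp
  finally show "conn ?E (Pos 0) (Pos x)" using k[of "x * m"] by simp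
qed

text \<open>In the descending word x + 1 precedes x cyclically, hence \<open>c = 1\<close>, and 2 is
  inverted by \<open>g + 1\<close> modulo the odd number \<open>2 * g + 1\<close>. The equation of
  this word is the one defining the probability with exponent \<open>2 * g\<close>.\<close>

lemma word_comps_rev: "word_comps (2 * g) (map Pos (0 # rev [1..<2 * g + 1])) = 1"
proof (rule word_comps_arithmetic[where c = 1 and m = "g + 1"])
  let ?n = "2 * g"
  define w where "w = map Pos (0 # rev [1..<2 * g + 1])"
  have len: "length w = Suc ?n" by (simp add: w_def del: upt_Suc)
  have nth: "w ! i = Pos ((Suc ?n - i) mod Suc ?n)" if "i \<le> ?n" for i
    using that by (cases i) (auto simp: w_def rev_nth simp del: upt_Suc)
  fix x assume x: "x \<le> ?n"
  define i where "i = ?n - x"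
  have i: "i \<le> ?n" "x = ?n - i" using x by (auto simp: i_def)
  have 1: "w ! i = Pos ((x + 1) mod Suc ?n)" using nth[OF i(1)] i x by (simp add: Suc_diff_le)
  have 2: "w ! (Suc i mod Suc ?n) = Pos x"
  proof (cases "i = ?n")
    case True
    then show ?thesis using i(2) nth[of 0] by simp
  next
    case False
    then have "Suc i \<le> ?n" using i(1) by simp
    then have "Suc i mod Suc ?n = Suc i" "w ! Suc i = Pos ((?n - i) mod Suc ?n)"
      using nth[of "Suc i"] by simp_all
    then show ?thesis using i(2) x by simp
  qed
  have "{w ! i, neg (w ! (Suc i mod Suc ?n))} \<in> word_edges w"
    using word_edge_nthI[of i w] i(1) len by simp
  then show "{Pos ((x + 1) mod Suc ?n), Neg x} \<in> word_edges (map Pos (0 # rev [1..<2 * g + 1]))"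
    unfolding 1 2 w_def[symmetric] by simp
next
  have "(g + 1) * (1 + 1) = 1 + Suc (2 * g)" by simp
  then show "(g + 1) * (1 + 1) mod Suc (2 * g) = 1 mod Suc (2 * g)"
    by (simp only: mod_add_self2)
qed

section \<open>Orientable words\<close>

definition nx :: "nat \<Rightarrow> nat \<Rightarrow> nat" where
  "nx n j = (if j = n then 0 else Suc j)"

inductive slide :: "nat \<Rightarrow> nat list \<Rightarrow> nat list \<Rightarrow> bool" for n where
  refl: "slide n l l"
| sym: "slide n l l' \<Longrightarrow> slide n l' l"
| trans: "slide n l l' \<Longrightarrow> slide n l' l'' \<Longrightarrow> slide n l l''"
| rotate: "slide n (u @ v) (v @ u)"
| move: "x \<le> n \<Longrightarrow> slide n (y # nx n x # u @ x # v) (nx n x # u @ x # y # v)"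

declare slide.trans [trans]

definition vlist :: "nat \<Rightarrow> nat list \<Rightarrow> bool" where
  "vlist n l \<longleftrightarrow> distinct l \<and> set l = {..n}"

lemma vlist_cong: "mset l = mset l' \<Longrightarrow> vlist n l \<longleftrightarrow> vlist n l'"
  unfolding vlist_def by (metis mset_eq_imp_distinct_iff mset_eq_setD)

lemma slide_mset: "slide n l l' \<Longrightarrow> mset l = mset l'"
  by (induction rule: slide.induct) auto

lemma slide_vlist: "slide n l l' \<Longrightarrow> vlist n l \<longleftrightarrow> vlist n l'"
  using slide_mset vlist_cong by blast

text \<open>The last letter of the block slides first and the others are placed in front of it, so
  the block keeps its order; rotation parks the letters still to be moved.\<close>

lemma slide_move_block:
  assumes "x \<le> n"
  shows "slide n (y @ nx n x # u @ x # v) (nx n x # u @ x # y @ v)"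
proof (induction y arbitrary: v rule: rev_induct)
  case (snoc a y)
  have "slide n ((y @ [a]) @ nx n x # u @ x # v) (a # nx n x # u @ x # v @ y)"
    using slide.rotate[of n y "a # nx n x # u @ x # v"] by simp
  also have "slide n \<dots> (nx n x # u @ x # a # v @ y)"
    using slide.move[OF assms, of a u "v @ y"] by simp
  also have "slide n \<dots> (y @ nx n x # u @ x # a # v)"
    using slide.rotate[of n "nx n x # u @ x # a # v" y] by simp
  also have "slide n \<dots> (nx n x # u @ x # y @ a # v)" by (rule snoc)
  finally show ?case by simp
qed (auto intro: slide.refl)

lemma slide_block1:
  assumes "x \<le> n"
  shows "slide n (a @ y @ nx n x # u @ x # v) (a @ nx n x # u @ x # y @ v)"
proof -
  have "slide n (a @ y @ nx n x # u @ x # v) (y @ nx n x # u @ x # v @ a)"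
    using slide.rotate[of n a "y @ nx n x # u @ x # v"] by simp
  also have "slide n \<dots> (nx n x # u @ x # y @ v @ a)"
    using slide_move_block[OF assms, of y u "v @ a"] by simp
  also have "slide n \<dots> (a @ nx n x # u @ x # y @ v)"
    using slide.rotate[of n "nx n x # u @ x # y @ v" a] by simp
  finally show ?thesis .
qed

text \<open>In this form the stretch from \<open>x\<close> to x + 1 may be rotated by itself; most
  slides below are used this way.\<close>

lemma slide_block2:
  assumes "x \<le> n"
  shows "slide n (a @ x # u @ y @ nx n x # v) (a @ x # y @ u @ nx n x # v)"
proof -
  have "slide n (a @ x # u @ y @ nx n x # v) (y @ nx n x # (v @ a) @ x # u)"
    using slide.rotate[of n "a @ x # u" "y @ nx n x # v"] by simp
  also have "slide n \<dots> (nx n x # (v @ a) @ x # y @ u)"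
    by (rule slide_move_block[OF assms])
  also have "slide n \<dots> (a @ x # y @ u @ nx n x # v)"
    using slide.rotate[of n "nx n x # v" "a @ x # y @ u"] by simp
  finally show ?thesis .
qed

lemma nx_le [simp]: "x \<le> n \<Longrightarrow> nx n x \<le> n"
  by (auto simp: nx_def)

lemma rotate_to_slide:
  assumes "x \<in> set l" obtains v where "slide n l (x # v)"
proof -
  obtain a b where "l = a @ x # b" using assms by (meson split_list)
  then show ?thesis using that slide.rotate[of n a "x # b"] by auto
qed

text \<open>The letters \<open>x, x + 1, x + 2\<close> occur in the reversed cyclic order.\<close>

definition handle_at :: "nat \<Rightarrow> nat \<Rightarrow> nat list \<Rightarrow> bool" where
  "handle_at n x l \<longleftrightarrow>
     (\<exists>a b c. slide n l (x # a @ nx n (nx n x) # b @ nx n x # c))"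

section \<open>Splitting off a handle\<close>

lemma nx_inject: "x \<le> n \<Longrightarrow> y \<le> n \<Longrightarrow> nx n x = nx n y \<Longrightarrow> x = y"
  by (auto simp: nx_def split: if_splits)

lemma nx3_neq:
  assumes "3 \<le> n" "x \<le> n"
  shows "nx n (nx n (nx n x)) \<noteq> x" "nx n (nx n (nx n x)) \<noteq> nx n x"
    "nx n (nx n (nx n x)) \<noteq> nx n (nx n x)"
  using assms by (auto simp: nx_def split: if_splits)

text \<open>The next triple is reversed as well unless x + 3 lies between x + 2 and x + 1. In that
  case rotating the stretch from x to x + 1 brings x + 3 in front of x + 2.\<close>

lemma handle_at_nx:
  assumes "vlist n l" "handle_at n x l" "x \<le> n" "3 \<le> n"
  shows "handle_at n (nx n x) l"
proof -
  define t v u where "t = nx n x" and "v = nx n t" and "u = nx n v"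
  have le: "t \<le> n" "v \<le> n" "u \<le> n" using assms by (auto simp: t_def v_def u_def)
  obtain a b c where abc: "slide n l (x # a @ v # b @ t # c)"
    using assms(2) unfolding handle_at_def t_def v_def by blast
  have "vlist n (x # a @ v # b @ t # c)" using slide_vlist[OF abc] assms(1) by simp
  then have "u \<in> set (x # a @ v # b @ t # c)" using le by (auto simp: vlist_def)
  moreover have "u \<noteq> x" "u \<noteq> t" "u \<noteq> v"
    using nx3_neq[OF assms(4,3)] by (simp_all add: t_def v_def u_def)
  ultimately consider "u \<in> set a" | "u \<in> set b" | "u \<in> set c" by auto
  then have "\<exists>p q r. slide n l (t # p @ u # q @ v # r)"
  proof cases
    case 1
    then obtain a1 a2 where "a = a1 @ u # a2" by (meson split_list)
    then have "slide n l (t # (c @ x # a1) @ u # a2 @ v # b)"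
      using slide.trans[OF abc, of "(t # c) @ (x # a @ v # b)"]
        slide.rotate[of n "x # a @ v # b" "t # c"] by simp
    then show ?thesis by blast
  next
    case 3
    then obtain c1 c2 where "c = c1 @ u # c2" by (meson split_list)
    then have "slide n l (t # c1 @ u # (c2 @ x # a) @ v # b)"
      using slide.trans[OF abc, of "(t # c) @ (x # a @ v # b)"]
        slide.rotate[of n "x # a @ v # b" "t # c"] by simp
    then show ?thesis by blast
  next
    case 2
    then obtain b1 b2 where b: "b = b1 @ u # b2" by (meson split_list)
    have "slide n l (x # (a @ v # b1) @ (u # b2) @ t # c)" using abc b by simp
    also have "slide n \<dots> (x # (u # b2) @ (a @ v # b1) @ t # c)"
      using slide_block2[OF assms(3), of "[]" "a @ v # b1" "u # b2" c] by (simp add: t_def)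
    also have "slide n \<dots> ((t # c) @ (x # (u # b2) @ (a @ v # b1)))"
      using slide.rotate[of n "x # (u # b2) @ (a @ v # b1)" "t # c"] by simp
    also have "\<dots> = t # (c @ [x]) @ u # (b2 @ a) @ v # b1" by simp
    finally show ?thesis by blast
  qed
  then show ?thesis unfolding handle_at_def by (simp add: t_def v_def u_def)
qed

text \<open>The triple is shifted upwards from \<open>x\<close> to \<open>n\<close>, across to 0 and
  up again to n - 1. For \<open>n = 2\<close> there is just one triple up to rotation, and x + 3
  would be x itself.\<close>

lemma handle_at_last:
  assumes "vlist n l" "handle_at n x l" "x \<le> n" "2 \<le> n"
  shows "handle_at n (n - 1) l"
proof (cases "n = 2")
  case False
  then have n: "3 \<le> n" using assms by simp
  have step: "handle_at n y l" if "handle_at n z l" "z \<le> y" "y \<le> n" for y z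
    using that(2,1,3)
  proof (induction rule: dec_induct)
    case (step m)
    then show ?case using handle_at_nx[OF assms(1) _ _ n, of m] by (auto simp: nx_def)
  qed simp
  have "handle_at n 0 l" using handle_at_nx[OF assms(1) step[OF assms(2,3)] _ n] by (auto simp: nx_def)
  then show ?thesis using step by simp
next
  case True
  obtain a b c where abc: "slide n l (x # a @ nx n (nx n x) # b @ nx n x # c)"
    using assms(2) unfolding handle_at_def by blast
  have "\<exists>a b c. slide n l (1 # a @ 0 # b @ 2 # c)"
  proof -
    consider "x = 0" | "x = 1" | "x = 2" using assms True by linarith
    then show ?thesis
    proof cases
      case 1
      then have "slide n l ((0 # a @ 2 # b) @ 1 # c)"
        using abc True by (simp add: nx_def eval_nat_numeral)
      also have "slide n \<dots> ((1 # c) @ 0 # a @ 2 # b)" by (rule slide.rotate)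
      also have "\<dots> = 1 # c @ 0 # a @ 2 # b" by simp
      finally show ?thesis by blast
    next
      case 2
      then have "slide n l (1 # a @ 0 # b @ 2 # c)"
        using abc True by (simp add: nx_def eval_nat_numeral)
      then show ?thesis by blast
    next
      case 3
      then have "slide n l ((2 # a) @ 1 # b @ 0 # c)"
        using abc True by (simp add: nx_def eval_nat_numeral)
      also have "slide n \<dots> ((1 # b @ 0 # c) @ 2 # a)" by (rule slide.rotate)
      also have "\<dots> = 1 # b @ 0 # c @ 2 # a" by simp
      finally show ?thesis by blast
    qed
  qed
  then show ?thesis using True by (auto simp: handle_at_def nx_def eval_nat_numeral)
qed

text \<open>The triple is n - 1, 0, n in this cyclic order. Sliding along n and its successor 0 puts
  n - 1 directly before 0; what remains between n and n - 1 is then removed by rotating the stretch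
  from n - 2 to n - 1.\<close>

lemma handle_extract:
  assumes "vlist n l" "handle_at n x l" "x \<le> n" "2 \<le> n"
  shows "\<exists>r. slide n l (0 # r @ [n, n - 1])"
proof -
  define v t where "v = n - 1" and "t = n - 2"
  have nx: "nx n t = v" "nx n v = n" "nx n n = 0" and le: "t \<le> n" "v \<le> n"
    using assms(4) by (auto simp: nx_def v_def t_def)
  obtain a b c where abc: "slide n l (v # a @ 0 # b @ n # c)"
    using handle_at_last[OF assms] unfolding handle_at_def v_def[symmetric] nx by blast
  have "slide n l ((a @ 0 # b @ n # c) @ [v])"
    using slide.trans[OF abc] slide.rotate[of n "[v]" "a @ 0 # b @ n # c"] by simp
  also have "slide n \<dots> (0 # b @ n # a @ c @ [v])"
    using slide_block1[of n n "[]" a b "c @ [v]"] nx by simp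
  finally have "slide n l (0 # b @ n # (a @ c) @ [v])" by simp
  then obtain p q where pq: "slide n l (0 # p @ n # q @ [v])" by blast
  have vl: "vlist n (0 # p @ n # q @ [v])" using slide_vlist[OF pq] assms(1) by simp
  \<comment> \<open>If n - 2 stands in front of n, the stretch from n - 2 to n - 1 contains n, and a
    rotation puts n at its end.\<close>
  have *: "\<exists>r. slide n l (0 # r @ [n, v])"
    if sl: "slide n l (0 # p @ n # q @ [v])" and t: "t \<in> set (0 # p)" for p q
  proof -
    obtain p1 p2 where p: "0 # p = p1 @ t # p2" using t by (meson split_list)
    note sl
    also have "0 # p @ n # q @ [v] = p1 @ t # (p2 @ [n]) @ q @ v # []" using p by simp
    also have "slide n \<dots> (p1 @ t # q @ (p2 @ [n]) @ v # [])"
      using slide_block2[OF le(1), of p1 "p2 @ [n]" q "[]"] nx by simp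
    finally have "slide n l (p1 @ t # q @ p2 @ [n, v])" by simp
    moreover obtain r where "p1 @ [t] = 0 # r" using p by (cases p1) auto
    then have "p1 @ t # q @ p2 @ [n, v] = 0 # (r @ q @ p2) @ [n, v]"
      by (metis append.assoc append_Cons append_Nil)
    ultimately show ?thesis by metis
  qed
  show ?thesis unfolding v_def[symmetric]
  proof (cases "t \<in> set (0 # p)")
    case False
    have "t \<noteq> n" "t \<noteq> v" using assms(4) False by (auto simp: t_def v_def)
    then have "t \<in> set q" using False vl le unfolding vlist_def by (metis (no_types) Un_iff
      atMost_iff empty_iff empty_set insert_iff list.simps(15) set_append append_Cons)
    then obtain q1 q2 where q: "q = q1 @ t # q2" by (meson split_list)
    \<comment> \<open>If n - 2 stands behind n, the block ending in it is first slid to the front of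
      0 along the pair n, 0, and then from behind n - 1 to the front of n along the pair n - 1,
      n.\<close>
    have "slide n l ([] @ (0 # p) @ n # (q1 @ [t]) @ (q2 @ [v]))" using pq q by simp
    also have "slide n \<dots> ((q1 @ [t]) @ 0 # p @ n # q2 @ [v])"
      using slide.sym[OF slide_block1[of n n "[]" "q1 @ [t]" p "q2 @ [v]"]] nx by simp
    also have "slide n \<dots> (0 # p @ n # q2 @ v # (q1 @ [t]))"
      using slide.rotate[of n "q1 @ [t]" "0 # p @ n # q2 @ [v]"] by simp
    also have "slide n \<dots> ((0 # p) @ (q1 @ [t]) @ n # q2 @ v # [])"
      using slide.sym[OF slide_block1[OF le(2), of "0 # p" "q1 @ [t]" q2 "[]"]] nx by simp
    finally show "\<exists>r. slide n l (0 # r @ [n, v])" using *[of "p @ q1 @ [t]" q2] by simp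
  qed (use * pq in blast)
qed


section \<open>Words without a reversed triple\<close>

lemma nx_funpow: "z \<le> n \<Longrightarrow> (nx n ^^ k) z = (z + k) mod Suc n"
proof (induction k)
  case (Suc k)
  then show ?case by (auto simp: nx_def mod_Suc)
qed simp

lemma nx_reach: "z \<le> n \<Longrightarrow> x \<le> n \<Longrightarrow> \<exists>k. (nx n ^^ k) z = x"
proof (rule exI)
  assume "z \<le> n" "x \<le> n"
  then have "(nx n ^^ (x + Suc n - z)) z = (x + Suc n) mod Suc n" by (simp add: nx_funpow)
  also have "\<dots> = x" using \<open>x \<le> n\<close> by (subst mod_add_self2) simp
  finally show "(nx n ^^ (x + Suc n - z)) z = x" .
qed

text \<open>Choose y so that y and y + 1 lie in the arc \<open>q\<close> but y + 2 does not; a run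
  that never left the arc would eventually reach \<open>x\<close>. Rotating the arc puts y + 1
  before y, and y + 2 lies outside, which is the order y, y + 2, y + 1.\<close>

lemma handle_in_arc:
  assumes "vlist n l" "slide n l (x # q @ nx n x # r)" "x \<le> n"
    and "z \<in> set q" "nx n z \<in> set q"
  shows "\<exists>y \<le> n. handle_at n y l"
proof -
  have v: "vlist n (x # q @ nx n x # r)" using assms slide_vlist by blast
  have q: "y \<le> n" "y \<noteq> x" if "y \<in> set q" for y using v that unfolding vlist_def by auto
  have "\<exists>y \<in> set q. nx n y \<in> set q \<and> nx n (nx n y) \<notin> set q"
  proof (rule ccontr)
    assume "\<not> ?thesis"
    then have *: "nx n (nx n y) \<in> set q" if "y \<in> set q" "nx n y \<in> set q" for y using that by blast
    have "(nx n ^^ k) z \<in> set q \<and> (nx n ^^ Suc k) z \<in> set q" for k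
      by (induction k) (use assms(4,5) * in auto)
    then show False using nx_reach[OF q(1)[OF assms(4)] assms(3)] q(2) by blast
  qed
  then obtain y where y: "y \<in> set q" "nx n y \<in> set q" "nx n (nx n y) \<notin> set q" by blast
  have yn: "y \<le> n" using q y by blast
  have "nx n (nx n y) \<in> set (nx n x # r @ [x])" using v y(3) yn unfolding vlist_def
    using nx_le[OF nx_le[OF yn]] by (metis (no_types, lifting) Un_iff append_Cons atMost_iff
        list.set(2) list.simps(15) insert_iff set_append empty_set rotate1.simps(2) set_rotate1)
  then obtain s1 s2 where s: "nx n x # r @ [x] = s1 @ nx n (nx n y) # s2" by (meson split_list)
  have ne: "nx n y \<noteq> y" using y by auto
  have main: "handle_at n y l" if "slide n l (x # q1 @ nx n y # q2 @ y # q3 @ nx n x # r)" for q1 q2 q3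
  proof -
    note that
    also have "slide n (x # q1 @ nx n y # q2 @ y # q3 @ nx n x # r)
        (y # q3 @ (nx n x # r @ [x]) @ q1 @ nx n y # q2)"
      using slide.rotate[of n "x # q1 @ nx n y # q2" "y # q3 @ nx n x # r"] by simp
    finally have "slide n l (y # (q3 @ s1) @ nx n (nx n y) # (s2 @ q1) @ nx n y # q2)"
      unfolding s by simp
    then show ?thesis unfolding handle_at_def by blast
  qed
  obtain a b where ab: "q = a @ y # b" using y by (meson split_list)
  then have "nx n y \<in> set a \<or> nx n y \<in> set b" using y ne by auto
  then have "handle_at n y l"
  proof
    assume "nx n y \<in> set a"
    then obtain c d where "a = c @ nx n y # d" by (meson split_list)
    then show ?thesis using main[of c d b] assms(2) ab by simp
  next
    assume "nx n y \<in> set b"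
    then obtain c d where b: "b = c @ nx n y # d" by (meson split_list)
    have "slide n l (x # (a @ y # c) @ (nx n y # d) @ nx n x # r)"
      using assms(2) ab b by simp
    also have "slide n \<dots> (x # (nx n y # d) @ (a @ y # c) @ nx n x # r)"
      using slide_block2[OF assms(3), of "[]" "a @ y # c" "nx n y # d" r] by simp
    finally show ?thesis using main[of "[]" "d @ a" c] by simp
  qed
  then show ?thesis using yn by blast
qed

lemma split_list_two:
  assumes "a \<in> set l" "b \<in> set l" "a \<noteq> b"
  shows "(\<exists>u v w. l = u @ a # v @ b # w) \<or> (\<exists>u v w. l = u @ b # v @ a # w)"
proof -
  obtain u v where l: "l = u @ a # v" using assms by (meson split_list)
  then have "b \<in> set u \<or> b \<in> set v" using assms by auto
  then show ?thesis
  proof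
    assume "b \<in> set u"
    then obtain c d where "u = c @ b # d" by (meson split_list)
    then have "l = c @ b # d @ a # v" using l by simp
    then show ?thesis by blast
  next
    assume "b \<in> set v"
    then obtain c d where "v = c @ b # d" by (meson split_list)
    then have "l = u @ a # c @ b # d" using l by simp
    then show ?thesis by blast
  qed
qed

text \<open>If c + 1 and y + 1 both lie outside the arc, then, after moving \<open>c\<close> to the
  end of the arc if c + 1 comes first, the stretch from one of \<open>c\<close>, \<open>y\<close> to
  its successor contains the other one together with its successor. So \<open>handle_in_arc\<close>
  applies in every case.\<close>

lemma handle_long_arc:
  assumes "vlist n l" "slide n l (x # c # y # q @ nx n x # r)" "x \<le> n"
  shows "\<exists>z \<le> n. handle_at n z l"
proof -
  have v: "vlist n (x # c # y # q @ nx n x # r)" using assms slide_vlist by blast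
  have cy: "c \<le> n" "y \<le> n" "c \<noteq> y" using v unfolding vlist_def by auto
  have set: "set (c # y # q) \<union> set (nx n x # r @ [x]) = {..n}" using v unfolding vlist_def by auto
  consider "nx n c \<in> set (c # y # q)" | "nx n y \<in> set (c # y # q)"
    | "nx n c \<in> set (nx n x # r @ [x])" "nx n y \<in> set (nx n x # r @ [x])"
    using set nx_le[OF cy(1)] nx_le[OF cy(2)] by blast
  then show ?thesis
  proof cases
    case 1
    then show ?thesis using handle_in_arc[OF assms(1) _ assms(3), of "c # y # q" r c] assms(2) by simp
  next
    case 2
    then show ?thesis using handle_in_arc[OF assms(1) _ assms(3), of "c # y # q" r y] assms(2) by simp
  next
    case 3
    have "nx n c \<noteq> nx n y" using nx_inject cy by blast
    then consider u v w where "nx n x # r @ [x] = u @ nx n y # v @ nx n c # w"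
      | u v w where "nx n x # r @ [x] = u @ nx n c # v @ nx n y # w"
      using split_list_two[OF 3] by blast
    then show ?thesis
    proof cases
      case (1 u v w)
      have "slide n l ([x] @ c # y # q @ nx n x # r)" using assms(2) by simp
      also have "slide n \<dots> (c # y # q @ nx n x # r @ [x])"
        using slide.rotate[of n "[x]" "c # y # q @ nx n x # r"] by simp
      finally have "slide n l (c # (y # q @ u @ nx n y # v) @ nx n c # w)" unfolding 1 by simp
      from handle_in_arc[OF assms(1) this cy(1), of y] show ?thesis by simp
    next
      case (2 u v w)
      have "slide n l (x # [c] @ (y # q) @ nx n x # r)" using assms(2) by simp
      also have "slide n \<dots> ([x] @ y # q @ c # nx n x # r)"
        using slide_block2[OF assms(3), of "[]" "[c]" "y # q" r] by simp
      also have "slide n \<dots> (y # q @ c # nx n x # r @ [x])"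
        using slide.rotate[of n "[x]" "y # q @ c # nx n x # r"] by simp
      finally have "slide n l (y # (q @ c # u @ nx n c # v) @ nx n y # w)" unfolding 2 by simp
      from handle_in_arc[OF assms(1) this cy(2), of c] show ?thesis by simp
    qed
  qed
qed

text \<open>The sum is m plus the number of twos, so this number is a multiple of m between 0 and
  m.\<close>

lemma sum_1_2_mod:
  fixes d :: "nat \<Rightarrow> nat"
  assumes d: "\<And>i. i < m \<Longrightarrow> d i = 1 \<or> d i = 2" and dvd: "m dvd (\<Sum>i<m. d i)"
  shows "(\<forall>i<m. d i = 1) \<or> (\<forall>i<m. d i = 2)"
proof -
  let ?S = "{i \<in> {..<m}. d i = 2}"
  have "(\<Sum>i<m. d i) = (\<Sum>i<m. 1 + (if d i = 2 then 1 else 0))"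
    by (rule sum.cong) (use d in auto)
  also have "\<dots> = m + card ?S" unfolding sum.distrib by (simp add: sum.If_cases Int_def)
  finally have "m dvd card ?S" using dvd by simp
  moreover have "card ?S \<le> m" using card_mono[of "{..<m}" ?S] by auto
  ultimately have "card ?S = 0 \<or> card ?S = m" by (metis dvd_imp_le gr0I le_antisym)
  then show ?thesis
  proof
    assume "card ?S = 0"
    then have "?S = {}" by simp
    then show ?thesis using d by blast
  next
    assume "card ?S = m"
    then have "?S = {..<m}" by (intro card_subset_eq) auto
    then show ?thesis by blast
  qed
qed

text \<open>The exceptional word \<open>0 (h+1) 1 (h+2) 2 \<dots> (2h) h\<close>, on which every exchange is trivial.\<close>

definition special :: "nat \<Rightarrow> nat list" where
  "special h = concat (map (\<lambda>i. [i, h + 1 + i]) [0..<h]) @ [h]"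

lemma length_concat_pairs: "length (concat (map (\<lambda>i. [f i, g i]) [0..<h])) = 2 * h"
  by (induction h) auto

lemma nth_concat_pairs:
  "i < h \<Longrightarrow> concat (map (\<lambda>i. [f i, g i]) [0..<h]) ! (2 * i) = f i"
  "i < h \<Longrightarrow> concat (map (\<lambda>i. [f i, g i]) [0..<h]) ! Suc (2 * i) = g i"
  by (induction h) (auto simp: nth_append length_concat_pairs less_Suc_eq)

lemma length_special: "length (special h) = Suc (2 * h)"
  by (simp add: special_def length_concat_pairs)

lemma nth_special: "i \<le> h \<Longrightarrow> special h ! (2 * i) = i" "i < h \<Longrightarrow> special h ! Suc (2 * i) = h + 1 + i"
  by (auto simp: special_def nth_append length_concat_pairs nth_concat_pairs le_less)

text \<open>
  The distances from \<open>x\<close> to \<open>x + 1\<close> in the cyclic word are 1 or 2 and add up to a multiple of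
  \<open>n + 1\<close>, hence they are all equal.
\<close>

lemma no_handle_cases:
  assumes v: "vlist n l" and no: "\<And>x. x \<le> n \<Longrightarrow> \<not> handle_at n x l" and "1 \<le> n"
  shows "slide n l [0..<n + 1] \<or> (\<exists>h. n = 2 * h \<and> slide n l (special h))"
proof -
  have "0 \<in> set l" using v by (auto simp: vlist_def)
  then obtain l' where l': "slide n l (0 # l')" using rotate_to_slide by blast
  define m where "m = 0 # l'"
  have lm: "slide n l m" using l' by (simp add: m_def)
  have vm: "vlist n m" using slide_vlist[OF lm] v by simp
  have len: "length m = Suc n" using vm unfolding vlist_def by (metis card_atMost distinct_card)
  have inj: "i = j" if "m ! i = m ! j" "i \<le> n" "j \<le> n" for i j
    using vm that len by (auto simp: vlist_def nth_eq_iff_index_eq)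
  have step: "\<exists>d. (d = 1 \<or> d = 2) \<and> m ! ((i + d) mod Suc n) = nx n (m ! i)" if "i \<le> n" for i
  proof -
    let ?x = "m ! i"
    have x: "?x \<le> n" using vm that len nth_mem[of i m] unfolding vlist_def by auto
    have "m = take i m @ ?x # drop (Suc i) m" by (rule id_take_nth_drop) (use that len in simp)
    moreover have "length (take i m) = i" using that len by simp
    ultimately obtain a b where ab: "m = a @ ?x # b" "length a = i" by blast
    have rot: "rotate i m = ?x # b @ a" using ab rotate_append[of a "?x # b"] by simp
    have sl: "slide n l (?x # b @ a)"
      using slide.trans[OF lm] slide.rotate[of n a "?x # b"] ab by simp
    have "nx n ?x \<noteq> ?x" using \<open>1 \<le> n\<close> by (auto simp: nx_def)
    moreover have "nx n ?x \<in> set (?x # b @ a)" using sl v slide_vlist x by (metis atMost_iff nx_le vlist_def)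
    ultimately have "nx n ?x \<in> set (b @ a)" by simp
    then obtain q r where qr: "b @ a = q @ nx n ?x # r" by (meson split_list)
    \<comment> \<open>Two letters between x and x + 1 would give a reversed triple.\<close>
    have "length q < 2"
    proof (rule ccontr)
      assume "\<not> length q < 2"
      then obtain c y q' where "q = c # y # q'" by (cases q; cases "tl q") auto
      then show False using handle_long_arc[OF v _ x, of c y q' r] sl qr no by auto
    qed
    moreover have "m ! ((i + Suc (length q)) mod Suc n) = rotate i m ! Suc (length q)"
    proof -
      have "length (b @ a) = n" using arg_cong[OF ab(1), of length] len by simp
      then have "Suc (length q) < length m" unfolding qr len by simp
      then show ?thesis using len by (simp add: nth_rotate add.commute)
    qed
    moreover have "rotate i m ! Suc (length q) = nx n ?x" unfolding rot qr by simp
    ultimately have "m ! ((i + Suc (length q)) mod Suc n) = nx n ?x" by (simp only:)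
    moreover have "Suc (length q) = 1 \<or> Suc (length q) = 2" using \<open>length q < 2\<close> by linarith
    ultimately show ?thesis by blast
  qed
  define p where "p x = (THE i. i \<le> n \<and> m ! i = x)" for x
  have p: "p x \<le> n \<and> m ! p x = x" if "x \<le> n" for x
  proof -
    have "\<exists>!i. i \<le> n \<and> m ! i = x"
    proof (rule ex_ex1I)
      have "x \<in> set m" using vm that by (auto simp: vlist_def)
      then show "\<exists>i. i \<le> n \<and> m ! i = x" unfolding in_set_conv_nth len less_Suc_eq_le by blast
    qed (use inj in blast)
    then show ?thesis unfolding p_def by (rule theI')
  qed
  have "\<exists>d. (d = 1 \<or> d = 2) \<and> p (nx n x) = (p x + d) mod Suc n" if xn: "x \<le> n" for x
  proof -
    obtain d where d: "d = 1 \<or> d = 2" "m ! ((p x + d) mod Suc n) = nx n x"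
      using step[of "p x"] p[OF xn] by auto
    have "m ! p (nx n x) = m ! ((p x + d) mod Suc n)" "p (nx n x) \<le> n"
      using d(2) p[OF nx_le[OF xn]] by simp_all
    moreover have "(p x + d) mod Suc n \<le> n" by (simp add: less_Suc_eq_le[symmetric])
    ultimately have "p (nx n x) = (p x + d) mod Suc n" using inj by blast
    then show ?thesis using d by blast
  qed
  then obtain d where d: "\<And>x. x \<le> n \<Longrightarrow> d x = 1 \<or> d x = (2::nat)"
    "\<And>x. x \<le> n \<Longrightarrow> p (nx n x) = (p x + d x) mod Suc n" by metis
  have p0: "p 0 = 0" using inj[of "p 0" 0] p[of 0] by (simp add: m_def)
  have pk: "p k = (\<Sum>i<k. d i) mod Suc n" if "k \<le> n" for k
    using that
  proof (induction k)
    case (Suc k)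
    then show ?case using d(2)[of k] by (simp add: nx_def mod_add_left_eq)
  qed (simp add: p0)
  \<comment> \<open>After n + 1 steps the position of the label 0 is reached again.\<close>
  have "(\<Sum>i<Suc n. d i) mod Suc n = 0"
    using d(2)[of n] pk[of n] p0 by (simp add: nx_def mod_add_left_eq)
  then consider "\<forall>i<Suc n. d i = 1" | "\<forall>i<Suc n. d i = 2"
    using sum_1_2_mod[of "Suc n" d] d(1) by (metis dvd_eq_mod_eq_0 less_Suc_eq_le)
  then show ?thesis
  proof cases
    case 1
    then have "p k = k" if "k \<le> n" for k using pk[OF that] that by simp
    then have "m ! k = k" if "k \<le> n" for k using p[OF that] that by simp
    then have "m = [0..<n + 1]" using len by (intro nth_equalityI) (auto simp del: upt_Suc)
    then show ?thesis using lm by simp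
  next
    case 2
    then have p2: "p k = 2 * k mod Suc n" if "k \<le> n" for k using pk[OF that] that by (simp add: mult.commute)
    \<comment> \<open>Were n + 1 = 2 h, the labels 0 and h would share position 0.\<close>
    have "even n"
    proof (rule ccontr)
      assume "odd n"
      then obtain h where h: "Suc n = 2 * h" by (metis odd_Suc_minus_one evenE even_Suc)
      then have "h \<le> n" "h \<noteq> 0" by auto
      then have "p h = p 0" using p2[of h] p0 h by simp
      then show False using p[OF \<open>h \<le> n\<close>] p[of 0] \<open>h \<noteq> 0\<close> by auto
    qed
    then obtain h where h: "n = 2 * h" by blast
    have "m ! i = special h ! i" if "i < Suc n" for i
    proof (cases "even i")
      case True
      then obtain k where k: "i = 2 * k" by blast
      then show ?thesis using p[of k] p2[of k] that h by (simp add: nth_special)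
    next
      case False
      then obtain k where k: "i = Suc (2 * k)" by (metis oddE Suc_eq_plus1)
      then have "k < h" using that h by simp
      then have "p (h + 1 + k) = (Suc (2 * k) + Suc n) mod Suc n" using p2[of "h + 1 + k"] h by (simp add: add.commute)
      also have "\<dots> = Suc (2 * k)" using \<open>k < h\<close> h by (subst mod_add_self2) simp
      finally show ?thesis using p[of "h + 1 + k"] k \<open>k < h\<close> h by (simp add: nth_special)
    qed
    then have "m = special h" using len length_special[of h] h by (intro nth_equalityI) auto
    then show ?thesis using lm h by auto
  qed
qed

text \<open>
  A handle in front of 0 moves along with 0, and letters can be slid across it. Hence slides lift from
  the letters up to \<open>n\<close> to those up to \<open>n + 2\<close>.
\<close>

definition thicken :: "nat \<Rightarrow> nat list \<Rightarrow> nat list" where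
  "thicken n l = concat (map (\<lambda>x. if x = 0 then [n + 2, n + 1, 0] else [x]) l)"

lemma thicken_simps [simp]:
  "thicken n [] = []" "thicken n (u @ v) = thicken n u @ thicken n v"
  "thicken n (x # u) = (if x = 0 then [n + 2, n + 1, 0] else [x]) @ thicken n u"
  by (auto simp: thicken_def)

lemma thicken_id: "0 \<notin> set l \<Longrightarrow> thicken n l = l"
  by (induction l) auto

lemma slide_thicken:
  assumes "1 \<le> n"
  shows "slide n l l' \<Longrightarrow> slide (n + 2) (thicken n l) (thicken n l')"
proof (induction rule: slide.induct)
  case (move x y u v)
  let ?y = "thicken n [y]" and ?u = "thicken n u" and ?v = "thicken n v"
  show ?case
  proof (cases "x = n")
    case False
    then have "x < n" using move by simp
    \<comment> \<open>For \<open>x = 0\<close> the handle in front of 0 is absorbed into the stretch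
      between x + 1 and x.\<close>
    obtain t where t: "thicken n [x] = t @ [x]" by (cases "x = 0") auto
    have "slide (n + 2) (?y @ nx (n + 2) x # (?u @ t) @ x # ?v) (nx (n + 2) x # (?u @ t) @ x # ?y @ ?v)"
      by (rule slide_move_block) (use \<open>x < n\<close> in simp)
    moreover have "nx (n + 2) x = Suc x" "nx n x = Suc x" using \<open>x < n\<close> by (auto simp: nx_def)
    moreover have "thicken n (x # v) = t @ x # ?v" "thicken n (x # y # v) = t @ x # ?y @ ?v"
      using t by auto
    moreover have "thicken n (y # Suc x # u @ x # v) = ?y @ Suc x # ?u @ thicken n (x # v)"
      "thicken n (Suc x # u @ x # y # v) = Suc x # ?u @ thicken n (x # y # v)" by simp_all
    ultimately show ?thesis by simp
  next
    case True
    \<comment> \<open>Here \<open>y\<close> has to get from the front of (n + 2) (n + 1) 0 to behind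
      n. It passes the handle by slides along the three pairs (n + 1, n + 2), (n + 2, 0) and (n, n +
      1).\<close>
    let ?N = "n + 2"
    have nx: "nx ?N (n + 1) = n + 2" "nx ?N (n + 2) = 0" "nx ?N n = n + 1" by (auto simp: nx_def)
    have "slide ?N (?y @ [n + 2, n + 1, 0] @ ?u @ n # ?v) ((n + 2) # (n + 1) # ?y @ 0 # ?u @ n # ?v)"
      using slide_block1[of "n + 1" ?N "[]" ?y "[]" "0 # ?u @ n # ?v"] nx by simp
    also have "slide ?N \<dots> ((n + 2) # ?y @ (n + 1) # 0 # ?u @ n # ?v)"
      using slide_block2[of "n + 2" ?N "[]" "[n + 1]" ?y "?u @ n # ?v"] nx by simp
    also have "slide ?N \<dots> ((n + 2) # (n + 1) # 0 # ?u @ n # ?y @ ?v)"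
      using slide_block1[of n ?N "[n + 2]" ?y "0 # ?u" ?v] nx by simp
    finally show ?thesis using True assms by (simp add: nx_def)
  qed
qed (auto intro: slide.refl slide.sym slide.trans slide.rotate)

lemma thicken_Cons_0:
  assumes "0 \<notin> set r"
  shows "slide (n + 2) (thicken n (0 # r)) (0 # r @ [n + 2, n + 1])"
  using slide.rotate[of "n + 2" "[n + 2, n + 1]" "0 # r"] assms by (simp add: thicken_id)

lemma vlist_Cons_0: "vlist n (0 # r) \<Longrightarrow> 0 \<notin> set r"
  by (simp add: vlist_def)

lemma slide_handle:
  assumes "vlist n (0 # r)" "slide n (0 # r) (0 # r')"
  shows "slide (n + 2) (0 # r @ [n + 2, n + 1]) (0 # r' @ [n + 2, n + 1])"
proof (cases "n = 0")
  case True
  then have "r = []" using assms(1) by (cases r) (auto simp: vlist_def)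
  moreover have "r' = []" using slide_mset[OF assms(2)] \<open>r = []\<close> by simp
  ultimately show ?thesis by (simp add: slide.refl)
next
  case False
  then have "slide (n + 2) (thicken n (0 # r)) (thicken n (0 # r'))"
    by (intro slide_thicken assms(2)) simp
  then show ?thesis
    using thicken_Cons_0 vlist_Cons_0 assms slide_vlist by (meson slide.sym slide.trans)
qed

section \<open>Normal forms of orientable words\<close>

definition handles :: "nat \<Rightarrow> nat \<Rightarrow> nat list" where
  "handles j g = concat (map (\<lambda>i. [j + 2 * i + 2, j + 2 * i + 1]) [0..<g])"

lemma handles_0 [simp]: "handles j 0 = []"
  by (simp add: handles_def)

lemma handles_Suc: "handles j (Suc g) = handles j g @ [j + 2 * g + 2, j + 2 * g + 1]"
  by (simp add: handles_def)

lemma handles_add: "handles j (a + b) = handles j a @ handles (j + 2 * a) b"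
  by (induction b) (auto simp: handles_Suc algebra_simps)

lemma set_handles: "set (handles j g) = {j + 1..j + 2 * g}"
proof (induction g)
  case (Suc g)
  have "{j + 1..j + 2 * Suc g} = {j + 1..j + 2 * g} \<union> {j + 2 * g + 2, j + 2 * g + 1}" by auto
  then show ?case by (simp add: handles_Suc Suc)
qed simp

lemma distinct_handles: "distinct (handles j g)"
  by (induction g) (auto simp: handles_Suc set_handles)

lemma vlist_handles: "vlist j l \<Longrightarrow> vlist (j + 2 * g) (l @ handles j g)"
proof -
  assume l: "vlist j l"
  have "{..j} \<union> {j + 1..j + 2 * g} = {..j + 2 * g}" unfolding set_eq_iff by (simp, arith)
  moreover have "{..j} \<inter> {j + 1..j + 2 * g} = {}" by auto
  ultimately show ?thesis using l by (simp add: vlist_def set_handles distinct_handles)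
qed

lemma slide_handles:
  assumes "vlist n (0 # r)" "slide n (0 # r) (0 # r')"
  shows "slide (n + 2 * g) (0 # r @ handles n g) (0 # r' @ handles n g)"
proof (induction g)
  case (Suc g)
  have "vlist (n + 2 * g) (0 # r @ handles n g)" using vlist_handles[OF assms(1)] by simp
  from slide_handle[OF this Suc] show ?case by (simp add: handles_Suc)
qed (use assms in simp)

lemma vlist_special: "vlist (2 * h) (special h)"
proof -
  let ?c = "\<lambda>k. concat (map (\<lambda>i. [i, h + 1 + i]) [0..<k])"
  have "distinct (?c k) \<and> set (?c k) = {..<k} \<union> {h + 1..<h + 1 + k}" if "k \<le> h" for k
    using that
  proof (induction k)
    case (Suc k)
    then have IH: "distinct (?c k)" "set (?c k) = {..<k} \<union> {h + 1..<h + 1 + k}" by simp_all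
    have eq: "?c (Suc k) = ?c k @ [k, h + 1 + k]" by simp
    have "k \<notin> set (?c k)" "h + 1 + k \<notin> set (?c k)" unfolding IH(2) using Suc.prems by simp_all
    moreover have "{..<Suc k} \<union> {h + 1..<h + 1 + Suc k} =
        {..<k} \<union> {h + 1..<h + 1 + k} \<union> {k, h + 1 + k}" by (simp add: lessThan_Suc atLeastLessThanSuc insert_commute)
    ultimately show ?case unfolding eq set_append distinct_append IH(2)
      using IH(1) by simp
  qed simp
  then have c: "distinct (?c h)" "set (?c h) = {..<h} \<union> {h + 1..<h + 1 + h}" by blast+
  have "{..<h} \<union> {h + 1..<h + 1 + h} \<union> {h} = {..2 * h}" unfolding set_eq_iff by (simp, arith)
  then show ?thesis using c by (simp add: vlist_def special_def)
qed

lemma special_Cons: "1 \<le> h \<Longrightarrow> \<exists>r. special h = 0 # r"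
  by (cases h) (auto simp: special_def upt_conv_Cons simp del: upt_Suc)

lemma vlist_remove_handle:
  assumes "vlist (n + 2) (0 # r @ [n + 2, n + 1])"
  shows "vlist n (0 # r)"
proof -
  have d: "distinct (0 # r)" "set (0 # r) \<inter> {n + 2, n + 1} = {}"
    and "set (0 # r) \<union> {n + 2, n + 1} = {..n + 2}"
    using assms by (simp_all add: vlist_def insert_commute)
  then have "set (0 # r) = {..n + 2} - {n + 2, n + 1}" by blast
  also have "\<dots> = {..n}" unfolding set_eq_iff by (simp, arith)
  finally show ?thesis using d(1) by (simp add: vlist_def)
qed

text \<open>A handle split off at the end does not obstruct further slides of the rest by
  \<open>slide_handle\<close>, so the induction removes handles until no reversed triple is left.
  The bound on \<open>h\<close> excludes 0 2 1, which is itself a handle.\<close>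

lemma slide_canonical:
  assumes "vlist n l"
  shows "(\<exists>j g. n = j + 2 * g \<and> slide n l ([0..<j + 1] @ handles j g)) \<or>
         (\<exists>h g. 2 \<le> h \<and> n = 2 * h + 2 * g \<and> slide n l (special h @ handles (2 * h) g))"
  using assms
proof (induction n arbitrary: l rule: less_induct)
  case (less n)
  show ?case
  proof (cases "n = 0")
    case True
    then have "l = [0]" using less.prems unfolding vlist_def
      by (metis One_nat_def atMost_0 card.empty card_insert_disjoint distinct_card empty_iff finite.emptyI length_0_conv length_Suc_conv list.set(2) singletonI insert_iff singletonD)
    then show ?thesis using True by (intro disjI1 exI[of _ 0]) (auto intro: slide.refl)
  next
    case False
    show ?thesis
    proof (cases "\<exists>x \<le> n. 2 \<le> n \<and> handle_at n x l")
      case True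
      then obtain x r where x: "2 \<le> n" "slide n l (0 # r @ [n, n - 1])"
        using handle_extract[OF less.prems] by blast
      define m where "m = n - 2"
      have n: "n = m + 2" using x by (simp add: m_def)
      have sl: "slide n l (0 # r @ [m + 2, m + 1])" using x n by simp
      have v: "vlist m (0 # r)" using vlist_remove_handle slide_vlist[OF sl] less.prems n by blast
      have lift: "slide n l (0 # r' @ [m + 2, m + 1])" if "slide m (0 # r) (0 # r')" for r'
        using slide.trans[OF sl] slide_handle[OF v that] n by simp
      have "(\<exists>j g. m = j + 2 * g \<and> slide m (0 # r) ([0..<j + 1] @ handles j g)) \<or>
          (\<exists>h g. 2 \<le> h \<and> m = 2 * h + 2 * g \<and> slide m (0 # r) (special h @ handles (2 * h) g))"
        using less.IH[OF _ v] n by simp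
      then show ?thesis
      proof (elim disjE exE conjE)
        fix j g assume j: "m = j + 2 * g" "slide m (0 # r) ([0..<j + 1] @ handles j g)"
        then have "slide n l ([0..<j + 1] @ handles j (Suc g))"
          using lift[of "[1..<j + 1] @ handles j g"]
          by (simp add: handles_Suc upt_conv_Cons del: upt_Suc)
        then show ?thesis using j n by (intro disjI1 exI[of _ j] exI[of _ "Suc g"]) simp
      next
        fix h g assume h: "2 \<le> h" "m = 2 * h + 2 * g" "slide m (0 # r) (special h @ handles (2 * h) g)"
        then obtain s where s: "special h = 0 # s" using special_Cons[of h] by auto
        have "slide n l (special h @ handles (2 * h) (Suc g))"
          using lift[of "s @ handles (2 * h) g"] h s by (simp add: handles_Suc)
        then show ?thesis using h n by (intro disjI2 exI[of _ h] exI[of _ "Suc g"]) simp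
      qed
    next
      case no: False
      have le2: "slide n l [0..<n + 1] \<or> (\<exists>h. n = 2 * h \<and> slide n l (special h))" if "2 \<le> n"
      proof (rule no_handle_cases[OF less.prems])
        show "\<not> handle_at n x l" if "x \<le> n" for x using no that \<open>2 \<le> n\<close> by blast
      qed (use that in simp)
      have eq1: "slide n l [0..<n + 1]" if "n = 1"
      proof -
        have "0 \<in> set l" using less.prems by (auto simp: vlist_def)
        then obtain r where r: "slide n l (0 # r)" using rotate_to_slide by blast
        then have "vlist n (0 # r)" using slide_vlist less.prems by blast
        then have "distinct r" "0 \<notin> set r" "insert 0 (set r) = {..1}"
          unfolding vlist_def that by simp_all
        moreover have "{..1} = {0, 1::nat}" by auto
        ultimately have r1: "set r = {1}" "distinct r" by (auto simp: insert_eq_iff)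
        then have "length r = 1" using distinct_card[of r] by simp
        then have "r = [1]" using r1(1) by (cases r) auto
        moreover have "[0..<n + 1] = [0, 1]" unfolding that by (simp add: upt_rec)
        ultimately show ?thesis using r by simp
      qed
      consider "slide n l [0..<n + 1]" | h where "n = 2 * h" "slide n l (special h)" "h \<noteq> 0"
      proof (cases "n = 1")
        case False
        then have "2 \<le> n" using \<open>n \<noteq> 0\<close> by simp
        then show ?thesis using le2 that \<open>n \<noteq> 0\<close> by (metis mult_0_right)
      qed (use eq1 that in blast)
      then show ?thesis
      proof cases
        case 1
        then show ?thesis by (intro disjI1 exI[of _ n] exI[of _ 0]) simp
      next
        case (2 h)
        show ?thesis
        proof (cases "h = 1")
          \<comment> \<open>The word 0 2 1 is a reversed triple, contrary to the absence of
            handles.\<close>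
          case True
          have "handle_at n 1 l"
            unfolding handle_at_def using 2 True slide.trans[OF 2(2)] slide.rotate[of n "[0,2]" "[1]"]
            by (intro exI[of _ "[]"]) (simp add: special_def nx_def numeral_2_eq_2)
          then show ?thesis using no 2 True by auto
        next
          case False
          then show ?thesis using 2 by (intro disjI2 exI[of _ h] exI[of _ 0]) auto
        qed
      qed
    qed
  qed
qed

text \<open>A handle frees the exceptional word: slides alone lead to a word whose lower part
  contains the reversed triple h + 1, h + 2, h + 3, for which \<open>h\<close> must be at least 3. A
  second handle can then be split off, which opens the way back from handles to exceptional
  words.\<close>

lemma slide_special:
  assumes "3 \<le> h"
  shows "\<exists>r. slide (2 * h + 2) (special h @ [2 * h + 2, 2 * h + 1]) (0 # r @ [2 * h + 2, 2 * h + 1])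
      \<and> vlist (2 * h) (0 # r) \<and> handle_at (2 * h) (h + 1) (0 # r)"
proof -
  \<comment> \<open>Each rotation below brings a pair x, x + 1 into position for rotating the
    stretch between them. The middle part \<open>m\<close>, namely 2 (h + 3) ... (h - 1) (2 h), is
    moved as a whole or accessed through its ends 2 and 2 h.\<close>
  let ?n = "2 * h + 2"
  define m where "m = concat (map (\<lambda>i. [i, h + 1 + i]) [2..<h])"
  define u v where "u = 2 * h + 2" and "v = 2 * h + 1"
  have "[0..<h] = 0 # 1 # [2..<h]" using assms by (simp add: upt_conv_Cons numeral_2_eq_2)
  then have sp: "special h = [0, h + 1, 1, h + 2] @ m @ [h]" by (simp add: special_def m_def)
  obtain m' where m': "m = 2 # m' @ [2 * h]"
  proof -
    have a: "[2..<h] = 2 # [3..<h]" using assms by (simp add: upt_conv_Cons numeral_eq_Suc)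
    have b: "[2..<h] = [2..<h - 1] @ [h - 1]"
      using upt_Suc_append[of 2 "h - 1"] assms by simp
    have "m = 2 # (h + 3) # concat (map (\<lambda>i. [i, h + 1 + i]) [3..<h])"
      unfolding m_def a by simp
    moreover have "m = (concat (map (\<lambda>i. [i, h + 1 + i]) [2..<h - 1]) @ [h - 1]) @ [2 * h]"
      unfolding m_def b using assms by simp
    ultimately obtain x y where "m = 2 # x" "m = y @ [2 * h]" by blast
    then show ?thesis using that assms by (cases y) auto
  qed
  have nx: "nx ?n h = h + 1" "nx ?n u = 0" "nx ?n 0 = 1" "nx ?n 1 = 2" "nx ?n (2 * h) = v" "nx ?n v = u"
    using assms by (auto simp: nx_def u_def v_def)
  have "slide ?n (special h @ [u, v]) ([h, u, v, 0, h + 1, 1, h + 2] @ m)"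
    using slide.rotate[of ?n "[0, h + 1, 1, h + 2] @ m" "[h, u, v]"] sp by simp
  also have "slide ?n \<dots> ([h, v, 0, u, h + 1, 1, h + 2] @ m)"
    using slide_block2[of h ?n "[]" "[u]" "[v, 0]" "[1, h + 2] @ m"] nx assms by simp
  also have "slide ?n \<dots> (u # ([h + 1, 1]) @ ([h + 2] @ m @ [h, v]) @ [0])"
    using slide.rotate[of ?n "[h, v, 0]" "[u, h + 1, 1, h + 2] @ m"]
      slide.rotate[of ?n "[0]" "[u, h + 1, 1, h + 2] @ m @ [h, v]"] slide.trans by fastforce
  also have "slide ?n \<dots> (u # ([h + 2] @ m @ [h, v]) @ ([h + 1, 1]) @ [0])"
    using slide_block2[of u ?n "[]" "[h + 1, 1]" "[h + 2] @ m @ [h, v]" "[]"] nx by (simp add: u_def)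
  also have "slide ?n \<dots> (0 # ([u, h + 2] @ m) @ ([h, v, h + 1]) @ [1])"
    using slide.rotate[of ?n "[u, h + 2] @ m @ [h, v, h + 1, 1]" "[0]"] by simp
  also have "slide ?n \<dots> (0 # ([h, v, h + 1]) @ ([u, h + 2] @ m) @ [1])"
    using slide_block2[of 0 ?n "[]" "[u, h + 2] @ m" "[h, v, h + 1]" "[]"] nx by simp
  also have "slide ?n \<dots> (1 # ([0, h, v]) @ ([h + 1, u, h + 2]) @ m)"
    using slide.rotate[of ?n "[0, h, v, h + 1, u, h + 2] @ m" "[1]"] by simp
  also have "slide ?n \<dots> (1 # ([h + 1, u, h + 2]) @ ([0, h, v]) @ m)"
    using slide_block2[of 1 ?n "[]" "[0, h, v]" "[h + 1, u, h + 2]" "m' @ [2 * h]"] nx m' by simp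
  also have "slide ?n \<dots> ((2 * h) # ([1, h + 1, u]) @ ([h + 2, 0, h]) @ v # 2 # m')"
    using slide.rotate[of ?n "[1, h + 1, u, h + 2, 0, h, v, 2] @ m'" "[2 * h]"] m' by simp
  also have "slide ?n \<dots> ((2 * h) # ([h + 2, 0, h]) @ ([1, h + 1, u]) @ v # 2 # m')"
    using slide_block2[of "2 * h" ?n "[]" "[1, h + 1, u]" "[h + 2, 0, h]" "2 # m'"] nx by simp
  also have "slide ?n \<dots> (v # (m @ [h + 2]) @ ([0, h, 1, h + 1]) @ [u])"
    using slide.rotate[of ?n "[2 * h, h + 2, 0, h, 1, h + 1, u]" "v # 2 # m'"]
      slide.rotate[of ?n "[2 * h, h + 2, 0, h, 1, h + 1, u]" "v # 2 # m'"] m' by simp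
  also have "slide ?n \<dots> (v # ([0, h, 1, h + 1]) @ (m @ [h + 2]) @ [u])"
    using slide_block2[of v ?n "[]" "m @ [h + 2]" "[0, h, 1, h + 1]" "[]"] nx by (simp add: v_def)
  also have "slide ?n \<dots> ([0, h, 1, h + 1] @ m @ [h + 2, u, v])"
    using slide.rotate[of ?n "[v]" "[0, h, 1, h + 1] @ m @ [h + 2, u]"] by simp
  finally have sl: "slide ?n (special h @ [u, v]) (0 # ([h, 1, h + 1] @ m @ [h + 2]) @ [u, v])" by simp
  have "mset (0 # [h, 1, h + 1] @ m @ [h + 2]) = mset (special h)" by (simp add: sp)
  then have vl: "vlist (2 * h) (0 # [h, 1, h + 1] @ m @ [h + 2])" using vlist_special vlist_cong by blast
  have "h + 3 \<in> set m" using assms by (auto simp: m_def intro!: bexI[of _ 2])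
  then obtain a b where ab: "m = a @ (h + 3) # b" by (meson split_list)
  have "nx (2 * h) (h + 1) = h + 2" "nx (2 * h) (h + 2) = h + 3" using assms by (auto simp: nx_def)
  then have "handle_at (2 * h) (h + 1) (0 # [h, 1, h + 1] @ m @ [h + 2])"
    unfolding handle_at_def ab
    using slide.rotate[of "2 * h" "[0, h, 1]" "(h + 1) # a @ (h + 3) # b @ [h + 2]"]
    by (intro exI[of _ a] exI[of _ b] exI[of _ "[0, h, 1]"]) simp
  then show ?thesis using sl vl unfolding u_def v_def by blast
qed

section \<open>Reduction of orientable words\<close>

lemma slide_eqv: "slide n l l' \<Longrightarrow> eqv n (map Pos l) (map Pos l')"
proof (induction rule: slide.induct)
  case (move x y u v)
  have "nxt n (Pos x) = Pos (nx n x)" by (simp add: nx_def)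
  then show ?case using eqv.move[OF move, of "Pos y" "map Pos u" "map Pos v"] by simp
next
  case (rotate u v)
  then show ?case using eqv.rotate[of n "map Pos u" "map Pos v"] by simp
qed (auto intro: eqv.refl eqv.sym eqv.trans)

lemma valid_map_Pos_vlist: "valid n (map Pos l) \<longleftrightarrow> vlist n l"
  by (simp add: valid_map_Pos vlist_def)

abbreviation list_comps :: "nat \<Rightarrow> nat list \<Rightarrow> nat" where
  "list_comps n l \<equiv> word_comps n (map Pos l)"

lemma list_comps_slide: "vlist n l \<Longrightarrow> slide n l l' \<Longrightarrow> list_comps n l = list_comps n l'"
  using word_comps_eqv slide_eqv valid_map_Pos_vlist by blast

lemma list_comps_handles:
  assumes "vlist n (0 # r)"
  shows "list_comps (n + 2 * g) (0 # r @ handles n g) = list_comps n (0 # r)"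
proof (induction g)
  case (Suc g)
  have "vlist (n + 2 * g) (0 # r @ handles n g)" using vlist_handles[OF assms] by simp
  then have "valid (n + 2 * g) (Pos 0 # map Pos (r @ handles n g))"
    using valid_map_Pos_vlist[of "n + 2 * g" "0 # r @ handles n g"] by simp
  from word_comps_handle[OF this] show ?case using Suc by (simp add: handles_Suc)
qed simp

lemma vlist_upt: "vlist n [0..<n + 1]"
  by (auto simp: vlist_def)

lemma list_comps_digon:
  assumes "vlist n (0 # r)"
  shows "list_comps (Suc n) (0 # r @ [Suc n]) = Suc (list_comps n (0 # r))"
  using word_comps_digon[of n "map Pos r"] assms valid_map_Pos_vlist[of n "0 # r"] by simp

lemma list_comps_upt: "list_comps n [0..<n + 1] = Suc n"
proof (induction n)
  case 0
  then show ?case using word_comps_0 by simp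
next
  case (Suc n)
  have "[0..<n + 1] = 0 # [1..<n + 1]" by (simp add: upt_conv_Cons del: upt_Suc)
  then show ?case using list_comps_digon[of n "[1..<n + 1]"] vlist_upt[of n] Suc by simp
qed

lemma list_comps_canonical: "list_comps (j + 2 * g) ([0..<j + 1] @ handles j g) = Suc j"
proof -
  have "[0..<j + 1] = 0 # [1..<j + 1]" by (simp add: upt_conv_Cons del: upt_Suc)
  then show ?thesis using list_comps_handles[of j "[1..<j + 1]" g] vlist_upt[of j] list_comps_upt[of j]
    by simp
qed

lemma list_edge_nthI:
  assumes "Suc i < length l"
  shows "{Pos (l ! i), Neg (l ! Suc i)} \<in> word_edges (map Pos l)"
  using word_edge_nthI[of i "map Pos l"] assms by simp

lemma list_edge_last:
  assumes "l \<noteq> []"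
  shows "{Pos (last l), Neg (hd l)} \<in> word_edges (map Pos l)"
proof -
  have "length l - 1 < length l" "Suc (length l - 1) mod length l = 0" using assms by simp_all
  then show ?thesis
    using word_edge_nthI[of "length l - 1" "map Pos l"] assms
    by (simp add: last_conv_nth hd_conv_nth)
qed

lemma hd_last_special:
  assumes "1 \<le> h" shows "hd (special h) = 0" "last (special h) = h" "special h \<noteq> []"
  using special_Cons[OF assms] by (auto simp: special_def)

text \<open>In the exceptional word x is preceded by x + h modulo 2 h + 1, and 2 is the inverse of h
  + 1.\<close>

lemma list_comps_special:
  assumes "1 \<le> h"
  shows "list_comps (2 * h) (special h) = 1"
proof (rule word_comps_arithmetic[where c = h and m = 2])
  fix x assume x: "x \<le> 2 * h"
  consider "x = 0" | i where "x = Suc i" "i < h" | i where "x = h + 1 + i" "i < h"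
  proof -
    have "x = Suc (x - 1) \<and> x - 1 < h" if "x \<noteq> 0" "x \<le> h" using that by simp
    moreover have "x = h + 1 + (x - (h + 1)) \<and> x - (h + 1) < h" if "\<not> x \<le> h" using that x by simp
    ultimately show ?thesis using that by blast
  qed
  then show "{Pos ((x + h) mod Suc (2 * h)), Neg x} \<in> word_edges (map Pos (special h))"
  proof cases
    case 1
    then show ?thesis using list_edge_last[of "special h"] hd_last_special[OF assms] by simp
  next
    case (2 i)
    then have "{Pos (special h ! Suc (2 * i)), Neg (special h ! Suc (Suc (2 * i)))}
        \<in> word_edges (map Pos (special h))"
      by (intro list_edge_nthI) (simp add: length_special)
    then show ?thesis using 2 nth_special(1)[of "Suc i" h] nth_special(2)[of i h] by (simp add: add.commute)
  next
    case (3 i)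
    then have "{Pos (special h ! (2 * i)), Neg (special h ! Suc (2 * i))}
        \<in> word_edges (map Pos (special h))"
      by (intro list_edge_nthI) (simp add: length_special)
    moreover have "(x + h) mod Suc (2 * h) = i"
    proof -
      have "x + h = i + Suc (2 * h)" using 3 by simp
      then show ?thesis using 3 by (simp only: mod_add_self2) simp
    qed
    ultimately show ?thesis using 3 nth_special[of i h] by simp
  qed
next
  have "2 * (h + 1) = 1 + Suc (2 * h)" by simp
  then show "2 * (h + 1) mod Suc (2 * h) = 1 mod Suc (2 * h)" by (simp only: mod_add_self2)
qed

text \<open>The map \<open>\<sigma>\<close> of a cyclic operation of type A with \<open>y = +q\<close> and \<open>q > p + 1\<close>.\<close>

definition shift :: "nat \<Rightarrow> nat \<Rightarrow> nat \<Rightarrow> nat" where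
  "shift p q t = (if t = Suc p then q - 1 else if p + 2 \<le> t \<and> t \<le> q - 1 then t - 1 else t)"

text \<open>The permutation \<open>star\<close> runs through the word backwards, so the factor
  \<open>p # q # Suc p\<close> says that it sends p + 1 to q and q to p. The leading 0 is fixed by
  \<open>shift\<close>, so that \<open>l'\<close> is again a word beginning with 0 and belongs to
  the resulting permutation as it stands.\<close>

definition cyc_step :: "nat \<Rightarrow> nat list \<Rightarrow> nat list \<Rightarrow> bool" where
  "cyc_step n l l' \<longleftrightarrow> (\<exists>p q u v. Suc p < q \<and> q \<le> n \<and> l = u @ p # q # Suc p # v \<and>
     hd l = 0 \<and> l' = map (shift p q) l)"

definition reach :: "nat \<Rightarrow> nat list \<Rightarrow> nat list \<Rightarrow> bool" where
  "reach n = (\<lambda>l l'. slide n l l' \<or> cyc_step n l l')\<^sup>*\<^sup>*"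

lemma reach_slide: "slide n l l' \<Longrightarrow> reach n l l'"
  by (simp add: reach_def r_into_rtranclp)

lemma reach_cyc_step: "cyc_step n l l' \<Longrightarrow> reach n l l'"
  by (simp add: reach_def r_into_rtranclp)

lemma reach_trans [trans]: "reach n l l' \<Longrightarrow> reach n l' l'' \<Longrightarrow> reach n l l''"
  unfolding reach_def by (rule rtranclp_trans)

section \<open>Cyclic steps and the exceptional words\<close>

lemma bij_shift:
  assumes "Suc p < q" shows "bij (shift p q)"
proof (rule o_bij)
  let ?g = "\<lambda>t. if t = q - 1 then Suc p else if Suc p \<le> t \<and> t < q - 1 then Suc t else t"
  show "?g \<circ> shift p q = id" "shift p q \<circ> ?g = id"
    using assms by (auto simp: fun_eq_iff shift_def)
qed

lemma shift_id: "q \<le> t \<Longrightarrow> Suc p < q \<Longrightarrow> shift p q t = t" "t \<le> p \<Longrightarrow> shift p q t = t"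
  by (auto simp: shift_def)

lemma shift_le: "Suc p < q \<Longrightarrow> q \<le> n \<Longrightarrow> t \<le> n \<Longrightarrow> shift p q t \<le> n"
  by (auto simp: shift_def)

lemma cyc_step_vlist:
  assumes "cyc_step n l l'" "vlist n l"
  shows "vlist n l'"
proof -
  obtain p q where pq: "Suc p < q" "q \<le> n" "l' = map (shift p q) l"
    using assms(1) unfolding cyc_step_def by blast
  have inj: "inj_on (shift p q) A" for A using bij_shift[OF pq(1)] by (metis bij_is_inj inj_on_subset subset_UNIV)
  have "shift p q ` {..n} = {..n}"
    by (rule endo_inj_surj) (use inj shift_le[OF pq(1,2)] in auto)
  then show ?thesis using assms(2) pq(3) inj by (simp add: vlist_def distinct_map)
qed

text \<open>\<open>shift\<close> fixes the labels from \<open>q\<close> on, hence all labels of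
  handles above \<open>n\<close>.\<close>

lemma cyc_step_handles:
  assumes "cyc_step n (0 # r) l'"
  shows "cyc_step (n + 2 * g) (0 # r @ handles n g) (l' @ handles n g)"
proof -
  obtain p q u v where pq: "Suc p < q" "q \<le> n" "0 # r = u @ p # q # Suc p # v" "l' = map (shift p q) (0 # r)"
    using assms unfolding cyc_step_def by blast
  have "map (shift p q) (handles n g) = handles n g"
    by (rule map_idI) (use pq in \<open>auto simp: set_handles intro: shift_id\<close>)
  then have "l' @ handles n g = map (shift p q) (0 # r @ handles n g)" unfolding pq(4) by simp
  moreover have "0 # r @ handles n g = u @ p # q # Suc p # v @ handles n g"
    using arg_cong[OF pq(3), of "\<lambda>l. l @ handles n g"] by simp
  moreover have "q \<le> n + 2 * g" "hd (0 # r @ handles n g) = 0" using pq(2) by simp_all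
  ultimately show ?thesis unfolding cyc_step_def using pq(1) by metis
qed

text \<open>The word begins with 0 (h + 1) 1, which permits a step with \<open>p = 0\<close> and
  \<open>q = h + 1\<close>. The result 0 (h + 1) h (h + 2) 1 (h + 3) 2 ... (2 h) (h - 1) contains h,
  h + 2, h + 1 in this cyclic order, a reversed triple.\<close>

lemma cyc_step_special:
  assumes "2 \<le> h"
  obtains r where "cyc_step (2 * h) (special h) (0 # r)" "vlist (2 * h) (0 # r)"
    "handle_at (2 * h) h (0 # r)" "list_comps (2 * h) (0 # r) = 1"
proof -
  let ?s = "shift 0 (h + 1)"
  define X where "X = map ?s (special h)"
  have lenX: "length X = Suc (2 * h)" by (simp add: X_def length_special)
  have s: "?s 0 = 0" "?s 1 = h" "\<And>i. 2 \<le> i \<Longrightarrow> i \<le> h \<Longrightarrow> ?s i = i - 1" "\<And>i. h < i \<Longrightarrow> ?s i = i"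
    using assms by (auto simp: shift_def)
  have even: "X ! (2 * i) = ?s i" if "i \<le> h" for i
    using that by (simp add: X_def nth_special length_special)
  have odd: "X ! Suc (2 * i) = h + 1 + i" if "i < h" for i
    using that s(4)[of "h + 1 + i"] by (simp add: X_def nth_special length_special)
  have hdX: "hd X = 0" using hd_last_special[of h] assms s(1) by (simp add: X_def hd_map)
  have lastX: "last X = h - 1" using hd_last_special[of h] assms s(3)[of h] by (simp add: X_def last_map)
  have X: "X ! 0 = 0" "X ! 1 = h + 1" "X ! 2 = h" "X ! 3 = h + 2"
    using even[of 0] odd[of 0] even[of 1] odd[of 1] s assms by (simp_all add: numeral_3_eq_3)
  have take4: "\<exists>v. xs = xs ! 0 # xs ! 1 # xs ! 2 # xs ! 3 # v" if "4 \<le> length xs" for xs :: "nat list"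
    using that by (cases xs; cases "tl xs"; cases "tl (tl xs)"; cases "tl (tl (tl xs))")
      (auto simp: numeral_2_eq_2 numeral_3_eq_3)
  obtain v where v: "X = 0 # (h + 1) # h # (h + 2) # v"
    using take4[of X] lenX assms unfolding X by auto
  obtain v' where v': "special h = 0 # (h + 1) # 1 # (h + 2) # v'"
    using take4[of "special h"] nth_special[of 0 h] nth_special[of 1 h] length_special[of h] assms
    by (auto simp: numeral_3_eq_3)
  have step: "cyc_step (2 * h) (special h) X"
    unfolding cyc_step_def
    by (intro exI[of _ 0] exI[of _ "h + 1"] exI[of _ "[]"] exI[of _ "(h + 2) # v'"])
      (use assms v' in \<open>auto simp: X_def\<close>)
  have vl: "vlist (2 * h) X" using cyc_step_vlist[OF step vlist_special] .
  have "slide (2 * h) X (h # [] @ (h + 2) # v @ 0 # (h + 1) # [])" if "X = [0, h + 1] @ h # (h + 2) # v"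
    using slide.rotate[of "2 * h" "[0, h + 1]" "h # (h + 2) # v"] that by simp
  then have "slide (2 * h) X (h # [] @ (h + 2) # (v @ [0]) @ (h + 1) # [])" using v by simp
  moreover have "nx (2 * h) h = h + 1" "nx (2 * h) (h + 1) = h + 2" using assms by (auto simp: nx_def)
  ultimately have handle: "handle_at (2 * h) h X" unfolding handle_at_def by metis
  \<comment> \<open>The cycle meets the positive vertices in the order 0, h + 2, 1, h + 3, 2, ..., 2
    h, h - 1, h + 1, h.\<close>
  have "list_comps (2 * h) X = 1"
  proof (rule word_comps_one)
    let ?E = "word_edges (map Pos X) \<union> gray_edges (2 * h)"
    have c: "conn ?E (Pos x) (Pos (X ! i))" if "X ! Suc i = Suc x" "i < 2 * h" "x < 2 * h" for x i
      by (rule conn_preceding) (use that list_edge_nthI[of i X] lenX in auto)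
    have 1: "conn ?E (Pos i) (Pos (h + 2 + i))" if "Suc i < h" for i
    proof -
      have "X ! Suc (Suc (2 * Suc i)) = Suc i" using even[of "i + 2"] s(3)[of "i + 2"] that by simp
      then show ?thesis using c[of "Suc (2 * Suc i)" i] odd[of "Suc i"] that by simp
    qed
    have 2: "conn ?E (Pos (h + 2 + i)) (Pos (Suc i))" if "Suc i < h" for i
    proof (cases "Suc (Suc i) = h")
      case True
      have "{Pos (last X), Neg (hd X)} \<in> word_edges (map Pos X)"
        by (rule list_edge_last) (use lenX in auto)
      then have "conn ?E (Pos (2 * h)) (Pos (h - 1))"
        using conn_preceding[of "2 * h" "2 * h" "h - 1" "map Pos X"] hdX lastX by simp
      moreover have "h + 2 + i = 2 * h" "Suc i = h - 1" using True by simp_all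
      ultimately show ?thesis by (simp only:)
    next
      case False
      have "X ! Suc (2 * (i + 2)) = h + 3 + i" using odd[of "i + 2"] that False by simp
      moreover have "X ! (2 * (i + 2)) = Suc i" using even[of "i + 2"] s(3)[of "i + 2"] that by simp
      ultimately show ?thesis using c[of "2 * (i + 2)" "h + 2 + i"] that False by simp
    qed
    have low: "conn ?E (Pos 0) (Pos i)" if "i < h" for i
      using that
    proof (induction i)
      case (Suc i)
      then show ?case using conn_trans[OF _ conn_trans[OF 1 2]] by simp
    qed simp
    have "conn ?E (Pos (h - 1)) (Pos (h + 1))"
      using c[of 1 "h - 1"] X assms by (simp add: numeral_2_eq_2)
    then have a: "conn ?E (Pos 0) (Pos (h + 1))" using conn_trans[OF low[of "h - 1"]] assms by simp
    have "conn ?E (Pos (h + 1)) (Pos h)"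
      using c[of 2 "h + 1"] X assms by (simp add: numeral_2_eq_2 numeral_3_eq_3)
    then have b: "conn ?E (Pos 0) (Pos h)" using conn_trans[OF a] by simp
    fix x assume "x \<le> 2 * h"
    then consider "x < h" | "x = h" | "x = h + 1" | i where "x = h + 2 + i" "Suc i < h"
    proof -
      have "x = h + 2 + (x - (h + 2)) \<and> Suc (x - (h + 2)) < h" if "h + 2 \<le> x"
        using that \<open>x \<le> 2 * h\<close> assms by (simp, arith)
      moreover have "x < h \<or> x = h \<or> x = h + 1 \<or> h + 2 \<le> x" by arith
      ultimately show ?thesis using that by blast
    qed
    then show "conn ?E (Pos 0) (Pos x)"
    proof cases
      case (4 i)
      then show ?thesis using conn_trans[OF low 1, of i] by simp
    qed (use low a b in auto)
  qed
  with step vl handle that v show thesis by simp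
qed


lemma handles_1: "handles j (Suc 0) = [j + 2, j + 1]"
  by (simp add: handles_Suc)

text \<open>The reversed triple lets a handle split off. The rest is then slid to its normal form,
  either handles only or a shorter exceptional word; the latter is followed by at least the handle
  just split off, so that the hypothesis gives both directions.\<close>

lemma reach_special_aux:
  assumes v: "vlist (2 * h) (0 # r)" and k: "list_comps (2 * h) (0 # r) = 1"
    and hd: "handle_at (2 * h) x (0 # r)" "x \<le> 2 * h" and h: "1 \<le> h"
    and IH: "\<And>h' g. h' < h \<Longrightarrow> 2 \<le> h' \<Longrightarrow> 1 \<le> g \<Longrightarrow>
      reach (2 * h' + 2 * g) (special h' @ handles (2 * h') g) (0 # handles 0 (h' + g)) \<and>
      reach (2 * h' + 2 * g) (0 # handles 0 (h' + g)) (special h' @ handles (2 * h') g)"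
  shows "reach (2 * h + 2 * g) (0 # r @ handles (2 * h) g) (0 # handles 0 (h + g)) \<and>
    reach (2 * h + 2 * g) (0 # handles 0 (h + g)) (0 # r @ handles (2 * h) g)"
proof -
  define m where "m = 2 * h - 2"
  have m: "2 * h = m + 2" "m = 2 * (h - 1)" using h by (auto simp: m_def)
  obtain s where "slide (2 * h) (0 # r) (0 # s @ [2 * h, 2 * h - 1])"
    using handle_extract[OF v hd] h by auto
  then have s: "slide (2 * h) (0 # r) (0 # s @ [m + 2, m + 1])" using m by simp
  have vs2: "vlist (m + 2) (0 # s @ [m + 2, m + 1])" using slide_vlist[OF s] v m by simp
  then have vs: "vlist m (0 # s)" by (rule vlist_remove_handle)
  have "list_comps m (0 # s) = list_comps (m + 2) (0 # s @ [m + 2, m + 1])"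
    using list_comps_handles[OF vs, of 1] by (simp add: handles_1)
  also have "\<dots> = 1" using list_comps_slide[OF v s] k m by simp
  finally have ks: "list_comps m (0 # s) = 1" .
  have start: "slide (2 * h + 2 * g) (0 # r @ handles (2 * h) g) (0 # s @ handles m (Suc g))"
  proof -
    have "handles m (Suc g) = [m + 2, m + 1] @ handles (2 * h) g"
      using handles_add[of m 1 g] m by (simp add: handles_1)
    then show ?thesis using slide_handles[OF v s, of g] by simp
  qed
  have n: "2 * h + 2 * g = m + 2 * Suc g" using m by simp
  have ext: "slide (2 * h + 2 * g) (0 # r @ handles (2 * h) g) (0 # s' @ handles m (Suc g))"
    if "slide m (0 # s) (0 # s')" for s'
    using slide.trans[OF start] slide_handles[OF vs that, of "Suc g"] unfolding n by simp
  from slide_canonical[OF vs] show ?thesis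
  proof (elim disjE exE conjE)
    fix j g' assume j: "m = j + 2 * g'" "slide m (0 # s) ([0..<j + 1] @ handles j g')"
    \<comment> \<open>Having a single component forces \<open>j = 0\<close>, so the normal form
      consists of handles only.\<close>
    have "Suc j = 1" using list_comps_slide[OF vs j(2)] ks list_comps_canonical[of j g'] j(1) by simp
    then have "j = 0" by simp
    then have g': "g' = h - 1" using j(1) m by simp
    have "slide m (0 # s) (0 # handles 0 (h - 1))" using j(2) \<open>j = 0\<close> g' by simp
    from ext[OF this]
    have "slide (2 * h + 2 * g) (0 # r @ handles (2 * h) g) (0 # handles 0 (h - 1 + Suc g))"
      unfolding handles_add using m by simp
    moreover have "h - 1 + Suc g = h + g" using h by simp
    ultimately show ?thesis using reach_slide slide.sym by metis
  next
    fix h' g' assume h': "2 \<le> h'" "m = 2 * h' + 2 * g'" "slide m (0 # s) (special h' @ handles (2 * h') g')"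
    obtain t where t: "special h' = 0 # t" using special_Cons[of h'] h' by auto
    have "slide m (0 # s) (0 # t @ handles (2 * h') g')" using h'(3) t by simp
    from ext[OF this]
    have "slide (2 * h + 2 * g) (0 # r @ handles (2 * h) g) (special h' @ handles (2 * h') (g' + Suc g))"
      unfolding handles_add using h'(2) t by simp
    note sl = reach_slide[OF this] reach_slide[OF slide.sym[OF this]]
    have eq: "2 * h + 2 * g = 2 * h' + 2 * (g' + Suc g)" "h' + (g' + Suc g) = h + g" "h' < h"
      using h' m by simp_all
    have "reach (2 * h + 2 * g) (special h' @ handles (2 * h') (g' + Suc g)) (0 # handles 0 (h + g)) \<and>
      reach (2 * h + 2 * g) (0 # handles 0 (h + g)) (special h' @ handles (2 * h') (g' + Suc g))"
      using IH[OF eq(3) h'(1), of "g' + Suc g"] unfolding eq by simp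
    then show ?thesis using sl reach_trans by blast
  qed
qed

text \<open>
  Cyclic operations cannot be undone directly. The way back from three handles to the exceptional word
  for \<open>n = 4\<close> with one handle was found by a computer search; larger exceptional words followed by a
  handle are dealt with by the slides of \<open>slide_special\<close>.
\<close>

lemma slide_6_1: "slide 6 [0,2,1,4,3,6,5] [0,5,1,4,2,6,3]"
proof -
  have "slide 6 [0,2,1,4,3,6,5] [0,2,1,4,6,5,3]"
    using slide_block1[of 5 6 "[0,2,1,4]" "[3]" "[]" "[]"] by (simp add: nx_def)
  also have "slide 6 \<dots> [0,2,5,1,4,6,3]"
    using slide_block2[of 2 6 "[0]" "[1,4,6]" "[5]" "[]"] by (simp add: nx_def)
  also have "slide 6 \<dots> [0,5,1,4,2,6,3]"
    using slide_block1[of 4 6 "[0]" "[2]" "[1]" "[6,3]"] by (simp add: nx_def)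
  finally show ?thesis .
qed

lemma slide_6_2: "slide 6 [0,5,1,4,3,6,2] [0,3,1,4,2,6,5]"
proof -
  have "slide 6 [0,5,1,4,3,6,2] [0,5,3,1,4,6,2]"
    using slide_block2[of 5 6 "[0]" "[1,4]" "[3]" "[2]"] by (simp add: nx_def)
  also have "slide 6 \<dots> [0,3,1,4,6,2,5]"
    using slide_block1[of 2 6 "[0]" "[5]" "[1,4,6]" "[]"] by (simp add: nx_def)
  also have "slide 6 \<dots> [0,3,1,4,2,6,5]"
    using slide_block2[of 4 6 "[0,3,1]" "[6]" "[2]" "[]"] by (simp add: nx_def)
  finally show ?thesis .
qed

lemma reach_special_2:
  "reach (6 + 2 * g) (0 # handles 0 (3 + g)) (special 2 @ handles 4 (1 + g))"
proof -
  have v: "vlist 6 [0,2,1,4,3,6,5]" "vlist 6 [0,5,1,4,3,6,2]"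
    by (auto simp: vlist_def atMost_Suc numeral_eq_Suc)
  have "handles 0 3 = [2,1,4,3,6,5]" "handles 4 1 = [6,5]" "special 2 = [0,3,1,4,2]"
    by (simp_all add: handles_def special_def upt_rec numeral_eq_Suc)
  then have eq: "0 # handles 0 (3 + g) = 0 # [2,1,4,3,6,5] @ handles 6 g"
    "special 2 @ handles 4 (1 + g) = 0 # [3,1,4,2,6,5] @ handles 6 g"
    unfolding handles_add by simp_all
  have "reach (6 + 2 * g) (0 # [2,1,4,3,6,5] @ handles 6 g) (0 # [5,1,4,2,6,3] @ handles 6 g)"
    by (intro reach_slide slide_handles) (use v slide_6_1 in simp_all)
  also have "reach (6 + 2 * g) \<dots> (0 # [5,1,4,3,6,2] @ handles 6 g)"
  proof -
    \<comment> \<open>The factor 1 4 2 permits \<open>p = 1\<close> and \<open>q = 4\<close>, and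
      this shift merely exchanges 2 and 3.\<close>
    have "cyc_step 6 (0 # [5,1,4,2,6,3]) (0 # [5,1,4,3,6,2])"
      unfolding cyc_step_def
      by (intro exI[of _ 1] exI[of _ 4] exI[of _ "[0,5]"] exI[of _ "[6,3]"]) (simp add: shift_def)
    from reach_cyc_step[OF cyc_step_handles[OF this, of g]] show ?thesis by simp
  qed
  also have "reach (6 + 2 * g) \<dots> (0 # [3,1,4,2,6,5] @ handles 6 g)"
    by (intro reach_slide slide_handles) (use v slide_6_2 in simp_all)
  finally show ?thesis unfolding eq .
qed

text \<open>Forwards, one cyclic step creates a reversed triple. Backwards, a handle is required:
  for \<open>h = 2\<close> the path was searched for, and for larger \<open>h\<close> the word of
  \<open>slide_special\<close> is slide equivalent to the target and already has a triple.\<close>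

lemma reach_special:
  assumes "2 \<le> h"
  shows "reach (2 * h + 2 * g) (special h @ handles (2 * h) g) (0 # handles 0 (h + g)) \<and>
    (1 \<le> g \<longrightarrow> reach (2 * h + 2 * g) (0 # handles 0 (h + g)) (special h @ handles (2 * h) g))"
  using assms
proof (induction h arbitrary: g rule: less_induct)
  case (less h)
  have IH: "reach (2 * h' + 2 * g) (special h' @ handles (2 * h') g) (0 # handles 0 (h' + g)) \<and>
      reach (2 * h' + 2 * g) (0 # handles 0 (h' + g)) (special h' @ handles (2 * h') g)"
    if "h' < h" "2 \<le> h'" "1 \<le> g" for h' g using less.IH that by blast
  obtain t where t: "special h = 0 # t" using special_Cons[of h] less.prems by auto
  obtain r where r: "cyc_step (2 * h) (special h) (0 # r)" "vlist (2 * h) (0 # r)"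
    "handle_at (2 * h) h (0 # r)" "list_comps (2 * h) (0 # r) = 1"
    using cyc_step_special[OF less.prems] by metis
  have "cyc_step (2 * h + 2 * g) (special h @ handles (2 * h) g) (0 # r @ handles (2 * h) g)"
    using cyc_step_handles[of "2 * h" t "0 # r" g] r(1) t by simp
  from reach_cyc_step[OF this]
  have forward: "reach (2 * h + 2 * g) (special h @ handles (2 * h) g) (0 # handles 0 (h + g))"
    using reach_special_aux[OF r(2,4,3) _ _ IH, of g] less.prems reach_trans by simp
  moreover have "reach (2 * h + 2 * g) (0 # handles 0 (h + g)) (special h @ handles (2 * h) g)"
    if g: "1 \<le> g"
  proof (cases "h = 2")
    case True
    obtain g' where g': "g = 1 + g'" using g le_Suc_ex by blast
    have R: "reach a (0 # handles 0 b) (special 2 @ handles c g)"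
      if "a = 6 + 2 * g'" "b = 3 + g'" "c = 4" for a b c
      using reach_special_2[of g'] unfolding that g' .
    show ?thesis using R[of "2 * h + 2 * g" "h + g" "2 * h"] True g' by simp
  next
    case False
    then obtain s where s: "slide (2 * h + 2) (special h @ [2 * h + 2, 2 * h + 1]) (0 # s @ [2 * h + 2, 2 * h + 1])"
      "vlist (2 * h) (0 # s)" "handle_at (2 * h) (h + 1) (0 # s)"
      using slide_special[of h] less.prems by auto
    have vt: "vlist (2 * h) (0 # t)" using vlist_special[of h] t by simp
    have vt2: "vlist (2 * h + 2) (0 # t @ [2 * h + 2, 2 * h + 1])"
      using vlist_handles[OF vt, of 1] by (simp add: handles_1)
    \<comment> \<open>The count for the lower part is computed by attaching the handle, sliding back
      and removing it.\<close>
    have "list_comps (2 * h) (0 # s) = list_comps (2 * h + 2) (0 # s @ [2 * h + 2, 2 * h + 1])"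
      using list_comps_handles[OF s(2), of 1] by (simp add: handles_1)
    also have "\<dots> = list_comps (2 * h + 2) (0 # t @ [2 * h + 2, 2 * h + 1])"
      using list_comps_slide[OF vt2] s(1) t by simp
    also have "\<dots> = list_comps (2 * h) (0 # t)"
      using list_comps_handles[OF vt, of 1] by (simp add: handles_1)
    also have "\<dots> = 1" using list_comps_special[of h] t less.prems by simp
    finally have ks: "list_comps (2 * h) (0 # s) = 1" .
    obtain g' where g': "g = Suc g'" using g by (cases g) auto
    have sp: "handles (2 * h) g = [2 * h + 2, 2 * h + 1] @ handles (2 * h + 2) g'"
      using handles_add[of "2 * h" 1 g'] by (simp add: g' handles_1)
    have "slide (2 * h + 2 + 2 * g') (0 # (t @ [2 * h + 2, 2 * h + 1]) @ handles (2 * h + 2) g')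
        (0 # (s @ [2 * h + 2, 2 * h + 1]) @ handles (2 * h + 2) g')"
      by (rule slide_handles) (use vt2 s(1) t in simp_all)
    then have "slide (2 * h + 2 * g) (0 # s @ handles (2 * h) g) (special h @ handles (2 * h) g)"
      using sp t g' by (simp add: slide.sym)
    from reach_slide[OF this] have "reach (2 * h + 2 * g) (0 # s @ handles (2 * h) g) (special h @ handles (2 * h) g)" .
    moreover have "reach (2 * h + 2 * g) (0 # handles 0 (h + g)) (0 # s @ handles (2 * h) g)"
      using reach_special_aux[OF s(2) ks s(3) _ _ IH, of g] less.prems by simp
    ultimately show ?thesis using reach_trans by blast
  qed
  ultimately show ?case by blast
qed

lemma list_comps_special_handles:
  assumes "1 \<le> h" shows "list_comps (2 * h + 2 * g) (special h @ handles (2 * h) g) = 1"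
proof -
  obtain t where t: "special h = 0 # t" using special_Cons[OF assms] by auto
  then show ?thesis
    using list_comps_handles[of "2 * h" t g] vlist_special[of h] list_comps_special[OF assms] by simp
qed

text \<open>Exceptional words, with or without handles, have one cycle; so only the first normal
  form remains, and n and the count determine \<open>j\<close> and \<open>g\<close>.\<close>

lemma slide_of_list_comps:
  assumes "vlist n l" "vlist n l'" "list_comps n l = list_comps n l'" "2 \<le> list_comps n l"
  shows "slide n l l'"
proof -
  have "\<exists>j g. n = j + 2 * g \<and> Suc j = list_comps n l \<and> slide n l ([0..<j + 1] @ handles j g)"
    if v: "vlist n l" and k: "2 \<le> list_comps n l" for l
    using slide_canonical[OF v]
  proof (elim disjE exE conjE)
    fix j g assume "n = j + 2 * g" "slide n l ([0..<j + 1] @ handles j g)"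
    then show ?thesis using list_comps_slide[OF v] list_comps_canonical[of j g] by (metis)
  next
    fix h g assume "2 \<le> h" "n = 2 * h + 2 * g" "slide n l (special h @ handles (2 * h) g)"
    then show ?thesis using list_comps_slide[OF v] list_comps_special_handles[of h g] k by auto
  qed
  from this[OF assms(1,4)] this[OF assms(2)] assms(3,4) obtain j g j' g'
    where j: "n = j + 2 * g" "Suc j = list_comps n l" "slide n l ([0..<j + 1] @ handles j g)"
      "n = j' + 2 * g'" "Suc j' = list_comps n l'" "slide n l' ([0..<j' + 1] @ handles j' g')" by metis
  then have "j' = j" "g' = g" using assms(3) by simp_all
  then show ?thesis using j slide.trans slide.sym by metis
qed

text \<open>A one-cycle word is linked in both directions with the word of handles, or it is slide
  equivalent to \<open>special h\<close> with \<open>n = 2 * h\<close> and only reaches the word of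
  handles. Two words of the second kind share the same \<open>h\<close>.\<close>

lemma reach_of_list_comps:
  assumes "vlist n l" "vlist n l'" "list_comps n l = list_comps n l'" "1 \<le> list_comps n l"
  shows "reach n l l' \<or> reach n l' l"
proof (cases "2 \<le> list_comps n l")
  case True
  then show ?thesis using slide_of_list_comps assms reach_slide by blast
next
  case False
  then have k: "list_comps n l = 1" using assms(4) by simp
  have *: "(\<exists>G. n = 2 * G \<and> reach n l (0 # handles 0 G) \<and> reach n (0 # handles 0 G) l) \<or>
      (\<exists>h. 2 \<le> h \<and> n = 2 * h \<and> slide n l (special h) \<and> reach n l (0 # handles 0 h))"
    if v: "vlist n l" and k: "list_comps n l = 1" for l
    using slide_canonical[OF v]
  proof (elim disjE exE conjE)
    fix j g assume j: "n = j + 2 * g" "slide n l ([0..<j + 1] @ handles j g)"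
    then have "Suc j = 1" using list_comps_slide[OF v] list_comps_canonical[of j g] k by metis
    then have "n = 2 * g" "slide n l (0 # handles 0 g)" using j by simp_all
    then show ?thesis using reach_slide slide.sym by blast
  next
    fix h g assume h: "2 \<le> h" "n = 2 * h + 2 * g" "slide n l (special h @ handles (2 * h) g)"
    note sl = reach_slide[OF h(3)] reach_slide[OF slide.sym[OF h(3)]]
    have R: "reach n (special h @ handles (2 * h) g) (0 # handles 0 (h + g)) \<and>
      (1 \<le> g \<longrightarrow> reach n (0 # handles 0 (h + g)) (special h @ handles (2 * h) g))"
      using reach_special[OF h(1), of g] h(2) by simp
    show ?thesis
    proof (cases "1 \<le> g")
      case True
      then have "reach n l (0 # handles 0 (h + g)) \<and> reach n (0 # handles 0 (h + g)) l"
        using R sl reach_trans by blast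
      moreover have "n = 2 * (h + g)" using h by simp
      ultimately show ?thesis by blast
    next
      case False
      then have "g = 0" by simp
      then show ?thesis using h R sl reach_trans[OF sl(1), of "0 # handles 0 (h + g)"] by auto
    qed
  qed
  have G: "G = G'" if "n = 2 * G" "n = 2 * G'" for G G' using that by simp
  from *[OF assms(1) k] *[OF assms(2)] k assms(3) show ?thesis
    using G reach_trans reach_slide slide.trans slide.sym by (metis (no_types, lifting))
qed

section \<open>Reduction of nonorientable words\<close>

lemma eqv_move_block:
  assumes "j \<le> n"
  shows "eqv n (y @ nxt n (Pos j) # u @ Pos j # v) (nxt n (Pos j) # u @ Pos j # y @ v)"
proof (induction y arbitrary: v rule: rev_induct)
  case (snoc a y)
  let ?N = "nxt n (Pos j)"
  have "eqv n ((y @ [a]) @ ?N # u @ Pos j # v) (a # ?N # u @ Pos j # v @ y)"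
    using eqv.rotate[of n y "a # ?N # u @ Pos j # v"] by simp
  also have "eqv n \<dots> (?N # u @ Pos j # a # v @ y)" by (rule eqv.move[OF assms])
  also have "eqv n \<dots> (y @ ?N # u @ Pos j # a # v)"
    using eqv.rotate[of n "?N # u @ Pos j # a # v" y] by simp
  also have "eqv n \<dots> (?N # u @ Pos j # y @ a # v)" by (rule snoc)
  finally show ?case by simp
qed (auto intro: eqv.refl)

lemma eqv_flip_block:
  assumes "j \<le> n"
  shows "eqv n (y @ nxt n (Pos j) # u @ Neg j # v) (nxt n (Pos j) # u @ winv y @ Neg j # v)"
proof (induction y arbitrary: u rule: rev_induct)
  case (snoc a y)
  let ?N = "nxt n (Pos j)"
  have "eqv n ((y @ [a]) @ ?N # u @ Neg j # v) (a # ?N # u @ Neg j # v @ y)"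
    using eqv.rotate[of n y "a # ?N # u @ Neg j # v"] by simp
  also have "eqv n \<dots> (?N # u @ neg a # Neg j # v @ y)" by (rule eqv.flip[OF assms])
  also have "eqv n \<dots> (y @ ?N # (u @ [neg a]) @ Neg j # v)"
    using eqv.rotate[of n "?N # u @ neg a # Neg j # v" y] by simp
  also have "eqv n \<dots> (?N # (u @ [neg a]) @ winv y @ Neg j # v)" by (rule snoc)
  finally show ?case by simp
qed (auto intro: eqv.refl)

lemma eqv_winvI: "eqv n (winv w) (winv w') \<Longrightarrow> eqv n w w'"
  by (metis eqv.sym eqv.trans eqv.winv)

text \<open>Block forms for the sign patterns of \<open>j\<close> and its successor: those numbered
  1 and 2 differ in which of the two letters comes first, the others follow by inversion. The
  successor is a parameter \<open>N\<close> so that explicit labels can be substituted for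
  it.\<close>

context
  fixes n j :: nat and N :: signed_nat
  assumes j: "j \<le> n" and N: "N = nxt n (Pos j)"
begin

lemma eqv_move1: "eqv n (a @ y @ N # u @ Pos j # v) (a @ N # u @ Pos j # y @ v)"
proof -
  have "eqv n (y @ N # u @ Pos j # (v @ a)) (N # u @ Pos j # y @ (v @ a))"
    unfolding N by (rule eqv_move_block[OF j])
  from eqv.trans[OF eqv.rotate[of n a "y @ N # u @ Pos j # v"] eqv.trans[OF _ eqv.rotate[of n "N # u @ Pos j # y @ v" a]]] this
  show ?thesis by simp
qed

lemma eqv_flip1: "eqv n (a @ y @ N # u @ Neg j # v) (a @ N # u @ winv y @ Neg j # v)"
proof -
  have "eqv n (y @ N # u @ Neg j # (v @ a)) (N # u @ winv y @ Neg j # (v @ a))"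
    unfolding N by (rule eqv_flip_block[OF j])
  from eqv.trans[OF eqv.rotate[of n a "y @ N # u @ Neg j # v"] eqv.trans[OF _ eqv.rotate[of n "N # u @ winv y @ Neg j # v" a]]] this
  show ?thesis by simp
qed

lemma eqv_move2: "eqv n (a @ Pos j # u @ y @ N # v) (a @ Pos j # y @ u @ N # v)"
proof -
  have "eqv n ((a @ Pos j # u) @ y @ N # v) ((y @ N # v) @ a @ Pos j # u)" by (rule eqv.rotate)
  also have "eqv n \<dots> (N # (v @ a) @ Pos j # y @ u)"
    using eqv_move1[of "[]" y "v @ a" u] by simp
  also have "eqv n \<dots> (a @ Pos j # y @ u @ N # v)"
    using eqv.rotate[of n "N # v" "a @ Pos j # y @ u"] by simp
  finally show ?thesis by simp
qed

lemma eqv_flip2: "eqv n (a @ Neg j # u @ y @ N # v) (a @ winv y @ Neg j # u @ N # v)"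
proof -
  have "eqv n ((a @ Neg j # u) @ y @ N # v) ((y @ N # v) @ a @ Neg j # u)" by (rule eqv.rotate)
  also have "eqv n \<dots> (N # (v @ a) @ winv y @ Neg j # u)"
    using eqv_flip1[of "[]" y "v @ a" u] by simp
  also have "eqv n \<dots> (a @ winv y @ Neg j # u @ N # v)"
    using eqv.rotate[of n "N # v" "a @ winv y @ Neg j # u"] by simp
  finally show ?thesis by simp
qed

lemma eqv_flip3: "eqv n (a @ neg N # y @ u @ Pos j # v) (a @ neg N # u @ Pos j # winv y @ v)"
  by (rule eqv_winvI) (use eqv_flip2[of "winv v" "winv u" "winv y" "winv a"] in simp)

lemma eqv_flip4: "eqv n (a @ Pos j # y @ u @ neg N # v) (a @ Pos j # u @ neg N # winv y @ v)"
  by (rule eqv_winvI) (use eqv.sym[OF eqv_flip1[of "winv v" y "winv u" "winv a"]] in simp)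

lemma eqv_move3: "eqv n (a @ neg N # y @ u @ Neg j # v) (a @ neg N # u @ y @ Neg j # v)"
  by (rule eqv_winvI) (use eqv_move2[of "winv v" "winv u" "winv y" "winv a"] in simp)

end

text \<open>As for handles, slides lift along a letter \<open>\<plusminus>(n + 1)\<close> inserted in front of 0.\<close>

definition subst0 :: "signed_nat list \<Rightarrow> signed_nat list \<Rightarrow> signed_nat list" where
  "subst0 s w = concat (map (\<lambda>x. if x = Pos 0 then s else if x = Neg 0 then winv s else [x]) w)"

lemma subst0_simps [simp]:
  "subst0 s [] = []" "subst0 s (u @ v) = subst0 s u @ subst0 s v"
  "subst0 s (x # u) = (if x = Pos 0 then s else if x = Neg 0 then winv s else [x]) @ subst0 s u"
  by (auto simp: subst0_def)

lemma subst0_neg: "subst0 s [neg x] = winv (subst0 s [x])"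
  by (cases x) auto

lemma subst0_winv: "subst0 s (winv w) = winv (subst0 s w)"
proof (induction w)
  case (Cons x w)
  then show ?case using subst0_neg[of s x] by simp
qed simp

lemma subst0_id: "Pos 0 \<notin> set w \<Longrightarrow> Neg 0 \<notin> set w \<Longrightarrow> subst0 s w = w"
  by (induction w) auto

text \<open>Only for \<open>j = n\<close> does the pair j, j + 1 change, since the inserted label
  comes between n and 0. The assumptions on \<open>s\<close> are what moves and flips along that
  pair turn into; all other pairs stay consecutive.\<close>

lemma eqv_subst0:
  assumes "1 \<le> n" and s: "s = [e, Pos 0]"
    and move: "\<And>y u v. eqv (Suc n) (y @ s @ u @ Pos n # v) (s @ u @ Pos n # y @ v)"
    and flip: "\<And>y u v. eqv (Suc n) (y @ s @ u @ Neg n # v) (s @ u @ winv y @ Neg n # v)"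
  shows "eqv n w w' \<Longrightarrow> eqv (Suc n) (subst0 s w) (subst0 s w')"
proof (induction rule: eqv.induct)
  case (move j y u v)
  let ?y = "subst0 s [y]"
  have y: "subst0 s (y # z) = ?y @ subst0 s z" for z by simp
  show ?case
  proof (cases "j = n")
    case True
    then show ?thesis
      using assms(3)[of ?y "subst0 s u" "subst0 s v"] \<open>1 \<le> n\<close> by simp
  next
    case False
    then have j: "j \<le> Suc n" "nxt n (Pos j) = Pos (Suc j)" "nxt (Suc n) (Pos j) = Pos (Suc j)"
      using move by auto
    \<comment> \<open>For \<open>j = 0\<close> the inserted letter stands before +0 and joins the
      stretch \<open>u\<close>.\<close>
    obtain t where t: "subst0 s [Pos j] = t @ [Pos j]" by (cases "j = 0") (auto simp: s)
    have tv: "subst0 s (Pos j # z) = t @ Pos j # subst0 s z" for z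
      using t by (simp split: if_splits)
    have cs: "subst0 s (Pos (Suc j) # z) = Pos (Suc j) # subst0 s z" for z by simp
    have "eqv (Suc n) (?y @ Pos (Suc j) # (subst0 s u @ t) @ Pos j # subst0 s v)
        (Pos (Suc j) # (subst0 s u @ t) @ Pos j # ?y @ subst0 s v)"
      using eqv_move_block[OF j(1)] unfolding j(3) .
    moreover have "subst0 s (y # Pos (Suc j) # u @ Pos j # v) =
        ?y @ Pos (Suc j) # (subst0 s u @ t) @ Pos j # subst0 s v"
      by (simp only: subst0_simps(2) cs tv y[of "Pos (Suc j) # u @ Pos j # v"] append.simps append_assoc)
    moreover have "subst0 s (Pos (Suc j) # u @ Pos j # y # v) =
        Pos (Suc j) # (subst0 s u @ t) @ Pos j # ?y @ subst0 s v"
      by (simp only: subst0_simps(2) cs tv y[of v] append.simps append_assoc)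
    ultimately show ?thesis unfolding j(2) by (simp only:)
  qed
next
  case (flip j y u v)
  let ?y = "subst0 s [y]"
  have y: "subst0 s (y # z) = ?y @ subst0 s z" "subst0 s (neg y # z) = winv ?y @ subst0 s z" for z
    using subst0_neg[of s y] by simp_all
  show ?case
  proof (cases "j = n")
    case True
    have "subst0 s (u @ neg y # Neg n # v) = subst0 s u @ winv ?y @ Neg n # subst0 s v"
      using y(2)[of "Neg n # v"] \<open>1 \<le> n\<close> by simp
    then show ?thesis
      using assms(4)[of ?y "subst0 s u" "subst0 s v"] \<open>1 \<le> n\<close> True by simp
  next
    case False
    then have j: "j \<le> Suc n" "nxt n (Pos j) = Pos (Suc j)" "nxt (Suc n) (Pos j) = Pos (Suc j)"
      using flip by auto
    \<comment> \<open>For \<open>j = 0\<close> the inverse of \<open>s\<close> puts the inserted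
      letter behind -0, so it joins \<open>v\<close>.\<close>
    obtain t where t: "subst0 s [Neg j] = Neg j # t" by (cases "j = 0") (auto simp: s)
    have tv: "subst0 s (Neg j # z) = Neg j # t @ subst0 s z" for z
      using t by (simp split: if_splits)
    have cs: "subst0 s (Pos (Suc j) # z) = Pos (Suc j) # subst0 s z" for z by simp
    have "eqv (Suc n) (?y @ Pos (Suc j) # subst0 s u @ Neg j # t @ subst0 s v)
        (Pos (Suc j) # subst0 s u @ winv ?y @ Neg j # t @ subst0 s v)"
      using eqv_flip_block[OF j(1)] unfolding j(3) .
    moreover have "subst0 s (y # Pos (Suc j) # u @ Neg j # v) =
        ?y @ Pos (Suc j) # subst0 s u @ Neg j # t @ subst0 s v"
      by (simp only: subst0_simps(2) cs tv y(1)[of "Pos (Suc j) # u @ Neg j # v"] append.simps append_assoc)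
    moreover have "subst0 s (Pos (Suc j) # u @ neg y # Neg j # v) =
        Pos (Suc j) # subst0 s u @ winv ?y @ Neg j # t @ subst0 s v"
      by (simp only: subst0_simps(2) cs tv y(2)[of "Neg j # v"] append.simps append_assoc)
    ultimately show ?thesis unfolding j(2) by (simp only:)
  qed
next
  case (winv w)
  then show ?case unfolding subst0_winv by (rule eqv.winv)
qed (auto intro: eqv.refl eqv.sym eqv.trans eqv.rotate)

text \<open>For e = +(n + 1) the pair n, n + 1 does all the work. For e = -(n + 1) a block first
  crosses e by a flip along n + 1 and 0, becoming inverted, and then goes to n: another flip if n is
  positive, which cancels the inversion, and a plain move if n is negative.\<close>

lemma eqv_append_last:
  assumes "valid n (Pos 0 # r)" "eqv n (Pos 0 # r) (Pos 0 # r')" "1 \<le> n"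
    and e: "e = Pos (Suc n) \<or> e = Neg (Suc n)"
  shows "eqv (Suc n) (Pos 0 # r @ [e]) (Pos 0 # r' @ [e])"
proof -
  have nx: "Pos (Suc n) = nxt (Suc n) (Pos n)" "Pos 0 = nxt (Suc n) (Pos (Suc n))" by simp_all
  have le: "n \<le> Suc n" "Suc n \<le> Suc n" by simp_all
  have 1: "eqv (Suc n) (y @ [e, Pos 0] @ u @ Pos n # v) ([e, Pos 0] @ u @ Pos n # y @ v) \<and>
      eqv (Suc n) (y @ [e, Pos 0] @ u @ Neg n # v) ([e, Pos 0] @ u @ winv y @ Neg n # v)" for y u v
  proof (cases "e = Pos (Suc n)")
    case True
    then show ?thesis
      using eqv_move1[OF le(1) nx(1), of "[]" y "Pos 0 # u" v]
        eqv_flip1[OF le(1) nx(1), of "[]" y "Pos 0 # u" v] by simp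
  next
    case False
    then have e: "e = Neg (Suc n)" using e by simp
    have a: "eqv (Suc n) (y @ Neg (Suc n) # Pos 0 # z) (Neg (Suc n) # winv y @ Pos 0 # z)" for z
      using eqv.sym[OF eqv_flip2[OF le(2) nx(2), of "[]" "[]" "winv y" z]] by simp
    have "eqv (Suc n) (Neg (Suc n) # winv y @ Pos 0 # u @ Pos n # v)
        (Neg (Suc n) # Pos 0 # u @ Pos n # y @ v)"
      using eqv_flip3[OF le(1) nx(1), of "[]" "winv y" "Pos 0 # u" v] by simp
    moreover have "eqv (Suc n) (Neg (Suc n) # winv y @ Pos 0 # u @ Neg n # v)
        (Neg (Suc n) # Pos 0 # u @ winv y @ Neg n # v)"
      using eqv_move3[OF le(1) nx(1), of "[]" "winv y" "Pos 0 # u" v] by simp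
    ultimately show ?thesis
      using eqv.trans[OF a] unfolding e by simp
  qed
  have "eqv (Suc n) (subst0 [e, Pos 0] (Pos 0 # r)) (subst0 [e, Pos 0] (Pos 0 # r'))"
    by (rule eqv_subst0[OF assms(3) HOL.refl _ _ assms(2)]) (use 1 in blast)+
  moreover have "valid n (Pos 0 # r')" using eqv_valid[OF assms(2)] assms(1) by simp
  ultimately have "eqv (Suc n) (e # Pos 0 # r) (e # Pos 0 # r')"
    using subst0_id valid_Cons_0 assms(1) by simp
  then show ?thesis
    using eqv.rotate[of "Suc n" "[e]" "Pos 0 # r"] eqv.rotate[of "Suc n" "[e]" "Pos 0 # r'"]
    by (metis append_Cons append_Nil eqv.sym eqv.trans)
qed

section \<open>The crosscap normal form\<close>

definition crosscaps :: "nat \<Rightarrow> nat \<Rightarrow> signed_nat list" where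
  "crosscaps n m = Pos 0 # map Neg [1..<m + 1] @ map Pos [m + 1..<n + 1]"

lemma valid_crosscaps: "m \<le> n \<Longrightarrow> valid n (crosscaps n m)"
proof -
  assume m: "m \<le> n"
  have "map lab (crosscaps n m) = 0 # [1..<m + 1] @ [m + 1..<n + 1]"
    by (simp add: crosscaps_def o_def del: upt_Suc)
  also have "\<dots> = 0 # [1..<n + 1]" using upt_add_eq_append[of 1 "m + 1" "n - m"] m by simp
  also have "\<dots> = [0..<n + 1]" by (simp add: upt_conv_Cons del: upt_Suc)
  finally have "map lab (crosscaps n m) = [0..<n + 1]" .
  then show ?thesis unfolding valid_def set_map[symmetric] by (auto simp del: upt_Suc)
qed

lemma crosscaps_Suc: "m \<le> n \<Longrightarrow> crosscaps (Suc n) m = crosscaps n m @ [Pos (Suc n)]"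
  by (simp add: crosscaps_def)

lemma crosscaps_Suc_Suc: "crosscaps (Suc n) (Suc n) = crosscaps n n @ [Neg (Suc n)]"
  by (simp add: crosscaps_def)

lemma crosscaps_Cons: "\<exists>r. crosscaps n m = Pos 0 # r"
  by (simp add: crosscaps_def)

text \<open>Rotated to the front, -(n + 1) is separated from n by the stretch beginning with 0.
  Flipping this stretch to behind n and then inverting the whole word restores it and exchanges the
  signs of n and n + 1.\<close>

lemma eqv_swap_last:
  assumes "1 \<le> n"
  shows "eqv (Suc n) (Pos 0 # r @ [Pos n, Neg (Suc n)]) (Pos 0 # r @ [Neg n, Pos (Suc n)])"
proof -
  have nx: "Pos (Suc n) = nxt (Suc n) (Pos n)" and le: "n \<le> Suc n" by simp_all
  have "eqv (Suc n) (Pos 0 # r @ [Pos n, Neg (Suc n)]) (Neg (Suc n) # (Pos 0 # r) @ [] @ Pos n # [])"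
    using eqv.rotate[of "Suc n" "Pos 0 # r @ [Pos n]" "[Neg (Suc n)]"] by simp
  also have "eqv (Suc n) \<dots> (Neg (Suc n) # Pos n # winv (Pos 0 # r))"
    using eqv_flip3[OF le nx, of "[]" "Pos 0 # r" "[]" "[]"] by simp
  also have "eqv (Suc n) \<dots> (winv (Neg (Suc n) # Pos n # winv (Pos 0 # r)))" by (rule eqv.winv)
  also have "\<dots> = Pos 0 # r @ [Neg n, Pos (Suc n)]" by simp
  finally show ?thesis .
qed

text \<open>The minus sign travels down from n + 1 to m + 1 by \<open>eqv_swap_last\<close>, the
  positive letters above being carried along by \<open>eqv_append_last\<close>.\<close>

lemma eqv_crosscaps_append:
  assumes "m \<le> n"
  shows "eqv (Suc n) (crosscaps n m @ [Neg (Suc n)]) (crosscaps (Suc n) (Suc m))"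
  using assms
proof (induction n)
  case 0
  then show ?case by (simp add: crosscaps_Suc_Suc eqv.refl)
next
  case (Suc n)
  show ?case
  proof (cases "m = Suc n")
    case True
    then show ?thesis by (simp add: crosscaps_Suc_Suc eqv.refl)
  next
    case False
    then have m: "m \<le> n" using Suc.prems by simp
    obtain r where r: "crosscaps n m = Pos 0 # r" using crosscaps_Cons by blast
    obtain r' where r': "crosscaps (Suc n) (Suc m) = Pos 0 # r'" using crosscaps_Cons by blast
    have "crosscaps (Suc n) m @ [Neg (Suc (Suc n))] = Pos 0 # r @ [Pos (Suc n), Neg (Suc (Suc n))]"
      using m r by (simp add: crosscaps_Suc)
    also have "eqv (Suc (Suc n)) \<dots> (Pos 0 # r @ [Neg (Suc n), Pos (Suc (Suc n))])"
      by (rule eqv_swap_last) simp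
    also have "\<dots> = Pos 0 # (r @ [Neg (Suc n)]) @ [Pos (Suc (Suc n))]" by simp
    also have "eqv (Suc (Suc n)) \<dots> (Pos 0 # r' @ [Pos (Suc (Suc n))])"
    proof (rule eqv_append_last)
      show 1: "eqv (Suc n) (Pos 0 # r @ [Neg (Suc n)]) (Pos 0 # r')"
        using Suc.IH[OF m] r r' by simp
      show "valid (Suc n) (Pos 0 # r @ [Neg (Suc n)])"
        using eqv_valid[OF 1] valid_crosscaps[of "Suc m" "Suc n"] m r' by simp
    qed simp_all
    also have "\<dots> = crosscaps (Suc (Suc n)) (Suc m)" using crosscaps_Suc[of "Suc m" "Suc n"] m r' by simp
    finally show ?thesis .
  qed
qed

definition mixed :: "signed_nat list \<Rightarrow> bool" where
  "mixed w \<longleftrightarrow> (\<exists>i. Pos i \<in> set w) \<and> (\<exists>i. Neg i \<in> set w)"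

lemma mixed_winv [simp]: "mixed (winv w) \<longleftrightarrow> mixed w"
proof -
  have "Pos i \<in> neg ` A \<longleftrightarrow> Neg i \<in> A" "Neg i \<in> neg ` A \<longleftrightarrow> Pos i \<in> A" for i A
    by (metis image_iff neg.simps neg_neg)+
  then show ?thesis by (auto simp: mixed_def)
qed

text \<open>0 is the successor of n, so the block \<open>q\<close>, which cyclically precedes 0, can
  be flipped to the front of -n.\<close>

lemma eqv_crosscap_to_end: "eqv n (Pos 0 # p @ Neg n # q) (Pos 0 # (p @ winv q) @ [Neg n])"
proof -
  have "eqv n (Pos 0 # p @ Neg n # q) (q @ Pos 0 # p @ [Neg n])"
    using eqv.rotate[of n "Pos 0 # p @ [Neg n]" q] by simp
  also have "eqv n \<dots> (Pos 0 # (p @ winv q) @ [Neg n])"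
    using eqv_flip1[of n n "Pos 0" "[]" q p "[]"] by simp
  finally show ?thesis .
qed

lemma eqv_last_of_mem:
  assumes "valid n w" "1 \<le> n" "Pos 0 \<in> set w" "Neg n \<in> set w"
  shows "\<exists>r. eqv n w (Pos 0 # r @ [Neg n])"
proof -
  obtain a b where ab: "w = a @ Pos 0 # b" using assms(3) by (meson split_list)
  have "eqv n w (Pos 0 # b @ a)" using eqv.rotate[of n a "Pos 0 # b"] ab by simp
  moreover have "Neg n \<in> set (b @ a)" using assms(4) ab by auto
  ultimately obtain p q where pq: "eqv n w (Pos 0 # p @ Neg n # q)" by (metis split_list)
  also note eqv_crosscap_to_end
  finally show ?thesis by blast
qed

lemma eqv_last_of_signs:
  assumes "valid n w" "1 \<le> n"
    and "Pos 0 \<in> set w \<and> Neg n \<in> set w \<or> Neg 0 \<in> set w \<and> Pos n \<in> set w"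
  shows "\<exists>r. eqv n w (Pos 0 # r @ [Neg n])"
  using assms(3)
proof
  assume "Neg 0 \<in> set w \<and> Pos n \<in> set w"
  then have "Pos 0 \<in> set (winv w)" "Neg n \<in> set (winv w)" by force+
  then show ?thesis using eqv_last_of_mem[of n "winv w"] assms(1,2) eqv.winv eqv.trans valid_winv by meson
qed (use eqv_last_of_mem assms(1,2) in blast)

lemma valid_mem: "valid n w \<Longrightarrow> i \<le> n \<Longrightarrow> Pos i \<in> set w \<or> Neg i \<in> set w"
proof -
  assume "valid n w" "i \<le> n"
  then have "i \<in> lab ` set w" by (auto simp: valid_def)
  then obtain a where a: "a \<in> set w" "lab a = i" by auto
  have "a = Pos i \<or> a = Neg i" using a(2) by (cases a) auto
  then show ?thesis using a(1) by auto
qed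

lemma valid_not_both: "valid n w \<Longrightarrow> \<not> (Pos i \<in> set w \<and> Neg i \<in> set w)"
  unfolding valid_def distinct_map by (metis inj_onD lab.simps signed_nat.distinct(1))

text \<open>It suffices to reach a word in which 0 and n have opposite signs. If both are positive,
  two consecutive labels of opposite sign provide flips that invert a chosen block and with it
  exactly one of 0 and n.\<close>

lemma eqv_crosscap_last:
  assumes v: "valid n w" and "mixed w" and n: "1 \<le> n"
  shows "\<exists>r. eqv n w (Pos 0 # r @ [Neg n])"
proof -
  have main: "\<exists>r. eqv n w (Pos 0 # r @ [Neg n])" if v: "valid n w" and 0: "Pos 0 \<in> set w" and N: "\<exists>i. Neg i \<in> set w" for w
  proof (cases "Neg n \<in> set w")
    case False
    then have Pn: "Pos n \<in> set w" using valid_mem[OF v] by blast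
    \<comment> \<open>By minimality i - 1 is positive, so i - 1 and i are the required consecutive
      labels of opposite sign.\<close>
    define i where "i = (LEAST i. Neg i \<in> set w)"
    have i: "Neg i \<in> set w" unfolding i_def using N by (rule LeastI_ex)
    have "i \<noteq> 0" using i 0 valid_not_both[OF v] by metis
    then obtain k where k: "i = Suc k" by (cases i) auto
    have "lab (Neg i) \<in> lab ` set w" using i by blast
    then have "i \<le> n" using v by (simp add: valid_def)
    moreover have "i \<noteq> n" using i False by metis
    ultimately have kn: "Suc k < n" using k by simp
    have "Neg k \<notin> set w" using not_less_Least[of k "\<lambda>i. Neg i \<in> set w"] k unfolding i_def by simp
    then have Pk: "Pos k \<in> set w" using valid_mem[OF v, of k] kn by auto
    then obtain a b where ab: "w = a @ Pos k # b" by (meson split_list)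
    have r1: "eqv n w (Pos k # b @ a)" using eqv.rotate[of n a "Pos k # b"] ab by simp
    have "Neg (Suc k) \<in> set (b @ a)" using i k ab by auto
    then obtain y z where yz: "b @ a = y @ Neg (Suc k) # z" by (meson split_list)
    let ?W = "Pos k # y @ Neg (Suc k) # z"
    have W: "eqv n w ?W" using r1 yz by simp
    have setW: "set ?W = set w" unfolding yz[symmetric] using ab by auto
    have vW: "valid n ?W" using eqv_valid[OF W] v by simp
    have nx: "Pos (Suc k) = nxt n (Pos k)" and kle: "k \<le> n" using kn by auto
    \<comment> \<open>A prefix of either stretch delimited by +k and -(k + 1) can be inverted and
      moved to the other stretch; all other letters keep their signs.\<close>
    have move: "\<exists>w'. eqv n w w' \<and> neg ` set p \<subseteq> set w' \<and> set w - set p \<subseteq> set w'"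
      if "y = p @ q \<or> z = p @ q" for p q
      using that
    proof
      assume y: "y = p @ q"
      have "eqv n ?W (Pos k # q @ Neg (Suc k) # winv p @ z)"
        using eqv_flip4[OF kle nx, of "[]" p q z] y by simp
      from eqv.trans[OF W this] show ?thesis
        by (intro exI[of _ "Pos k # q @ Neg (Suc k) # winv p @ z"]) (auto simp: setW[symmetric] y)
    next
      assume z: "z = p @ q"
      have "eqv n ?W (Pos k # winv p @ y @ Neg (Suc k) # q)"
        using eqv.sym[OF eqv_flip4[OF kle nx, of "[]" "winv p" y q]] z by simp
      from eqv.trans[OF W this] show ?thesis
        by (intro exI[of _ "Pos k # winv p @ y @ Neg (Suc k) # q"]) (auto simp: setW[symmetric] z)
    qed
    have flip: "\<exists>r. eqv n w (Pos 0 # r @ [Neg n])" if z': "Pos n \<in> set z'" and sub: "z' = y \<or> z' = z" for z'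
    proof -
      obtain p q where pq: "z' = p @ Pos n # q" using z' by (meson split_list)
      have dist: "distinct ?W" using vW unfolding valid_def distinct_map by blast
      have use: "\<exists>r. eqv n w (Pos 0 # r @ [Neg n])"
        if "eqv n w w'" "Pos 0 \<in> set w' \<and> Neg n \<in> set w' \<or> Neg 0 \<in> set w' \<and> Pos n \<in> set w'" for w'
        using eqv_last_of_signs[of n w'] that v n eqv_valid eqv.trans by meson
      show ?thesis
      \<comment> \<open>The inverted prefix ends at +n, or at +0 if that comes earlier in this
        stretch, so that it contains only one of them.\<close>
      proof (cases "Pos 0 \<in> set p")
        case False
        obtain w' where w': "eqv n w w'" "neg ` set (p @ [Pos n]) \<subseteq> set w'" "set w - set (p @ [Pos n]) \<subseteq> set w'"
          using move[of "p @ [Pos n]" q] pq sub by auto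
        have "Neg n \<in> set w'" "Pos 0 \<in> set w'" using w' False 0 n by auto
        then show ?thesis using use w' by blast
      next
        case True
        then obtain p1 p2 where p: "p = p1 @ Pos 0 # p2" by (meson split_list)
        obtain w' where w': "eqv n w w'" "neg ` set (p1 @ [Pos 0]) \<subseteq> set w'" "set w - set (p1 @ [Pos 0]) \<subseteq> set w'"
          using move[of "p1 @ [Pos 0]" "p2 @ Pos n # q"] pq p sub by auto
        have "Pos n \<notin> set p1" using dist sub pq p by auto
        then have "Neg 0 \<in> set w'" "Pos n \<in> set w'" using w' Pn n by auto
        then show ?thesis using use w' by blast
      qed
    qed
    have "Pos n \<in> set ?W" using Pn setW by simp
    then have "Pos n \<in> set y \<or> Pos n \<in> set z" using kn by auto
    then show ?thesis using flip by blast
  qed (use eqv_last_of_mem[OF v n 0] in blast)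
  show ?thesis
  proof (cases "Pos 0 \<in> set w")
    case True
    then show ?thesis using main[OF v] \<open>mixed w\<close> by (auto simp: mixed_def)
  next
    case False
    then have "Neg 0 \<in> set w" using valid_mem[OF v] by blast
    then have "Pos 0 \<in> set (winv w)" by force
    moreover have "\<exists>i. Neg i \<in> set (winv w)" using \<open>mixed w\<close> mixed_winv[of w] unfolding mixed_def by blast
    ultimately obtain r where "eqv n (winv w) (Pos 0 # r @ [Neg n])" using main[of "winv w"] v by auto
    then show ?thesis using eqv.trans[OF eqv.winv] by blast
  qed
qed


lemma valid_remove_last:
  assumes "valid (Suc n) (Pos 0 # r @ [e])" "lab e = Suc n"
  shows "valid n (Pos 0 # r)"
proof -
  have d: "distinct (map lab (Pos 0 # r))" "Suc n \<notin> lab ` set (Pos 0 # r)"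
    and "insert (Suc n) (lab ` set (Pos 0 # r)) = {..Suc n}"
    using assms by (auto simp: valid_def insert_commute)
  then have "lab ` set (Pos 0 # r) = {..Suc n} - {Suc n}" by blast
  also have "\<dots> = {..n}" by auto
  finally show ?thesis using d(1) by (simp add: valid_def)
qed

text \<open>If -(t + 1) is the only negative letter, 0 and 1 have equal signs. Flipping 0 along t
  and t + 1 and inverting the word gives them opposite signs, which makes flips along 0 and 1
  available to the next two lemmas; these finally return -(t + 1) to the end.\<close>

lemma eqv_turn_0:
  "eqv (Suc t) (Pos 0 # a @ Pos t # b @ [Neg (Suc t)]) (Pos 0 # Neg t # winv a @ Pos (Suc t) # winv b)"
proof -
  have nx: "Pos (Suc t) = nxt (Suc t) (Pos t)" and le: "t \<le> Suc t" by simp_all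
  have "eqv (Suc t) (Pos 0 # a @ Pos t # b @ [Neg (Suc t)]) (Neg (Suc t) # Pos 0 # a @ Pos t # b)"
    using eqv.rotate[of "Suc t" "Pos 0 # a @ Pos t # b" "[Neg (Suc t)]"] by simp
  also have "eqv (Suc t) \<dots> (Neg (Suc t) # a @ Pos t # Neg 0 # b)"
    using eqv_flip3[OF le nx, of "[]" "[Pos 0]" a b] by simp
  also have "eqv (Suc t) \<dots> (winv (Neg (Suc t) # a @ Pos t # Neg 0 # b))" by (rule eqv.winv)
  also have "eqv (Suc t) \<dots> (Pos 0 # Neg t # winv a @ Pos (Suc t) # winv b)"
    using eqv.rotate[of "Suc t" "winv b" "Pos 0 # Neg t # winv a @ [Pos (Suc t)]"] by simp
  finally show ?thesis .
qed

lemma eqv_turn_1: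
  assumes "1 \<le> t"
  shows "eqv (Suc t) (Pos 0 # (s @ Pos 1 # s') @ Pos t # b @ [Neg (Suc t)])
      (Pos 0 # (b @ Pos 1 # s' @ Pos t # winv s) @ [Neg (Suc t)])"
proof -
  have nx: "Pos 1 = nxt (Suc t) (Pos 0)" and le: "0 \<le> Suc t" by simp_all
  have "eqv (Suc t) (Pos 0 # (s @ Pos 1 # s') @ Pos t # b @ [Neg (Suc t)])
      (Pos 0 # (Neg t # winv s') @ Neg 1 # (winv s @ [Pos (Suc t)]) @ winv b)"
    using eqv_turn_0[of t "s @ Pos 1 # s'" b] by simp
  also have "eqv (Suc t) \<dots> (Pos 0 # [] @ Neg (Suc t) # s @ (Neg t # winv s') @ Neg 1 # winv b)"
    using eqv.sym[OF eqv_flip4[OF le nx, of "[]" "Neg (Suc t) # s" "Neg t # winv s'" "winv b"]] by simp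
  also have "eqv (Suc t) \<dots> (Pos 0 # (b @ Pos 1 # s' @ Pos t # winv s) @ [Neg (Suc t)])"
    using eqv_crosscap_to_end[of "Suc t" "[]" "s @ (Neg t # winv s') @ Neg 1 # winv b"] by simp
  finally show ?thesis .
qed

lemma eqv_turn_2:
  assumes "1 \<le> t"
  shows "eqv (Suc t) (Pos 0 # a @ Pos t # (s @ Pos 1 # s') @ [Neg (Suc t)])
      (Pos 0 # (winv s' @ Neg 1 # s @ Neg t # winv a) @ [Neg (Suc t)])"
proof -
  have nx: "Pos 1 = nxt (Suc t) (Pos 0)" and le: "0 \<le> Suc t" by simp_all
  have "eqv (Suc t) (Pos 0 # a @ Pos t # (s @ Pos 1 # s') @ [Neg (Suc t)])
      (Pos 0 # (Neg t # winv a @ [Pos (Suc t)]) @ winv s' @ Neg 1 # winv s)"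
    using eqv_turn_0[of t a "s @ Pos 1 # s'"] by simp
  also have "eqv (Suc t) \<dots> (Pos 0 # (winv s' @ [Neg 1]) @ Neg (Suc t) # (a @ [Pos t]) @ winv s)"
    using eqv_flip4[OF le nx, of "[]" "Neg t # winv a @ [Pos (Suc t)]" "winv s'" "winv s"] by simp
  also have "eqv (Suc t) \<dots> (Pos 0 # (winv s' @ Neg 1 # s @ Neg t # winv a) @ [Neg (Suc t)])"
    using eqv_crosscap_to_end[of "Suc t" "winv s' @ [Neg 1]" "(a @ [Pos t]) @ winv s"] by simp
  finally show ?thesis .
qed

text \<open>The difficulty is to keep the word mixed when its last letter is removed. If -(t + 1) is
  the only negative letter, either t can be brought in front of it, so that the sign passes to t, or
  a turn produces a further negative letter.\<close>

lemma eqv_crosscaps: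
  "valid n w \<Longrightarrow> mixed w \<Longrightarrow> \<exists>m. 1 \<le> m \<and> m \<le> n \<and> eqv n w (crosscaps n m)"
proof (induction n arbitrary: w)
  case 0
  then have "length w = 1" using valid_length by auto
  then obtain a where "w = [a]" by (auto simp: length_Suc_conv)
  then show ?case using 0 by (auto simp: mixed_def)
next
  case (Suc t)
  obtain r where r: "eqv (Suc t) w (Pos 0 # r @ [Neg (Suc t)])"
    using eqv_crosscap_last[OF Suc.prems] by auto
  have valid: "valid t (Pos 0 # r')" if "eqv (Suc t) w (Pos 0 # r' @ [e])" "lab e = Suc t" for r' e
    using valid_remove_last that eqv_valid Suc.prems(1) by blast
  \<comment> \<open>Another negative letter is present: -(t + 1) is removed as a crosscap.\<close>
  have A: ?case if r': "eqv (Suc t) w (Pos 0 # r' @ [Neg (Suc t)])" "Neg i \<in> set r'" for r' i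
  proof -
    have v: "valid t (Pos 0 # r')" using valid r'(1) by simp
    moreover have "mixed (Pos 0 # r')" using r'(2) by (auto simp: mixed_def)
    ultimately obtain m where m: "1 \<le> m" "m \<le> t" "eqv t (Pos 0 # r') (crosscaps t m)"
      using Suc.IH by blast
    obtain c where c: "crosscaps t m = Pos 0 # c" using crosscaps_Cons by blast
    have "eqv (Suc t) (Pos 0 # r' @ [Neg (Suc t)]) (Pos 0 # c @ [Neg (Suc t)])"
      by (rule eqv_append_last[OF v]) (use m c in auto)
    then have "eqv (Suc t) w (crosscaps t m @ [Neg (Suc t)])" using r'(1) c eqv.trans by auto
    then have "eqv (Suc t) w (crosscaps (Suc t) (Suc m))"
      using eqv_crosscaps_append[OF m(2)] eqv.trans by blast
    then show ?thesis using m by (intro exI[of _ "Suc m"]) simp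
  qed
  \<comment> \<open>The letter t stands directly before -(t + 1): after exchanging their signs, the
    positive t + 1 is removed and -t keeps the rest mixed.\<close>
  have B: ?case if r': "eqv (Suc t) w (Pos 0 # (r' @ [Pos t]) @ [Neg (Suc t)])" and t: "1 \<le> t" for r'
  proof -
    have sw: "eqv (Suc t) w (Pos 0 # (r' @ [Neg t]) @ [Pos (Suc t)])"
      using eqv.trans[OF r'] eqv_swap_last[OF t, of r'] by simp
    have v: "valid t (Pos 0 # r' @ [Neg t])" using valid[OF sw] by simp
    moreover have "mixed (Pos 0 # r' @ [Neg t])" by (auto simp: mixed_def)
    ultimately obtain m where m: "1 \<le> m" "m \<le> t" "eqv t (Pos 0 # r' @ [Neg t]) (crosscaps t m)"
      using Suc.IH by blast
    obtain c where c: "crosscaps t m = Pos 0 # c" using crosscaps_Cons by blast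
    have "eqv (Suc t) (Pos 0 # (r' @ [Neg t]) @ [Pos (Suc t)]) (Pos 0 # c @ [Pos (Suc t)])"
      by (rule eqv_append_last) (use v m c in auto)
    moreover have "crosscaps (Suc t) m = Pos 0 # c @ [Pos (Suc t)]" using crosscaps_Suc[OF m(2)] c by simp
    ultimately have "eqv (Suc t) w (crosscaps (Suc t) m)" using eqv.trans[OF sw] by simp
    then show ?thesis using m by (intro exI[of _ m]) simp
  qed
  show ?case
  proof (cases "\<exists>i. Neg i \<in> set r")
    case True
    then show ?thesis using A r by blast
  next
    case no_neg: False
    have vr: "valid t (Pos 0 # r)" using valid[OF r] by simp
    show ?thesis
    proof (cases "t = 0")
      case True
      then have "r = []" using valid_length[OF vr] by simp
      then have "eqv (Suc t) w (crosscaps (Suc t) 1)" using r True by (simp add: crosscaps_def)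
      then show ?thesis using True by (intro exI[of _ 1]) simp
    next
      case False
      then have t: "1 \<le> t" by simp
      have mem: "Pos i \<in> set r" if "1 \<le> i" "i \<le> t" for i
        using valid_mem[OF vr that(2)] no_neg that(1) by auto
      obtain a b where ab: "r = a @ Pos t # b" using mem[of t] t by (meson order_refl split_list)
      show ?thesis
      proof (cases "b = []")
        case True
        then show ?thesis using B[of a] r ab t by simp
      next
        case False
        have "t \<noteq> 1"
        proof
          assume "t = 1"
          then have "length r = 1" using valid_length[OF vr] by simp
          then show False using ab False by simp
        qed
        then have "Pos 1 \<in> set a \<or> Pos 1 \<in> set b" using mem[of 1] t ab by auto
        then show ?thesis
        proof
          assume "Pos 1 \<in> set a"
          then obtain s s' where s: "a = s @ Pos 1 # s'" by (meson split_list)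
          have e: "eqv (Suc t) w (Pos 0 # (b @ Pos 1 # s' @ Pos t # winv s) @ [Neg (Suc t)])"
            using eqv.trans[OF r] eqv_turn_1[OF t, of s s' b] ab s by simp
          show ?thesis
          \<comment> \<open>If \<open>s\<close> is empty, t has become the last letter before -(t +
            1); otherwise \<open>winv s\<close> contributes a negative letter.\<close>
          proof (cases s)
            case Nil
            then show ?thesis using B[of "b @ Pos 1 # s'"] e t by simp
          next
            case (Cons c s0)
            then obtain i where "c = Pos i" using no_neg ab s by (cases c) auto
            then have "Neg i \<in> set (b @ Pos 1 # s' @ Pos t # winv s)" using Cons by simp
            then show ?thesis using A[OF e] by blast
          qed
        next
          assume "Pos 1 \<in> set b"
          then obtain s s' where s: "b = s @ Pos 1 # s'" by (meson split_list)
          have "eqv (Suc t) w (Pos 0 # (winv s' @ Neg 1 # s @ Neg t # winv a) @ [Neg (Suc t)])"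
            using eqv.trans[OF r] eqv_turn_2[OF t, of a s s'] ab s by simp
          then show ?thesis by (rule A[of _ 1]) simp
        qed
      qed
    qed
  qed
qed

text \<open>The word \<open>[Pos 0]\<close> has one component; each of the m negative letters keeps
  the count and each positive one raises it by one. The count therefore determines m.\<close>

lemma word_comps_crosscaps: "m \<le> n \<Longrightarrow> word_comps n (crosscaps n m) = Suc n - m"
proof (induction n)
  case 0
  then show ?case using word_comps_0 by (simp add: crosscaps_def)
next
  case (Suc n)
  show ?case
  proof (cases "m = Suc n")
    case True
    have base: "word_comps k (crosscaps k k) = 1" for k
    proof (induction k)
      case (Suc k)
      obtain c where c: "crosscaps k k = Pos 0 # c" using crosscaps_Cons by blast
      then show ?case using word_comps_crosscap[of k c] valid_crosscaps[of k k] Suc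
        by (simp add: crosscaps_Suc_Suc)
    qed (use word_comps_0 in \<open>simp add: crosscaps_def\<close>)
    show ?thesis using base[of "Suc n"] True by simp
  next
    case False
    then have m: "m \<le> n" using Suc.prems by simp
    obtain c where c: "crosscaps n m = Pos 0 # c" using crosscaps_Cons by blast
    then show ?thesis
      using word_comps_digon[of n c] valid_crosscaps[OF m] Suc.IH[OF m] m crosscaps_Suc[OF m]
      by (simp add: Suc_diff_le)
  qed
qed

section \<open>Operations\<close>

lemma cycle_of_list_nth:
  assumes "distinct cs" "Suc i < length cs"
  shows "cycle_of_list cs (cs ! i) = cs ! Suc i"
proof -
  have "map (cycle_of_list cs ^^ 1) cs ! i = rotate 1 cs ! i" using cyclic_rotation[OF assms(1), of 1] by simp
  then show ?thesis using assms(2) by (simp add: nth_rotate1)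
qed

lemma valid_distinct: "valid n w \<Longrightarrow> distinct w"
  by (simp add: valid_def distinct_map)

lemma star_eq:
  assumes "\<pi> \<in> signed_perms n"
  shows "star n \<pi> = cycle_of_list (rev (perm_word n \<pi>)) \<circ> cycle_of_list (map neg (perm_word n \<pi>))"
proof -
  have "ext \<pi> (Neg j) = neg (ext \<pi> (Pos j))" if "j \<in> set [0..<n + 1]" for j
    using ext_neg[OF assms, of "Pos j"] that by (auto simp: mem_H_iff simp del: ext.simps upt_Suc)
  then have "map (\<lambda>j. ext \<pi> (Neg j)) [0..<n + 1] = map neg (perm_word n \<pi>)"
    unfolding perm_word_def map_map by (intro map_cong HOL.refl) (simp only: o_def)
  moreover have "map (\<lambda>j. ext \<pi> (Pos j)) (rev [0..<n + 1]) = rev (perm_word n \<pi>)"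
    by (simp only: perm_word_def rev_map)
  ultimately show ?thesis unfolding star_def by (simp only:)
qed

text \<open>The first cycle of \<open>star\<close> lists the word from its last letter to its first,
  and the second one moves only negated letters.\<close>

lemma star_nth:
  assumes "\<pi> \<in> signed_perms n" "i < n"
  shows "star n \<pi> (perm_word n \<pi> ! Suc i) = perm_word n \<pi> ! i"
proof -
  let ?w = "perm_word n \<pi>"
  have v: "valid n ?w" using valid_perm_word assms(1) .
  have mem: "?w ! Suc i \<in> set ?w" using assms(2) by simp
  have "?w ! Suc i \<notin> set (map neg ?w)"
  proof
    assume "?w ! Suc i \<in> set (map neg ?w)"
    then have "neg (?w ! Suc i) \<in> set ?w" by auto
    then show False using mem valid_not_both[OF v] by (cases "?w ! Suc i") auto
  qed
  then have "star n \<pi> (?w ! Suc i) = cycle_of_list (rev ?w) (rev ?w ! (n - Suc i))"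
    using assms by (simp add: star_eq id_outside_supp rev_nth)
  also have "\<dots> = rev ?w ! Suc (n - Suc i)"
    by (rule cycle_of_list_nth) (use assms(2) valid_distinct[OF v] in auto)
  also have "\<dots> = ?w ! i" using assms(2) by (simp add: rev_nth)
  finally show ?thesis .
qed

lemma conjugate_comp:
  assumes "bij \<sigma>"
  shows "conjugate \<sigma> (f \<circ> g) = conjugate \<sigma> f \<circ> conjugate \<sigma> g"
  using bij_is_inj[OF assms] by (auto simp: conjugate_def fun_eq_iff)

lemma star_conjugate:
  assumes "\<pi> \<in> signed_perms n" "\<theta> \<in> signed_perms n" "bij \<sigma>" "\<And>u. \<sigma> (neg u) = neg (\<sigma> u)"
    and "perm_word n \<theta> = map \<sigma> (perm_word n \<pi>)"
  shows "star n \<theta> = conjugate \<sigma> (star n \<pi>)"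
proof -
  let ?w = "perm_word n \<pi>"
  have d: "distinct ?w" using valid_distinct valid_perm_word assms(1) by blast
  then have dn: "distinct (map neg ?w)" by (simp add: distinct_map inj_on_def)
  have c: "conjugate \<sigma> (cycle_of_list (rev ?w)) = cycle_of_list (map \<sigma> (rev ?w))"
    "conjugate \<sigma> (cycle_of_list (map neg ?w)) = cycle_of_list (map \<sigma> (map neg ?w))"
    unfolding conjugate_def using d dn assms(3) by (simp_all only: conjugation_of_cycle distinct_rev)
  have m: "map \<sigma> (map neg ?w) = map neg (map \<sigma> ?w)" by (simp add: assms(4))
  show ?thesis
    unfolding star_eq[OF assms(1)] star_eq[OF assms(2)] conjugate_comp[OF assms(3)] assms(5)
    by (simp only: c m rev_map)
qed

text \<open>A relabelling that commutes with negation conjugates both cycles of \<open>star\<close>;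
  here it is the odd extension of \<open>shift\<close>, which agrees with \<open>sigma_A\<close> for
  \<open>y = Pos q\<close> and \<open>q > p + 1\<close>.\<close>

lemma cyclic_of_cyc_step:
  assumes "\<pi> \<in> signed_perms n" "\<theta> \<in> signed_perms n"
    and w: "perm_word n \<pi> = map Pos l" "perm_word n \<theta> = map Pos (map (shift p q) l)"
    and l: "l = u @ p # q # Suc p # v" and pq: "Suc p < q" "q \<le> n"
  shows "cyclic n (Pos p) (Pos q) \<pi> \<theta>"
proof (rule cyclic.A)
  have s: "sigma_A p (Pos q) t = Pos (shift p q t)" for t
    using pq by (auto simp: sigma_A_def shift_def)
  let ?\<sigma> = "odd_extension (sigma_A p (Pos q))"
  define g where "g = inv_into UNIV (shift p q)"
  have gs: "g (shift p q t) = t" "shift p q (g t) = t" for t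
    using bij_shift[OF pq(1)] by (simp_all add: g_def bij_is_inj bij_is_surj surj_f_inv_f)
  have bij: "bij ?\<sigma>"
  proof (rule o_bij)
    show "odd_extension (\<lambda>t. Pos (g t)) \<circ> ?\<sigma> = id" "?\<sigma> \<circ> odd_extension (\<lambda>t. Pos (g t)) = id"
    proof -
      have "(odd_extension (\<lambda>t. Pos (g t)) \<circ> ?\<sigma>) x = x" "(?\<sigma> \<circ> odd_extension (\<lambda>t. Pos (g t))) x = x" for x
        by (cases x; simp add: s gs)+
      then show "odd_extension (\<lambda>t. Pos (g t)) \<circ> ?\<sigma> = id" "?\<sigma> \<circ> odd_extension (\<lambda>t. Pos (g t)) = id"
        by (simp_all add: fun_eq_iff)
    qed
  qed
  have neg: "?\<sigma> (neg x) = neg (?\<sigma> x)" for x by (cases x) simp_all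
  have "perm_word n \<theta> = map ?\<sigma> (perm_word n \<pi>)" unfolding w by (simp add: s)
  then show "star n \<theta> = conjugate ?\<sigma> (star n \<pi>)" using star_conjugate assms(1,2) bij neg by blast
  have len: "length l = Suc n" using arg_cong[OF w(1), of length] by simp
  have nth: "perm_word n \<pi> ! length u = Pos p" "perm_word n \<pi> ! Suc (length u) = Pos q"
    "perm_word n \<pi> ! Suc (Suc (length u)) = Pos (Suc p)"
    unfolding w(1) l by (simp_all add: nth_append)
  have "nxt n (Pos p) = Pos (Suc p)" using pq by simp
  then show "star n \<pi> (nxt n (Pos p)) = Pos q" "star n \<pi> (Pos q) = Pos p"
    using star_nth[OF assms(1), of "Suc (length u)"] star_nth[OF assms(1), of "length u"] len l nth by simp_all
  show "Pos p \<in> H n" "Pos q \<in> H n" using pq by (simp_all add: mem_H_iff)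
qed (fact assms(1,2))+

lemma perm_word_of_edges:
  assumes "\<pi> \<in> signed_perms n" "valid n w" "w ! 0 = Pos 0" "black_edges n \<pi> = word_edges w"
  shows "perm_word n \<pi> = w"
proof -
  obtain \<pi>' where "\<pi>' \<in> signed_perms n" "perm_word n \<pi>' = w" using ex_perm_word assms(2,3) by blast
  then show ?thesis using black_edges_inject[OF assms(1), of \<pi>'] black_edges_eq assms(4) by metis
qed

lemma operation_of_cyc_step:
  assumes "cyc_step n l l'" "vlist n l" "\<pi> \<in> signed_perms n" "\<theta> \<in> signed_perms n"
    and "black_edges n \<pi> = word_edges (map Pos l)" "black_edges n \<theta> = word_edges (map Pos l')"
  shows "operation n \<pi> \<theta>"
proof -
  obtain p q u v where pq: "Suc p < q" "q \<le> n" "l = u @ p # q # Suc p # v" "hd l = 0" "l' = map (shift p q) l"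
    using assms(1) unfolding cyc_step_def by blast
  have v': "vlist n l'" using cyc_step_vlist assms(1,2) by blast
  have ne: "l \<noteq> []" using pq(3) by simp
  have l0: "l ! 0 = 0" using pq(4) ne by (simp add: hd_conv_nth)
  then have l'0: "l' ! 0 = 0" using ne pq(5) by (simp add: shift_def)
  have "perm_word n \<pi> = map Pos l"
    by (rule perm_word_of_edges) (use assms ne l0 valid_map_Pos_vlist in auto)
  moreover have "perm_word n \<theta> = map Pos l'"
  proof (rule perm_word_of_edges)
    show "valid n (map Pos l')" using v' valid_map_Pos_vlist by blast
    show "map Pos l' ! 0 = Pos 0" using l'0 ne pq(5) by simp
  qed (use assms in auto)
  ultimately have "cyclic n (Pos p) (Pos q) \<pi> \<theta>"
    using cyclic_of_cyc_step[OF assms(3,4) _ _ pq(3,1,2)] pq(5) by simp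
  then show ?thesis unfolding operation_def by blast
qed

lemma operations_of_reach:
  assumes "reach n l l'" "vlist n l" "\<pi> \<in> signed_perms n" "black_edges n \<pi> = word_edges (map Pos l)"
  shows "vlist n l' \<and> (\<forall>\<theta> \<in> signed_perms n. black_edges n \<theta> = word_edges (map Pos l') \<longrightarrow>
    (operation n)\<^sup>*\<^sup>* \<pi> \<theta>)"
  using assms(1) unfolding reach_def
proof (induction rule: rtranclp_induct)
  case base
  then show ?case using assms(2-4) black_edges_inject by (metis rtranclp.rtrancl_refl)
next
  case (step l' l'')
  then have v': "vlist n l'" by blast
  obtain \<rho> where \<rho>: "\<rho> \<in> signed_perms n" "black_edges n \<rho> = word_edges (map Pos l')"
    using ex_perm[of n "map Pos l'"] v' valid_map_Pos_vlist by blast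
  have "(operation n)\<^sup>*\<^sup>* \<pi> \<rho>" using step.IH \<rho> by blast
  moreover have "vlist n l''" using step.hyps(2) v' slide_vlist cyc_step_vlist by blast
  moreover have "(operation n)\<^sup>*\<^sup>* \<rho> \<theta>" if \<theta>: "\<theta> \<in> signed_perms n" "black_edges n \<theta> = word_edges (map Pos l'')" for \<theta>
    using step.hyps(2)
  proof
    assume "slide n l' l''"
    then show ?thesis
      using eqv_operations[OF _ slide_eqv \<rho>(1) \<theta>(1) \<rho>(2) \<theta>(2)] v' valid_map_Pos_vlist by blast
  next
    assume "cyc_step n l' l''"
    then show ?thesis using operation_of_cyc_step[OF _ v' \<rho>(1) \<theta>(1) \<rho>(2) \<theta>(2)] by blast
  qed
  ultimately show ?case by (meson rtranclp_trans)
qed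

section \<open>Equivalence of permutations\<close>

lemma Neg_in_perm_word:
  assumes "\<pi> \<in> signed_perms n"
  shows "(\<exists>i. Neg i \<in> set (perm_word n \<pi>)) \<longleftrightarrow> 0 < neg_count n \<pi>"
proof
  assume "\<exists>i. Neg i \<in> set (perm_word n \<pi>)"
  then obtain i j where j: "j \<le> n" "Neg i = ext \<pi> (Pos j)"
    unfolding perm_word_def by (auto simp: less_Suc_eq_le simp del: ext.simps upt_Suc)
  have "j \<noteq> 0" using j(2) by (metis ext.simps(1) signed_nat.distinct(1))
  then have "\<pi> (int j) < 0"
    using j signed_perms_bounds(1)[OF assms, of "int j"] by (auto simp: signed_of_int_def split: if_splits)
  then have "int j \<in> {i \<in> {1..int n}. \<pi> i < 0}" using j \<open>j \<noteq> 0\<close> by simp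
  moreover have "finite {i \<in> {1..int n}. \<pi> i < 0}" by (rule finite_subset[of _ "{1..int n}"]) auto
  ultimately show "0 < neg_count n \<pi>" unfolding neg_count_def card_gt_0_iff by blast
next
  assume "0 < neg_count n \<pi>"
  then obtain i where i: "i \<in> {1..int n}" "\<pi> i < 0" unfolding neg_count_def by (auto simp: card_gt_0_iff)
  then have "ext \<pi> (Pos (nat i)) = Neg (nat (- \<pi> i))" by (simp add: signed_of_int_def)
  moreover have "nat i \<in> set [0..<n + 1]" using i(1) unfolding set_upt by auto
  then have "ext \<pi> (Pos (nat i)) \<in> set (perm_word n \<pi>)"
    unfolding perm_word_def set_map by (rule imageI)
  ultimately show "\<exists>i. Neg i \<in> set (perm_word n \<pi>)" by metis
qed

lemma perm_word_positive:
  assumes "\<pi> \<in> signed_perms n" "neg_count n \<pi> = 0"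
  obtains l where "perm_word n \<pi> = map Pos l" "vlist n l"
proof -
  have "\<forall>u \<in> set (perm_word n \<pi>). u = Pos (lab u)"
  proof
    fix u assume u: "u \<in> set (perm_word n \<pi>)"
    show "u = Pos (lab u)" using Neg_in_perm_word[OF assms(1)] assms(2) u by (cases u) auto
  qed
  then have "perm_word n \<pi> = map Pos (map lab (perm_word n \<pi>))"
    unfolding map_map by (intro map_idI[symmetric]) (simp add: o_def)
  then show ?thesis using that valid_perm_word[OF assms(1)] valid_map_Pos_vlist by metis
qed

lemma mixed_perm_word:
  assumes "\<pi> \<in> signed_perms n" "0 < neg_count n \<pi>"
  shows "mixed (perm_word n \<pi>)"
proof -
  have "Pos 0 \<in> set (perm_word n \<pi>)" using perm_word_hd[of n \<pi>] nth_mem[of 0 "perm_word n \<pi>"] by simp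
  then show ?thesis using Neg_in_perm_word[OF assms(1)] assms(2) by (auto simp: mixed_def)
qed

lemma num_cycles_word_comps:
  "\<pi> \<in> signed_perms n \<Longrightarrow> num_cycles n \<pi> = word_comps n (perm_word n \<pi>)"
  using num_cycles_eq black_edges_eq by (simp add: word_comps_def)

lemma num_cycles_positive:
  assumes "\<pi> \<in> signed_perms n"
  shows "0 < num_cycles n \<pi>"
proof -
  have "Pos 0 \<in> H n" by (simp add: mem_H_iff)
  then show ?thesis unfolding num_cycles_eq[OF assms] num_comps_def by (auto simp: card_gt_0_iff)
qed

lemma op_equivalent_orientable:
  assumes "\<pi> \<in> signed_perms n" "\<theta> \<in> signed_perms n" "num_cycles n \<pi> = num_cycles n \<theta>"
    and "neg_count n \<pi> = 0" "neg_count n \<theta> = 0"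
  shows "op_equivalent n \<pi> \<theta>"
proof -
  obtain l l' where l: "perm_word n \<pi> = map Pos l" "vlist n l" and l': "perm_word n \<theta> = map Pos l'" "vlist n l'"
    using perm_word_positive assms by metis
  have "list_comps n l = list_comps n l'" "1 \<le> list_comps n l"
    using assms(3) num_cycles_word_comps[OF assms(1)] num_cycles_word_comps[OF assms(2)]
      num_cycles_positive[OF assms(1)] l l' by simp_all
  then have "reach n l l' \<or> reach n l' l" using reach_of_list_comps l l' by blast
  then show ?thesis
    unfolding op_equivalent_def
    using operations_of_reach[of n l l' \<pi>] operations_of_reach[of n l' l \<theta>] l l' assms(1,2) black_edges_eq
    by metis
qed

lemma crosscaps_eqv_perm:
  assumes "\<pi> \<in> signed_perms n" "0 < neg_count n \<pi>"
  shows "num_cycles n \<pi> \<le> n" "eqv n (perm_word n \<pi>) (crosscaps n (Suc n - num_cycles n \<pi>))"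
proof -
  obtain m where m: "1 \<le> m" "m \<le> n" "eqv n (perm_word n \<pi>) (crosscaps n m)"
    using eqv_crosscaps[OF valid_perm_word mixed_perm_word] assms by blast
  have "num_cycles n \<pi> = Suc n - m"
    using word_comps_eqv[OF valid_perm_word m(3)] word_comps_crosscaps[OF m(2)] assms(1) num_cycles_word_comps by metis
  then show "num_cycles n \<pi> \<le> n" "eqv n (perm_word n \<pi>) (crosscaps n (Suc n - num_cycles n \<pi>))"
    using m by simp_all
qed

lemma op_equivalent_nonorientable:
  assumes "\<pi> \<in> signed_perms n" "\<theta> \<in> signed_perms n" "num_cycles n \<pi> = num_cycles n \<theta>"
    and "0 < neg_count n \<pi>" "0 < neg_count n \<theta>"
  shows "op_equivalent n \<pi> \<theta>"
proof -
  have "eqv n (perm_word n \<pi>) (perm_word n \<theta>)"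
    using crosscaps_eqv_perm(2)[OF assms(1,4)] crosscaps_eqv_perm(2)[OF assms(2,5)] assms(3)
    by (metis eqv.sym eqv.trans)
  then show ?thesis
    unfolding op_equivalent_def
    using eqv_operations[OF valid_perm_word[OF assms(1)]] assms(1,2) black_edges_eq by blast
qed

section \<open>Probabilities\<close>

lemma perm_word_Cons: "perm_word n \<pi> = Pos 0 # tl (perm_word n \<pi>)"
  using perm_word_hd[of n \<pi>] length_perm_word[of n \<pi>] by (cases "perm_word n \<pi>") auto

context group
begin

section \<open>Products of words in a group\<close>

lemma list_prod_simps [simp]: "list_prod G [] = \<one>" "list_prod G (x # xs) = x \<otimes> list_prod G xs"
  by (simp_all add: list_prod_def)

definition letter :: "(nat \<Rightarrow> 'a) \<Rightarrow> signed_nat \<Rightarrow> 'a" where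
  "letter a u = (case u of Pos j \<Rightarrow> a j | Neg j \<Rightarrow> inv (a j))"

lemma letter_simps [simp]: "letter a (Pos j) = a j" "letter a (Neg j) = inv (a j)"
  by (simp_all add: letter_def)

definition word_prod :: "(nat \<Rightarrow> 'a) \<Rightarrow> signed_nat list \<Rightarrow> 'a" where
  "word_prod a w = list_prod G (map (letter a) w)"

definition on_labels :: "(nat \<Rightarrow> 'a) \<Rightarrow> signed_nat list \<Rightarrow> bool" where
  "on_labels a w \<longleftrightarrow> (\<forall>u \<in> set w. a (lab u) \<in> carrier G)"

lemma on_labels_simps [simp]:
  "on_labels a []" "on_labels a (u # w) \<longleftrightarrow> a (lab u) \<in> carrier G \<and> on_labels a w"
  "on_labels a (v @ w) \<longleftrightarrow> on_labels a v \<and> on_labels a w" "on_labels a (winv w) \<longleftrightarrow> on_labels a w"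
  by (auto simp: on_labels_def)

lemma letter_closed [simp]: "a (lab u) \<in> carrier G \<Longrightarrow> letter a u \<in> carrier G"
  by (cases u) auto

lemma letter_neg: "a (lab u) \<in> carrier G \<Longrightarrow> letter a (neg u) = inv (letter a u)"
  by (cases u) auto

lemma word_prod_simps [simp]: "word_prod a [] = \<one>" "word_prod a (u # w) = letter a u \<otimes> word_prod a w"
  by (simp_all add: word_prod_def)

lemma word_prod_closed [simp]: "on_labels a w \<Longrightarrow> word_prod a w \<in> carrier G"
  by (induction w) auto

lemma word_prod_append [simp]:
  "on_labels a v \<Longrightarrow> on_labels a w \<Longrightarrow> word_prod a (v @ w) = word_prod a v \<otimes> word_prod a w"
  by (induction v) (auto simp: m_assoc)

lemma word_prod_winv: "on_labels a w \<Longrightarrow> word_prod a (winv w) = inv (word_prod a w)"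
  by (induction w) (auto simp: letter_neg inv_mult_group)

lemma prod_eq_one_commute:
  assumes "x \<in> carrier G" "y \<in> carrier G"
  shows "x \<otimes> y = \<one> \<longleftrightarrow> y \<otimes> x = \<one>"
  using assms by (metis inv_comm)

lemma word_prod_rotate:
  "on_labels a (v @ w) \<Longrightarrow> word_prod a (v @ w) = \<one> \<longleftrightarrow> word_prod a (w @ v) = \<one>"
  using prod_eq_one_commute[of "word_prod a v" "word_prod a w"] by simp

text \<open>
  With the additional unknown \<open>a\<^sub>0\<close> both sides of the equation become cyclic words, which may be
  rotated and inverted.
\<close>

definition solutions :: "nat \<Rightarrow> signed_nat list \<Rightarrow> (nat \<Rightarrow> 'a) set" where
  "solutions n w = {a \<in> {..n} \<rightarrow>\<^sub>E carrier G. word_prod a (map Pos [0..<n + 1]) = \<one> \<and> word_prod a w = \<one>}"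

lemma on_labels_valid:
  assumes "a \<in> {..n} \<rightarrow>\<^sub>E carrier G" "valid n w"
  shows "on_labels a w"
proof -
  have "lab u \<le> n" if "u \<in> set w" for u using assms(2) that by (auto simp: valid_def)
  then show ?thesis using assms(1) by (auto simp: on_labels_def PiE_iff)
qed

lemma word_prod_cong: "(\<And>u. u \<in> set w \<Longrightarrow> a (lab u) = b (lab u)) \<Longrightarrow> word_prod a w = word_prod b w"
proof (induction w)
  case (Cons u w)
  have "letter a u = letter b u" using Cons.prems[of u] by (cases u) auto
  then show ?case using Cons by simp
qed simp

text \<open>The substitution \<open>a\<^sub>j \<mapsto> a\<^sub>j y\<inverse>\<close>, \<open>a\<^sub>i \<mapsto> y a\<^sub>i\<close> preserves a product in which \<open>i\<close> follows \<open>j\<close>.\<close>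

definition transvect :: "nat \<Rightarrow> nat \<Rightarrow> signed_nat \<Rightarrow> (nat \<Rightarrow> 'a) \<Rightarrow> nat \<Rightarrow> 'a" where
  "transvect j i y a = a(j := a j \<otimes> inv (letter a y), i := letter a y \<otimes> a i)"

lemma transvect_apply:
  assumes "j \<noteq> i"
  shows "transvect j i y a j = a j \<otimes> inv (letter a y)" "transvect j i y a i = letter a y \<otimes> a i"
    "k \<noteq> j \<Longrightarrow> k \<noteq> i \<Longrightarrow> transvect j i y a k = a k"
  using assms by (simp_all add: transvect_def)

text \<open>The label of \<open>y\<close> differs from \<open>j\<close> and \<open>i\<close>, so its
  value survives the substitution, and substituting with \<open>neg y\<close> undoes it.\<close>

lemma bij_betw_solutions:
  assumes ij: "j \<noteq> i" "j \<le> n" "i \<le> n" "lab y \<noteq> j" "lab y \<noteq> i" "lab y \<le> n"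
    and top: "\<And>y a. a \<in> {..n} \<rightarrow>\<^sub>E carrier G \<Longrightarrow> lab y \<noteq> j \<Longrightarrow> lab y \<noteq> i \<Longrightarrow> lab y \<le> n \<Longrightarrow>
      word_prod (transvect j i y a) (map Pos [0..<n + 1]) = \<one> \<longleftrightarrow> word_prod a (map Pos [0..<n + 1]) = \<one>"
    and w: "\<And>a. a \<in> {..n} \<rightarrow>\<^sub>E carrier G \<Longrightarrow> word_prod (transvect j i y a) w' = \<one> \<longleftrightarrow> word_prod a w = \<one>"
  shows "bij_betw (transvect j i y) (solutions n w) (solutions n w')"
proof (rule bij_betw_byWitness[where f' = "transvect j i (neg y)"])
  have inE: "transvect j i z a \<in> {..n} \<rightarrow>\<^sub>E carrier G"
    if a: "a \<in> {..n} \<rightarrow>\<^sub>E carrier G" and z: "lab z = lab y" for a z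
  proof (rule PiE_I)
    have c: "a k \<in> carrier G" if "k \<le> n" for k using a that by (auto simp: PiE_iff)
    have "letter a z \<in> carrier G" using c ij z by simp
    then show "transvect j i z a k \<in> carrier G" if "k \<in> {..n}" for k
      using that c ij by (auto simp: transvect_def)
    show "transvect j i z a k = undefined" if "k \<notin> {..n}" for k
      using that a ij by (auto simp: transvect_def PiE_iff extensional_def)
  qed
  have inverse: "transvect j i (neg z) (transvect j i z a) = a"
    if a: "a \<in> {..n} \<rightarrow>\<^sub>E carrier G" and z: "lab z = lab y" for a z
  proof
    fix k
    have c: "a k \<in> carrier G" if "k \<le> n" for k using a that by (auto simp: PiE_iff)
    have "transvect j i z a (lab z) = a (lab z)" using ij z by (simp add: transvect_def)
    then have "letter (transvect j i z a) (neg z) = letter a (neg z)" by (cases z) auto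
    also have "\<dots> = inv (letter a z)" using letter_neg c ij z by simp
    finally have l: "letter (transvect j i z a) (neg z) = inv (letter a z)" .
    have lc: "letter a z \<in> carrier G" using c ij z by simp
    consider "k = j" | "k = i" | "k \<noteq> j" "k \<noteq> i" by blast
    then show "transvect j i (neg z) (transvect j i z a) k = a k"
    proof cases
      case 1
      then show ?thesis using lc c[of j] ij by (simp add: transvect_apply[OF ij(1)] l m_assoc)
    next
      case 2
      then show ?thesis using lc c[of i] ij by (simp add: transvect_apply[OF ij(1)] l m_assoc[symmetric])
    next
      case 3
      then show ?thesis by (simp add: transvect_apply[OF ij(1)])
    qed
  qed
  show "\<forall>a \<in> solutions n w. transvect j i (neg y) (transvect j i y a) = a"
    using inverse by (auto simp: solutions_def)
  have inverse': "transvect j i y (transvect j i (neg y) a) = a" if "a \<in> {..n} \<rightarrow>\<^sub>E carrier G" for a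
    using inverse[OF that, of "neg y"] by simp
  then show "\<forall>a \<in> solutions n w'. transvect j i y (transvect j i (neg y) a) = a"
    by (auto simp: solutions_def)
  have iff: "transvect j i y a \<in> solutions n w' \<longleftrightarrow> a \<in> solutions n w" if "a \<in> {..n} \<rightarrow>\<^sub>E carrier G" for a
    using that inE[OF that, of y] top[OF that ij(4,5,6)] w[OF that] by (simp add: solutions_def)
  then show "transvect j i y ` solutions n w \<subseteq> solutions n w'" by (auto simp: solutions_def)
  show "transvect j i (neg y) ` solutions n w' \<subseteq> solutions n w"
  proof (rule image_subsetI)
    fix a assume a: "a \<in> solutions n w'"
    then have aE: "a \<in> {..n} \<rightarrow>\<^sub>E carrier G" by (simp add: solutions_def)
    then show "transvect j i (neg y) a \<in> solutions n w"
      using iff[OF inE[OF aE, of "neg y"]] inverse'[OF aE] a by simp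
  qed
qed

lemma transvect_top:
  assumes "1 \<le> n" "j \<le> n" "i = (if j = n then 0 else Suc j)" "a \<in> {..n} \<rightarrow>\<^sub>E carrier G"
    and "lab y \<noteq> j" "lab y \<noteq> i" "lab y \<le> n"
  shows "word_prod (transvect j i y a) (map Pos [0..<n + 1]) = \<one> \<longleftrightarrow> word_prod a (map Pos [0..<n + 1]) = \<one>"
proof -
  have c: "a k \<in> carrier G" if "k \<le> n" for k using assms(4) that by (auto simp: PiE_iff)
  have yc: "letter a y \<in> carrier G" using c assms by simp
  have ij: "j \<noteq> i" "i \<le> n" using assms by auto
  have tc: "transvect j i y a k \<in> carrier G" if "k \<le> n" for k
    using that c yc ij by (auto simp: transvect_def)
  have on: "on_labels b (map Pos [0..<n + 1])" if "\<And>k. k \<le> n \<Longrightarrow> b k \<in> carrier G" for b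
    using that by (auto simp: on_labels_def simp del: upt_Suc)
  \<comment> \<open>For \<open>j = n\<close> the successor is 0 and adjacent to \<open>j\<close>
    only cyclically, so the product is rotated to begin with \<open>j\<close>,
    \<open>i\<close>.\<close>
  obtain p q r where pq: "[0..<n + 1] = p @ q" "q @ p = j # i # r"
  proof (cases "j = n")
    case True
    then show ?thesis using that[of "[0..<n]" "[n]" "[1..<n]"] assms by (simp add: upt_conv_Cons)
  next
    case False
    then have "[0..<n + 1] = [0..<j] @ [j..<n + 1]" using upt_add_eq_append[of 0 j "n + 1 - j"] assms by simp
    moreover have "[j..<n + 1] = j # Suc j # [Suc (Suc j)..<n + 1]"
      using False assms by (simp add: upt_conv_Cons del: upt_Suc)
    ultimately show ?thesis using that False assms by simp
  qed
  have "distinct (p @ q)" using pq(1) by (metis distinct_upt)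
  then have "distinct (q @ p)" by auto
  then have r: "j \<notin> set r" "i \<notin> set r" unfolding pq(2) by auto
  have rle: "k \<le> n" if "k \<in> set r" for k
  proof -
    have "k \<in> set (q @ p)" using that pq(2) by simp
    then have "k \<in> set [0..<n + 1]" unfolding pq(1) by auto
    then show ?thesis unfolding set_upt by simp
  qed
  have rot: "word_prod b (map Pos [0..<n + 1]) = \<one> \<longleftrightarrow> word_prod b (map Pos (j # i # r)) = \<one>"
    if "\<And>k. k \<le> n \<Longrightarrow> b k \<in> carrier G" for b
  proof -
    have "on_labels b (map Pos p @ map Pos q)" using on[OF that] unfolding pq(1) by simp
    from word_prod_rotate[OF this] show ?thesis unfolding map_append[symmetric] pq(1)[symmetric] pq(2) .
  qed
  have eqr: "word_prod (transvect j i y a) (map Pos r) = word_prod a (map Pos r)"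
    by (rule word_prod_cong) (use r in \<open>auto simp: transvect_def\<close>)
  have onr: "on_labels a (map Pos r)" using rle c by (auto simp: on_labels_def)
  have "word_prod (transvect j i y a) (map Pos (j # i # r)) = word_prod a (map Pos (j # i # r))"
    using yc c[of j] c[of i] assms(2) ij onr
    by (simp add: eqr transvect_apply[OF ij(1)] m_assoc) (simp add: m_assoc[symmetric])
  then show ?thesis using rot c tc by simp
qed

text \<open>After the substitution \<open>i\<close> contributes the old \<open>y\<close> times the
  old \<open>i\<close>. In a move, the new \<open>j\<close> followed by \<open>y\<close> is the old
  \<open>j\<close>; in a flip, the inverse of \<open>y\<close> followed by the inverse of the new
  \<open>j\<close> is the inverse of the old \<open>j\<close>. So the product of the new word equals
  the former product.\<close>

lemma card_solutions_eqv:
  assumes "eqv n w w'" "valid n w" "1 \<le> n"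
  shows "card (solutions n w) = card (solutions n w')"
  using assms(1,2)
proof (induction rule: eqv.induct)
  case (sym w w')
  then show ?case using eqv_valid by metis
next
  case (trans w w' w'')
  then show ?case using eqv_valid by metis
next
  case (rotate u v)
  have "solutions n (u @ v) = solutions n (v @ u)"
    unfolding solutions_def using word_prod_rotate on_labels_valid[OF _ rotate] by blast
  then show ?case by simp
next
  case (winv w)
  have "word_prod a (winv w) = \<one> \<longleftrightarrow> word_prod a w = \<one>" if "a \<in> {..n} \<rightarrow>\<^sub>E carrier G" for a
    using word_prod_winv[OF on_labels_valid[OF that winv]] word_prod_closed[OF on_labels_valid[OF that winv]]
    by (metis inv_inv inv_one)
  then have "solutions n w = solutions n (winv w)" unfolding solutions_def by blast
  then show ?case by simp
next
  case (move j y u v)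
  define i where "i = (if j = n then 0 else Suc j)"
  have N: "nxt n (Pos j) = Pos i" by (simp add: i_def)
  have v: "valid n (y # Pos i # u @ Pos j # v)" using move(2) unfolding N .
  then have dist: "j \<noteq> i" "lab y \<noteq> j" "lab y \<noteq> i" "lab y \<le> n" "i \<le> n"
    and notin: "j \<notin> lab ` set u" "i \<notin> lab ` set u" "j \<notin> lab ` set v" "i \<notin> lab ` set v"
    by (auto simp: valid_def)
  have "word_prod (transvect j i y a) (Pos i # u @ Pos j # y # v) = word_prod a (y # Pos i # u @ Pos j # v)"
    if a: "a \<in> {..n} \<rightarrow>\<^sub>E carrier G" for a
  proof -
    let ?t = "transvect j i y a"
    have on: "on_labels a (y # Pos i # u @ Pos j # v)" using on_labels_valid[OF a v] .
    have uv: "word_prod ?t u = word_prod a u" "word_prod ?t v = word_prod a v"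
      by (rule word_prod_cong, use notin in \<open>auto simp: transvect_def image_iff\<close>)+
    have ly: "letter ?t y = letter a y" using dist by (cases y) (auto simp: transvect_def)
    have tl: "?t j = a j \<otimes> inv (letter a y)" "?t i = letter a y \<otimes> a i" using transvect_apply[OF dist(1)] by auto
    have lc: "letter a y \<in> carrier G" "a i \<in> carrier G" "a j \<in> carrier G"
      "on_labels a u" "on_labels a v" using on by auto
    have tu: "on_labels ?t u" "on_labels ?t v"
      using lc notin by (auto simp: on_labels_def transvect_def image_iff)
    have ty: "?t (lab y) \<in> carrier G" using on dist by (simp add: transvect_def)
    have 1: "word_prod ?t (Pos j # y # v) = a j \<otimes> word_prod a v"
      using lc by (simp add: uv ly tl m_assoc) (simp add: m_assoc[symmetric])
    have "on_labels ?t (Pos j # y # v)" using lc tl tu ty by simp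
    then have "word_prod ?t (Pos i # u @ Pos j # y # v) = ?t i \<otimes> (word_prod ?t u \<otimes> word_prod ?t (Pos j # y # v))"
      using tu by simp
    also have "\<dots> = word_prod a (y # Pos i # u @ Pos j # v)"
      using lc unfolding 1 uv tl by (simp add: m_assoc)
    finally show ?thesis .
  qed
  then have "bij_betw (transvect j i y) (solutions n (y # Pos i # u @ Pos j # v)) (solutions n (Pos i # u @ Pos j # y # v))"
    by (intro bij_betw_solutions dist move(1) transvect_top[OF assms(3) move(1) i_def]) auto
  then show ?case unfolding N by (rule bij_betw_same_card)
next
  case (flip j y u v)
  define i where "i = (if j = n then 0 else Suc j)"
  have N: "nxt n (Pos j) = Pos i" by (simp add: i_def)
  have v: "valid n (y # Pos i # u @ Neg j # v)" using flip(2) unfolding N .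
  then have dist: "j \<noteq> i" "lab y \<noteq> j" "lab y \<noteq> i" "lab y \<le> n" "i \<le> n"
    and notin: "j \<notin> lab ` set u" "i \<notin> lab ` set u" "j \<notin> lab ` set v" "i \<notin> lab ` set v"
    by (auto simp: valid_def)
  have "word_prod (transvect j i y a) (Pos i # u @ neg y # Neg j # v) = word_prod a (y # Pos i # u @ Neg j # v)"
    if a: "a \<in> {..n} \<rightarrow>\<^sub>E carrier G" for a
  proof -
    let ?t = "transvect j i y a"
    have on: "on_labels a (y # Pos i # u @ Neg j # v)" using on_labels_valid[OF a v] .
    have uv: "word_prod ?t u = word_prod a u" "word_prod ?t v = word_prod a v"
      by (rule word_prod_cong, use notin in \<open>auto simp: transvect_def image_iff\<close>)+
    have tl: "?t j = a j \<otimes> inv (letter a y)" "?t i = letter a y \<otimes> a i" using transvect_apply[OF dist(1)] by auto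
    have lc: "letter a y \<in> carrier G" "a i \<in> carrier G" "a j \<in> carrier G"
      "on_labels a u" "on_labels a v" using on by auto
    have ty: "?t (lab y) \<in> carrier G" using on dist by (simp add: transvect_def)
    have "letter ?t y = letter a y" using dist by (cases y) (auto simp: transvect_def)
    then have ly: "letter ?t (neg y) = inv (letter a y)" using letter_neg[of ?t y] ty by simp
    have tu: "on_labels ?t u" "on_labels ?t v"
      using lc notin by (auto simp: on_labels_def transvect_def image_iff)
    have 1: "word_prod ?t (neg y # Neg j # v) = inv (a j) \<otimes> word_prod a v"
      using lc by (simp add: uv ly tl inv_mult_group m_assoc) (simp add: m_assoc[symmetric])
    have "on_labels ?t (neg y # Neg j # v)" using lc tl tu ty by simp
    then have "word_prod ?t (Pos i # u @ neg y # Neg j # v) = ?t i \<otimes> (word_prod ?t u \<otimes> word_prod ?t (neg y # Neg j # v))"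
      using tu by simp
    also have "\<dots> = word_prod a (y # Pos i # u @ Neg j # v)"
      using lc unfolding 1 uv tl by (simp add: m_assoc)
    finally show ?thesis .
  qed
  then have "bij_betw (transvect j i y) (solutions n (y # Pos i # u @ Neg j # v)) (solutions n (Pos i # u @ neg y # Neg j # v))"
    by (intro bij_betw_solutions dist flip(1) transvect_top[OF assms(3) flip(1) i_def]) auto
  then show ?case unfolding N by (rule bij_betw_same_card)
qed simp

section \<open>Probabilities as counts of solutions\<close>

lemma Pr_signed_eq_prob:
  assumes "\<pi> \<in> signed_perms n"
  shows "Pr_signed G n \<pi> = measure_pmf.prob (random_elements G n)
    {a. list_prod G (map a [1..<n + 1]) = list_prod G (map (letter a) (tl (perm_word n \<pi>)))}"
proof -
  have "(if \<pi> (int i) > 0 then a (nat \<bar>\<pi> (int i)\<bar>) else inv (a (nat \<bar>\<pi> (int i)\<bar>))) =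
      letter a (ext \<pi> (Pos i))" if "i \<in> set [1..<n + 1]" for a i
    using that signed_perms_bounds(1)[OF assms, of "int i"]
    by (auto simp: signed_of_int_def simp del: upt_Suc)
  moreover have "tl (perm_word n \<pi>) = map (\<lambda>i. ext \<pi> (Pos i)) [1..<n + 1]"
    by (simp add: perm_word_def upt_conv_Cons del: upt_Suc ext.simps)
  ultimately have "map (\<lambda>i. if \<pi> (int i) > 0 then a (nat \<bar>\<pi> (int i)\<bar>) else inv (a (nat \<bar>\<pi> (int i)\<bar>))) [1..<n + 1] =
      map (letter a) (tl (perm_word n \<pi>))" for a
    by (simp del: upt_Suc ext.simps)
  then show ?thesis unfolding Pr_signed_def by (simp del: upt_Suc)
qed

lemma prob_random_elements:
  assumes "finite (carrier G)"
  shows "measure_pmf.prob (random_elements G n) A =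
    card (({1..n} \<rightarrow>\<^sub>E carrier G) \<inter> A) / card ({1..n} \<rightarrow>\<^sub>E carrier G)"
proof -
  let ?P = "{1..n} \<rightarrow>\<^sub>E carrier G"
  have "PiE_dflt {1..n} undefined (\<lambda>_. carrier G) = ?P"
    by (auto simp: PiE_dflt_def PiE_def Pi_def extensional_def)
  moreover have ne: "carrier G \<noteq> {}" by auto
  ultimately have "random_elements G n = pmf_of_set ?P"
    unfolding random_elements_def using assms by (subst Pi_pmf_of_set) auto
  moreover have "?P \<noteq> {}" "finite ?P" using ne assms by (auto simp: PiE_eq_empty_iff intro!: finite_PiE)
  ultimately show ?thesis by (simp add: measure_pmf_of_set)
qed

definition fixed_assignments :: "nat \<Rightarrow> signed_nat list \<Rightarrow> (nat \<Rightarrow> 'a) set" where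
  "fixed_assignments n w = {a \<in> {1..n} \<rightarrow>\<^sub>E carrier G. word_prod a (map Pos [1..<n + 1]) = word_prod a w}"

lemma Pr_signed_eq_card:
  assumes "finite (carrier G)" "\<pi> \<in> signed_perms n"
  shows "Pr_signed G n \<pi> =
    card (fixed_assignments n (tl (perm_word n \<pi>))) / card ({1..n} \<rightarrow>\<^sub>E carrier G)"
proof -
  have letters: "map (letter a) (map Pos l) = map a l" for a l
    by (simp add: o_def)
  have "fixed_assignments n (tl (perm_word n \<pi>)) = ({1..n} \<rightarrow>\<^sub>E carrier G) \<inter>
      {a. list_prod G (map a [1..<n + 1]) = list_prod G (map (letter a) (tl (perm_word n \<pi>)))}"
    unfolding fixed_assignments_def word_prod_def letters by blast
  then show ?thesis by (simp only: Pr_signed_eq_prob[OF assms(2)] prob_random_elements[OF assms(1)])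
qed

text \<open>The two equations force the value at 0 to be the inverse of the common value of both
  sides, so forgetting it is a bijection.\<close>

lemma card_solutions:
  assumes "valid n (Pos 0 # r)"
  shows "card (solutions n (Pos 0 # r)) = card (fixed_assignments n r)"
proof (rule bij_betw_same_card)
  define q where "q b = word_prod b (map Pos [1..<n + 1])" for b
  have up: "map Pos [0..<n + 1] = Pos 0 # map Pos [1..<n + 1]" by (simp add: upt_conv_Cons del: upt_Suc)
  have labs: "1 \<le> lab u" "lab u \<le> n" if "u \<in> set r" for u
  proof -
    have "lab u \<noteq> 0" using assms that by (auto simp: valid_def)
    then show "1 \<le> lab u" by simp
    show "lab u \<le> n" using assms that by (auto simp: valid_def)
  qed
  have onr: "on_labels b r" "on_labels b (map Pos [1..<n + 1])"
    if "\<And>k. 1 \<le> k \<Longrightarrow> k \<le> n \<Longrightarrow> b k \<in> carrier G" for b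
    using that labs by (auto simp: on_labels_def simp del: upt_Suc)
  have cong: "word_prod b r = word_prod a r" "q b = q a" if "\<And>k. 1 \<le> k \<Longrightarrow> k \<le> n \<Longrightarrow> b k = a k" for a b
    unfolding q_def by (rule word_prod_cong, use that labs in \<open>auto simp del: upt_Suc\<close>)+
  let ?f = "\<lambda>a. restrict a {1..n}" and ?g = "\<lambda>b. b(0 := inv (q b))"
  have F: "b \<in> fixed_assignments n r \<longleftrightarrow> b \<in> {1..n} \<rightarrow>\<^sub>E carrier G \<and> q b = word_prod b r" for b
    by (simp add: fixed_assignments_def q_def)
  have eq_inv: "x \<otimes> y = \<one> \<and> x \<otimes> z = \<one> \<longleftrightarrow> x = inv y \<and> y = z"
    if "x \<in> carrier G" "y \<in> carrier G" "z \<in> carrier G" for x y z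
    using that by (metis inv_equality inv_inv l_inv)
  have S: "a \<in> solutions n (Pos 0 # r) \<longleftrightarrow>
      a \<in> {..n} \<rightarrow>\<^sub>E carrier G \<and> a 0 = inv (q a) \<and> q a = word_prod a r" for a
  proof (cases "a \<in> {..n} \<rightarrow>\<^sub>E carrier G")
    case True
    then have c: "a k \<in> carrier G" if "k \<le> n" for k using that by (auto simp: PiE_iff)
    then have "q a \<in> carrier G" "word_prod a r \<in> carrier G" using onr[of a] by (auto simp: q_def)
    moreover have "a 0 \<in> carrier G" using c by simp
    ultimately have "a 0 \<otimes> q a = \<one> \<and> a 0 \<otimes> word_prod a r = \<one> \<longleftrightarrow> a 0 = inv (q a) \<and> q a = word_prod a r"
      using eq_inv by blast
    moreover have "word_prod a (map Pos [0..<n + 1]) = a 0 \<otimes> q a" "word_prod a (Pos 0 # r) = a 0 \<otimes> word_prod a r"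
      unfolding up q_def by (simp_all only: word_prod_simps letter_simps)
    ultimately show ?thesis using True by (simp only: solutions_def mem_Collect_eq simp_thms)
  qed (simp add: solutions_def)
  have c1: "a k \<in> carrier G" if "a \<in> {1..n} \<rightarrow>\<^sub>E carrier G" "1 \<le> k" "k \<le> n" for a k
    using that by (auto simp: PiE_iff)
  have r: "q (?f a) = q a" "word_prod (?f a) r = word_prod a r" for a
    using cong[of "?f a" a] by simp_all
  have u: "q (?g b) = q b" "word_prod (?g b) r = word_prod b r" for b
    using cong[of "?g b" b] by simp_all
  show "bij_betw ?f (solutions n (Pos 0 # r)) (fixed_assignments n r)"
  proof (rule bij_betw_byWitness[where f' = ?g])
    show "\<forall>a \<in> solutions n (Pos 0 # r). ?g (?f a) = a"
    proof
      fix a assume "a \<in> solutions n (Pos 0 # r)"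
      then have a: "a \<in> {..n} \<rightarrow>\<^sub>E carrier G" "a 0 = inv (q a)" by (simp_all add: S)
      show "?g (?f a) = a"
      proof
        fix k show "?g (?f a) k = a k"
          using a r(1)[of a] by (auto simp: PiE_iff extensional_def)
      qed
    qed
    show "\<forall>b \<in> fixed_assignments n r. ?f (?g b) = b"
    proof
      fix b assume "b \<in> fixed_assignments n r"
      then have b: "b \<in> {1..n} \<rightarrow>\<^sub>E carrier G" by (simp add: F)
      show "?f (?g b) = b"
      proof
        fix k show "?f (?g b) k = b k" using b by (auto simp: PiE_iff extensional_def)
      qed
    qed
    show "?f ` solutions n (Pos 0 # r) \<subseteq> fixed_assignments n r"
      using r by (auto simp: S F PiE_iff)
    show "?g ` fixed_assignments n r \<subseteq> solutions n (Pos 0 # r)"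
    proof (rule image_subsetI)
      fix b assume "b \<in> fixed_assignments n r"
      then have b: "b \<in> {1..n} \<rightarrow>\<^sub>E carrier G" "q b = word_prod b r" by (simp_all add: F)
      have "q b \<in> carrier G" unfolding q_def by (rule word_prod_closed, rule onr, rule c1[OF b(1)])
      then have "?g b \<in> {..n} \<rightarrow>\<^sub>E carrier G" using b(1) by (auto simp: PiE_iff extensional_def)
      moreover have "?g b 0 = inv (q b)" by simp
      ultimately show "?g b \<in> solutions n (Pos 0 # r)" unfolding S u using b(2) by blast
    qed
  qed
qed

lemma Pr_signed_eqv:
  assumes "finite (carrier G)" "\<pi> \<in> signed_perms n" "\<theta> \<in> signed_perms n" "1 \<le> n"
    and "eqv n (perm_word n \<pi>) (perm_word n \<theta>)"
  shows "Pr_signed G n \<pi> = Pr_signed G n \<theta>"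
proof -
  have v: "valid n (perm_word n \<pi>)" "valid n (perm_word n \<theta>)" using valid_perm_word assms(2,3) by auto
  have "card (fixed_assignments n (tl (perm_word n \<pi>))) = card (solutions n (perm_word n \<pi>))"
    using card_solutions[of n "tl (perm_word n \<pi>)"] v(1) perm_word_Cons[of n \<pi>] by metis
  also have "\<dots> = card (solutions n (perm_word n \<theta>))" using card_solutions_eqv[OF assms(5) v(1) assms(4)] .
  also have "\<dots> = card (fixed_assignments n (tl (perm_word n \<theta>)))"
    using card_solutions[of n "tl (perm_word n \<theta>)"] v(2) perm_word_Cons[of n \<theta>] by metis
  finally show ?thesis using Pr_signed_eq_card assms(1-3) by simp
qed

end

section \<open>Fixed letters at the end and the values of the probabilities\<close>

lemma signed_perms_mono: "n \<le> m \<Longrightarrow> \<pi> \<in> signed_perms n \<Longrightarrow> \<pi> \<in> signed_perms m"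
  unfolding signed_perms_def by (auto elim!: permutes_subset)

lemma perm_word_Suc:
  assumes "\<pi> \<in> signed_perms n"
  shows "perm_word (Suc n) \<pi> = perm_word n \<pi> @ [Pos (Suc n)]"
proof -
  have "\<pi> (int (Suc n)) = int (Suc n)"
    using assms unfolding signed_perms_def by (intro permutes_not_in[of \<pi> "{- int n..int n} - {0}"]) auto
  then have "ext \<pi> (Pos (Suc n)) = Pos (Suc n)" by (simp add: signed_of_int_def nat_add_distrib)
  then show ?thesis by (simp add: perm_word_def del: ext.simps)
qed

text \<open>The fixed letter n + 1 multiplies both sides on the right by the same free element,
  which cancels; both counts gain a factor equal to the order of the group.\<close>

lemma (in group) Pr_signed_Suc:
  assumes "finite (carrier G)" "\<pi> \<in> signed_perms n"
  shows "Pr_signed G (Suc n) \<pi> = Pr_signed G n \<pi>"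
proof -
  define r where "r = tl (perm_word n \<pi>)"
  have w: "perm_word n \<pi> = Pos 0 # r" using perm_word_Cons[of n \<pi>] by (simp only: r_def)
  have tl: "tl (perm_word (Suc n) \<pi>) = r @ [Pos (Suc n)]" using perm_word_Suc[OF assms(2)] w by simp
  have v: "valid n (Pos 0 # r)" using valid_perm_word[OF assms(2)] w by simp
  have lr: "1 \<le> lab u" "lab u \<le> n" if "u \<in> set r" for u
  proof -
    have "lab u \<noteq> 0" using v that by (auto simp: valid_def)
    then show "1 \<le> lab u" by simp
    show "lab u \<le> n" using v that by (auto simp: valid_def)
  qed
  let ?P = "\<lambda>n. {1..n} \<rightarrow>\<^sub>E carrier G"
  have ins: "{1..Suc n} = insert (Suc n) {1..n}" by auto
  have P: "?P (Suc n) = (\<lambda>(g, a). a(Suc n := g)) ` (carrier G \<times> ?P n)"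
    unfolding ins PiE_insert_eq by simp
  have inj: "inj_on (\<lambda>(g, a). a(Suc n := g)) (carrier G \<times> ?P n)"
    using inj_combinator[of "Suc n" "{1..n}" "\<lambda>_. carrier G"] by simp
  have iff: "word_prod (a(Suc n := g)) (map Pos [1..<Suc n + 1]) = word_prod (a(Suc n := g)) (r @ [Pos (Suc n)])
      \<longleftrightarrow> word_prod a (map Pos [1..<n + 1]) = word_prod a r"
    if "a \<in> ?P n" "g \<in> carrier G" for a g
  proof -
    let ?a = "a(Suc n := g)"
    have c: "a k \<in> carrier G" if "1 \<le> k" "k \<le> n" for k using \<open>a \<in> ?P n\<close> that by (auto simp: PiE_iff)
    have on: "on_labels a (map Pos [1..<n + 1])" "on_labels a r"
      using c lr by (auto simp: on_labels_def simp del: upt_Suc)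
    have on': "on_labels ?a (map Pos [1..<n + 1])" "on_labels ?a r"
      using c lr \<open>g \<in> carrier G\<close> by (auto simp: on_labels_def simp del: upt_Suc)
    have eq: "word_prod ?a (map Pos [1..<n + 1]) = word_prod a (map Pos [1..<n + 1])"
      by (rule word_prod_cong) (auto simp del: upt_Suc)
    have eq': "word_prod ?a r = word_prod a r"
      by (rule word_prod_cong) (use lr in fastforce)
    have up: "map Pos [1..<Suc n + 1] = map Pos [1..<n + 1] @ [Pos (Suc n)]" by simp
    have "word_prod ?a (map Pos [1..<n + 1] @ [Pos (Suc n)]) = word_prod a (map Pos [1..<n + 1]) \<otimes> g"
      using word_prod_append[OF on'(1), of "[Pos (Suc n)]"] \<open>g \<in> carrier G\<close> unfolding eq by simp
    moreover have "word_prod ?a (r @ [Pos (Suc n)]) = word_prod a r \<otimes> g"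
      using word_prod_append[OF on'(2), of "[Pos (Suc n)]"] \<open>g \<in> carrier G\<close> unfolding eq' by simp
    ultimately show ?thesis unfolding up using on \<open>g \<in> carrier G\<close> by simp
  qed
  have "fixed_assignments (Suc n) (r @ [Pos (Suc n)]) =
      (\<lambda>(g, a). a(Suc n := g)) ` (carrier G \<times> fixed_assignments n r)"
    unfolding fixed_assignments_def P using iff by (auto simp del: upt_Suc simp: image_iff)
  moreover have "carrier G \<times> fixed_assignments n r \<subseteq> carrier G \<times> ?P n"
    by (auto simp: fixed_assignments_def)
  ultimately have "card (fixed_assignments (Suc n) (r @ [Pos (Suc n)])) = card (carrier G) * card (fixed_assignments n r)"
    using card_image[OF inj_on_subset[OF inj]] by (simp add: card_cartesian_product)
  moreover have "card (?P (Suc n)) = card (carrier G) * card (?P n)"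
    unfolding P using card_image[OF inj] by (simp add: card_cartesian_product)
  moreover have "card (carrier G) \<noteq> 0" using assms(1) by auto
  ultimately show ?thesis
    using Pr_signed_eq_card[OF assms] Pr_signed_eq_card[OF assms(1) signed_perms_mono[OF _ assms(2)], of "Suc n"]
    unfolding tl r_def[symmetric] by simp
qed

lemma (in group) Pr_signed_mono:
  assumes "finite (carrier G)" "\<pi> \<in> signed_perms n" "n \<le> m"
  shows "Pr_signed G m \<pi> = Pr_signed G n \<pi>"
  using assms(3)
proof (induction rule: dec_induct)
  case (step k)
  then show ?case using Pr_signed_Suc[OF assms(1) signed_perms_mono[OF step(1) assms(2)]] by simp
qed simp

lemma (in group) Pr_power_rev:
  assumes "\<pi> \<in> signed_perms m" "perm_word m \<pi> = map Pos (0 # rev [1..<m + 1])"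
  shows "Pr_signed G m \<pi> = Pr_power G (int m)"
  unfolding Pr_signed_eq_prob[OF assms(1)] Pr_power_def using assms(2)
  by (simp add: o_def rev_map del: upt_Suc)

lemma (in group) Pr_power_crosscaps:
  assumes "\<pi> \<in> signed_perms m" "perm_word m \<pi> = crosscaps m m" "1 \<le> m"
  shows "Pr_signed G m \<pi> = Pr_power G (- int m)"
  unfolding Pr_signed_eq_prob[OF assms(1)] Pr_power_def using assms(2,3)
  by (simp add: crosscaps_def o_def del: upt_Suc)

lemma num_cycles_mono:
  assumes "\<pi> \<in> signed_perms m" "m \<le> n"
  shows "num_cycles n \<pi> = num_cycles m \<pi> + (n - m)"
  using assms(2)
proof (induction rule: dec_induct)
  case (step n)
  have \<pi>: "\<pi> \<in> signed_perms n" "\<pi> \<in> signed_perms (Suc n)"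
    using signed_perms_mono[OF _ assms(1)] step(1) by simp_all
  obtain r where r: "perm_word n \<pi> = Pos 0 # r" using perm_word_Cons by blast
  then have "word_comps (Suc n) (perm_word (Suc n) \<pi>) = Suc (word_comps n (perm_word n \<pi>))"
    using word_comps_digon[of n r] valid_perm_word[OF \<pi>(1)] perm_word_Suc[OF \<pi>(1)] by simp
  then show ?case using step num_cycles_word_comps[OF \<pi>(1)] num_cycles_word_comps[OF \<pi>(2)] by simp
qed simp

text \<open>The normal form has j + 1 cycles and n + 1 = (j + 1) + 2 g letters. This evenness
  matches the exponent with a number of handles.\<close>

lemma list_comps_parity:
  assumes "vlist n l" "2 \<le> list_comps n l"
  shows "\<exists>g. Suc n = list_comps n l + 2 * g"
  using slide_canonical[OF assms(1)]
proof (elim disjE exE conjE)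
  fix j g assume "n = j + 2 * g" "slide n l ([0..<j + 1] @ handles j g)"
  then show ?thesis
    using list_comps_slide[OF assms(1)] list_comps_canonical[of j g] by (metis add_Suc)
next
  fix h g assume "2 \<le> h" "n = 2 * h + 2 * g" "slide n l (special h @ handles (2 * h) g)"
  then show ?thesis
    using list_comps_slide[OF assms(1)] list_comps_special_handles[of h g] assms(2) by auto
qed

lemma (in group) Pr_signed_orientable:
  assumes fin: "finite (carrier G)" and \<pi>: "\<pi> \<in> signed_perms n" "neg_count n \<pi> = 0"
  shows "Pr_signed G n \<pi> = Pr_power G (int n - int (num_cycles n \<pi>) + 1)"
proof -
  let ?N = "Suc n" and ?k = "num_cycles n \<pi>"
  obtain l where l: "perm_word n \<pi> = map Pos l" "vlist n l" using perm_word_positive \<pi> by blast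
  have \<pi>N: "\<pi> \<in> signed_perms ?N" using signed_perms_mono[OF _ \<pi>(1)] by simp
  have w: "perm_word ?N \<pi> = map Pos (l @ [?N])" using perm_word_Suc[OF \<pi>(1)] l by simp
  have v: "vlist ?N (l @ [?N])" using valid_perm_word[OF \<pi>N] valid_map_Pos_vlist unfolding w by blast
  have k: "list_comps ?N (l @ [?N]) = Suc ?k"
    using num_cycles_mono[OF \<pi>(1), of ?N] num_cycles_word_comps[OF \<pi>N] unfolding w by simp
  have k1: "1 \<le> ?k" using num_cycles_positive[OF \<pi>(1)] by simp
  then obtain g where g: "Suc n = ?k + 2 * g" using list_comps_parity[OF v] k by auto
  define m where "m = 2 * g"
  have mn: "m \<le> n" "n - m + 1 = ?k" using g k1 by (auto simp: m_def)
  let ?r = "0 # rev [1..<m + 1]"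
  have "set [1..<m + 1] = {1..m}" by auto
  moreover have "insert 0 {1..m} = {..m}" by auto
  ultimately have "vlist m ?r" by (simp add: vlist_def del: upt_Suc)
  then have "valid m (map Pos ?r)" using valid_map_Pos_vlist by blast
  \<comment> \<open>The comparison permutation reverses 1, ..., m, which is the equation of exponent
    m, and has one cycle. Fixing the n + 1 - m = k remaining letters adds k cycles, giving the same
    count k + 1 as for \<pi>.\<close>
  then obtain \<rho> where \<rho>: "\<rho> \<in> signed_perms m" "perm_word m \<rho> = map Pos ?r" using ex_perm_word[of m "map Pos ?r"] by auto
  have \<rho>N: "\<rho> \<in> signed_perms ?N" "neg_count ?N \<rho> = 0"
  proof -
    show mem: "\<rho> \<in> signed_perms ?N" using signed_perms_mono[OF _ \<rho>(1)] mn by simp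
    have "perm_word n' \<rho> = map Pos (?r @ [m + 1..<n' + 1])" if "m \<le> n'" for n'
      using that
    proof (induction rule: dec_induct)
      case (step n')
      then show ?case using perm_word_Suc[OF signed_perms_mono[OF step(1) \<rho>(1)]] by simp
    qed (use \<rho>(2) in simp)
    then have "\<nexists>i. Neg i \<in> set (perm_word ?N \<rho>)" using mn by auto
    then show "neg_count ?N \<rho> = 0" using Neg_in_perm_word[OF mem] by simp
  qed
  obtain l' where l': "perm_word ?N \<rho> = map Pos l'" "vlist ?N l'" using perm_word_positive \<rho>N by blast
  have "num_cycles m \<rho> = 1"
    using num_cycles_word_comps[OF \<rho>(1)] word_comps_rev[of g] \<rho>(2) by (simp add: m_def)
  then have "list_comps ?N l' = Suc ?k"
    using num_cycles_mono[OF \<rho>(1), of ?N] num_cycles_word_comps[OF \<rho>N(1)] mn unfolding l' by simp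
  then have "slide ?N (l @ [?N]) l'" using slide_of_list_comps[OF v l'(2)] k k1 by simp
  then have "eqv ?N (perm_word ?N \<pi>) (perm_word ?N \<rho>)" unfolding w l' by (rule slide_eqv)
  then have "Pr_signed G ?N \<pi> = Pr_signed G ?N \<rho>" using Pr_signed_eqv[OF fin \<pi>N \<rho>N(1)] by simp
  then have "Pr_signed G n \<pi> = Pr_signed G m \<rho>"
    using Pr_signed_Suc[OF fin \<pi>(1)] Pr_signed_mono[OF fin \<rho>(1), of ?N] mn by simp
  also have "\<dots> = Pr_power G (int m)" using Pr_power_rev[OF \<rho>] .
  also have "int m = int n - int ?k + 1" using mn by simp
  finally show ?thesis .
qed

lemma (in group) Pr_signed_nonorientable:
  assumes fin: "finite (carrier G)" and \<pi>: "\<pi> \<in> signed_perms n" "0 < neg_count n \<pi>"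
  shows "Pr_signed G n \<pi> = Pr_power G (- (int n - int (num_cycles n \<pi>) + 1))"
proof -
  define m where "m = Suc n - num_cycles n \<pi>"
  have m: "1 \<le> m" "m \<le> n"
    using crosscaps_eqv_perm(1)[OF \<pi>] num_cycles_positive[OF \<pi>(1)] by (auto simp: m_def)
  \<comment> \<open>The word -1 ... -m is the equation of exponent -m; extended by fixed letters it
    is the crosscap normal form of \<pi>.\<close>
  obtain \<rho> where \<rho>: "\<rho> \<in> signed_perms m" "perm_word m \<rho> = crosscaps m m"
    using ex_perm_word[OF valid_crosscaps[of m m]] by (auto simp: crosscaps_def)
  have "perm_word n' \<rho> = crosscaps n' m" if "m \<le> n'" for n'
    using that
  proof (induction rule: dec_induct)
    case (step n')
    then show ?case using perm_word_Suc[OF signed_perms_mono[OF step(1) \<rho>(1)]] crosscaps_Suc by simp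
  qed (use \<rho>(2) in simp)
  then have "eqv n (perm_word n \<pi>) (perm_word n \<rho>)" using crosscaps_eqv_perm(2)[OF \<pi>] m by (simp add: m_def)
  then have "Pr_signed G n \<pi> = Pr_signed G n \<rho>"
    using Pr_signed_eqv[OF fin \<pi>(1) signed_perms_mono[OF m(2) \<rho>(1)]] m by simp
  also have "\<dots> = Pr_power G (- int m)"
    using Pr_signed_mono[OF fin \<rho>(1) m(2)] Pr_power_crosscaps[OF \<rho> m(1)] by simp
  also have "int m = int n - int (num_cycles n \<pi>) + 1"
    using crosscaps_eqv_perm(1)[OF \<pi>] by (simp add: m_def)
  finally show ?thesis .
qed

theorem theorem5p6:
  fixes n k :: nat and \<pi> \<theta> :: "int \<Rightarrow> int"
  assumes "n \<ge> 1"
    and "\<pi> \<in> signed_perms n" and "\<theta> \<in> signed_perms n"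
    and "num_cycles n \<pi> = k" and "num_cycles n \<theta> = k"
  shows
    "(neg_count n \<pi> = 0 \<and> neg_count n \<theta> = 0 \<longrightarrow>
        op_equivalent n \<pi> \<theta> \<and>
        (\<forall>G :: ('g, 'r) monoid_scheme. group G \<and> finite (carrier G) \<longrightarrow>
           Pr_signed G n \<pi> = Pr_signed G n \<theta> \<and>
           Pr_signed G n \<theta> = Pr_power G (int n - int k + 1)))
   \<and> (neg_count n \<pi> > 0 \<and> neg_count n \<theta> > 0 \<longrightarrow>
        op_equivalent n \<pi> \<theta> \<and>
        (\<forall>G :: ('g, 'r) monoid_scheme. group G \<and> finite (carrier G) \<longrightarrow>
           Pr_signed G n \<pi> = Pr_signed G n \<theta> \<and>
           Pr_signed G n \<theta> = Pr_power G (- (int n - int k + 1))))"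
proof (intro conjI impI allI; elim conjE)
  assume "neg_count n \<pi> = 0" "neg_count n \<theta> = 0"
  then show "op_equivalent n \<pi> \<theta>" using op_equivalent_orientable assms by simp
next
  fix G :: "('g, 'r) monoid_scheme"
  assume "neg_count n \<pi> = 0" "neg_count n \<theta> = 0" "group G" "finite (carrier G)"
  then show "Pr_signed G n \<pi> = Pr_signed G n \<theta>" "Pr_signed G n \<theta> = Pr_power G (int n - int k + 1)"
    using group.Pr_signed_orientable assms by metis+
next
  assume "neg_count n \<pi> > 0" "neg_count n \<theta> > 0"
  then show "op_equivalent n \<pi> \<theta>" using op_equivalent_nonorientable assms by simp
next
  fix G :: "('g, 'r) monoid_scheme"
  assume "neg_count n \<pi> > 0" "neg_count n \<theta> > 0" "group G" "finite (carrier G)"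
  then show "Pr_signed G n \<pi> = Pr_signed G n \<theta>" "Pr_signed G n \<theta> = Pr_power G (- (int n - int k + 1))"
    using group.Pr_signed_nonorientable assms by metis+
qed

end
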